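(* For every $\tau<3$, there exists an axisymmetric solution $(U_\theta,U_\phi)$ with nonzero swirl of the stationary Navier-Stokes equations in $C^\infty(\mathbb{S}^2\setminus\{S\})$ such that $U_\theta(-1)=\tau$. On the other hand, every axisymmetric solution $(U_\theta,U_\phi)$ of the stationary Navier-Stokes equations in $C^\infty(\mathbb{S}^2\setminus\{S\})$ with $U_\theta(-1)\ge3$ necessarily has zero swirl, i.e. $U_\phi\equiv0$.
   Context: The stationary incompressible Navier-Stokes equations in $\mathbb{R}^3$ are $-\Delta u+u\cdot\nabla u+\nabla p=0$, $\operatorname{div}u=0$; solutions considered are $(-1)$-homogeneous in $u$, $(-2)$-homogeneous in $p$, and axisymmetric: in spherical coordinates $(r,\theta,\phi)$ with $\theta$ the angle from the positive $x_3$-axis, $u=u_re_r+u_\theta e_\theta+u_\phi e_\phi$ with components independent of $\phi$. $S$ is the south pole of $\mathbb{S}^2$. Set $x=\cos\theta$, $U_\theta=u_\theta\sin\theta$, $U_\phi=u_\phi\sin\theta$ on $\mathbb{S}^2$; the divergence-free condition gives $u_r=dU_\theta/dx$. Saying that $(U_\theta,U_\phi)$ is a solution in $C^\infty(\mathbb{S}^2\setminus\{S\})$ means that the vector field $u$ on $\mathbb{S}^2\setminus\{S\}$ with $u_r=U_\theta'$, $u_\theta=U_\theta/\sin\theta$, $u_\phi=U_\phi/\sin\theta$ is smooth there and its $(-1)$-homogeneous extension satisfies the Navier-Stokes equations in $\mathbb{R}^3\setminus\{(0,0,x_3):x_3\le0\}$. $U_\theta(-1):=\lim_{x\to-1^+}U_\theta(x)$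 (the limit exists and is finite for every such solution). Nonzero swirl means $U_\phi\not\equiv0$. *)

theory Defs
  imports "HOL-Analysis.Analysis"
begin

definition partial_deriv ::
  "'n::finite \<Rightarrow> (real^'n \<Rightarrow> 'b::real_normed_vector) \<Rightarrow> real^'n \<Rightarrow> 'b" where
  "partial_deriv i f x = frechet_derivative f (at x) (axis i 1)"

text \<open>The two predicates below are meant for open sets \<open>S\<close> only: derivatives are
  taken with respect to the full space.\<close>

primrec Ck_on :: "nat \<Rightarrow> (real^'n::finite \<Rightarrow> 'b::real_normed_vector) \<Rightarrow> (real^'n) set \<Rightarrow> bool" where
  "Ck_on 0 f S \<longleftrightarrow> continuous_on S f"
| "Ck_on (Suc k) f S \<longleftrightarrow>
     (\<forall>x\<in>S. f differentiable (at x)) \<and> (\<forall>i. Ck_on k (partial_deriv i f) S)"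

definition smooth_on :: "(real^'n::finite \<Rightarrow> 'b::real_normed_vector) \<Rightarrow> (real^'n) set \<Rightarrow> bool" where
  "smooth_on f S \<longleftrightarrow> (\<forall>k. Ck_on k f S)"

definition laplacian :: "(real^'n::finite \<Rightarrow> 'b::real_normed_vector) \<Rightarrow> real^'n \<Rightarrow> 'b" where
  "laplacian f x = (\<Sum>i\<in>UNIV. partial_deriv i (partial_deriv i f) x)"

definition gradient :: "(real^'n::finite \<Rightarrow> real) \<Rightarrow> real^'n \<Rightarrow> real^'n" where
  "gradient p x = (\<chi> i. partial_deriv i p x)"

definition divergence :: "(real^'n::finite \<Rightarrow> real^'n) \<Rightarrow> real^'n \<Rightarrow> real" where
  "divergence u x = (\<Sum>i\<in>UNIV. partial_deriv i u x $ i)"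

definition convection :: "(real^'n::finite \<Rightarrow> real^'n) \<Rightarrow> real^'n \<Rightarrow> real^'n" where
  "convection u x = (\<Sum>j\<in>UNIV. (u x $ j) *\<^sub>R partial_deriv j u x)"

definition stationary_NS_on ::
  "(real^3 \<Rightarrow> real^3) \<Rightarrow> (real^3 \<Rightarrow> real) \<Rightarrow> (real^3) set \<Rightarrow> bool" where
  "stationary_NS_on u p S \<longleftrightarrow>
     (\<forall>x\<in>S. - laplacian u x + convection u x + gradient p x = 0 \<and> divergence u x = 0)"

definition homogeneous_on ::
  "int \<Rightarrow> (real^3 \<Rightarrow> 'b::real_vector) \<Rightarrow> (real^3) set \<Rightarrow> bool" where
  "homogeneous_on m f S \<longleftrightarrow> (\<forall>x\<in>S. \<forall>c>0. f (c *\<^sub>R x) = (c powi m) *\<^sub>R f x)"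

text \<open>The cone over the unit sphere minus its south pole.\<close>

definition slit_space :: "(real^3) set" where
  "slit_space = - {x. x $ 1 = 0 \<and> x $ 2 = 0 \<and> x $ 3 \<le> 0}"

definition e_r :: "real \<Rightarrow> real \<Rightarrow> real^3" where
  "e_r \<theta> \<phi> = vector [sin \<theta> * cos \<phi>, sin \<theta> * sin \<phi>, cos \<theta>]"

definition e_theta :: "real \<Rightarrow> real \<Rightarrow> real^3" where
  "e_theta \<theta> \<phi> = vector [cos \<theta> * cos \<phi>, cos \<theta> * sin \<phi>, - sin \<theta>]"

definition e_phi :: "real \<Rightarrow> real \<Rightarrow> real^3" where
  "e_phi \<theta> \<phi> = vector [- sin \<phi>, cos \<phi>, 0]"

text \<open>\<open>U\<^sub>\<theta>\<close> and \<open>U\<^sub>\<phi>\<close> are functions of \<open>x = cos \<theta>\<close>; only their values on \<open>(-1, 1)\<close> matter.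
  The point \<open>e_r \<theta> \<phi>\<close> runs over the unit sphere without its two poles; at the north pole,
  where the spherical frame degenerates, \<open>u\<close> is determined by continuity.
  For homogeneous \<open>u\<close>, smoothness on \<open>slit_space\<close> amounts to smoothness on the sphere
  minus the south pole. It forces \<open>U\<^sub>\<theta> (cos \<theta>) = sin \<theta> * (u \<bullet> e_theta)\<close> to be smooth on
  \<open>(-1, 1)\<close>, so \<open>deriv\<close> is never applied to a non-differentiable function.\<close>

definition axisymmetric_NS_solution :: "(real \<Rightarrow> real) \<Rightarrow> (real \<Rightarrow> real) \<Rightarrow> bool" where
  "axisymmetric_NS_solution U\<^sub>\<theta> U\<^sub>\<phi> \<longleftrightarrow>
     (\<exists>(u :: real^3 \<Rightarrow> real^3) (p :: real^3 \<Rightarrow> real).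
        smooth_on u slit_space \<and> smooth_on p slit_space \<and>
        homogeneous_on (-1) u slit_space \<and> homogeneous_on (-2) p slit_space \<and>
        stationary_NS_on u p slit_space \<and>
        (\<forall>\<theta> \<phi>. 0 < \<theta> \<and> \<theta> < pi \<longrightarrow>
           u (e_r \<theta> \<phi>) = deriv U\<^sub>\<theta> (cos \<theta>) *\<^sub>R e_r \<theta> \<phi>
                      + (U\<^sub>\<theta> (cos \<theta>) / sin \<theta>) *\<^sub>R e_theta \<theta> \<phi>
                      + (U\<^sub>\<phi> (cos \<theta>) / sin \<theta>) *\<^sub>R e_phi \<theta> \<phi>))"

definition zero_swirl :: "(real \<Rightarrow> real) \<Rightarrow> bool" where
  "zero_swirl U\<^sub>\<phi> \<longleftrightarrow> (\<forall>x\<in>{-1<..<1}. U\<^sub>\<phi> x = 0)"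

end

theory Submission imports Defs begin

text \<open>Put \<open>U\<^sub>\<theta> = (1 - x\<^sup>2) g\<close> and \<open>U\<^sub>\<phi> = (1 - x\<^sup>2) k\<close>. Away from the axis a homogeneous axisymmetric
  divergence-free field is \<open>A X / |X|\<^sup>2 - g e\<^sub>3 / |X| + k (e\<^sub>3 \<times> X) / |X|\<^sup>2\<close> with
  \<open>A = (1 - x\<^sup>2) g' - x g\<close> and \<open>x = X\<^sub>3 / |X|\<close>. After elimination of the pressure the Navier-Stokes
  equations become \<open>U\<^sub>\<phi>'' + g U\<^sub>\<phi>' = 0\<close> and \<open>H''' = - 2 U\<^sub>\<phi> U\<^sub>\<phi>' / (1 - x\<^sup>2)\<close>, where
  \<open>H = (1 - x\<^sup>2) U\<^sub>\<theta>' + 2 x U\<^sub>\<theta> + U\<^sub>\<theta>\<^sup>2 / 2\<close>.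

  If the swirl does not vanish, \<open>U\<^sub>\<phi>'\<close> has a constant sign and \<open>U\<^sub>\<phi>\<close> the opposite one, so
  \<open>H''' \<ge> 0\<close>. Hence \<open>H'\<close> is bounded below near \<open>-1\<close>, and \<open>H\<close> exceeds its limit at \<open>-1\<close> up to
  \<open>O(1 + x)\<close>. For \<open>\<tau> \<ge> 3\<close> the equation for \<open>U\<^sub>\<theta>\<close> then gives \<open>U\<^sub>\<theta> \<ge> 3 - C (1 + x)\<close>, so
  \<open>|U\<^sub>\<phi>'| \<ge> c (1 + x) powr (-3/2)\<close> and \<open>H''' \<ge> c / (1 + x)\<^sup>3\<close>, which drives \<open>H\<close> to \<open>-\<infinity>\<close>.

  For \<open>\<tau> = 4 \<alpha> < 3\<close> let \<open>y = 1 + x\<close> and \<open>g = 2 w' / w\<close>. This linearizes the Riccati equation for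
  \<open>U\<^sub>\<theta>\<close> to \<open>w'' = (\<alpha> (\<alpha> - 1) / y\<^sup>2 + \<epsilon> K) w\<close>, with \<open>U\<^sub>\<phi>' = - sqrt \<epsilon> / w\<^sup>2\<close> and \<open>K\<close> obtained from
  \<open>w\<close> by integrating \<open>U\<^sub>\<phi> U\<^sub>\<phi>' / (1 - x\<^sup>2)\<close> three times. Since \<open>\<alpha> < 3/4\<close>, \<open>K\<close> is less singular than
  \<open>1 / y\<^sup>2\<close>, and for small \<open>\<epsilon>\<close> the contraction principle yields \<open>w = y powr \<alpha> * m\<close> with \<open>m\<close> close to 1.
  The problem is solved on \<open>0 < y < 3\<close>, that is, beyond the north pole \<open>y = 2\<close>: this makes the
  velocity smooth across the positive axis.\<close>

section \<open>Finite smoothness in one variable\<close>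

text \<open>The threshold is where the swirl source stops being three times integrable. If
  \<open>U\<^sub>\<theta>\<close> tends to \<tau> at the south pole, then g ~ \<tau> / (2 (1 + x)),
  so \<open>U\<^sub>\<phi>'\<close> has size (1 + x)^(-\<tau>/2) and, for \<tau> > 2,
  \<open>H'''\<close> has size (1 + x)^(-\<tau>). For \<tau> < 3 three integrations leave H bounded
  near x = -1; at \<tau> = 3 they produce a logarithm, which is incompatible with a finite limit of
  \<open>U\<^sub>\<theta>\<close>. At \<tau> = 3 this heuristic needs a rate: convergence alone
  would leave slowly varying factors in \<open>U\<^sub>\<phi>'\<close>, hence the linear lower bound
  for \<open>U\<^sub>\<theta>\<close>. For existence, H has the limit \<tau>^2 / 2 - 2 \<tau> = 8
  \<alpha> (\<alpha> - 1), the same for \<tau> and 4 - \<tau>. The equation for w accordingly has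
  the exponents \<alpha> and 1 - \<alpha> at y = 0, and prescribing \<tau> means selecting the first
  one. It belongs to the dominant solution for \<alpha> < 1/2 and to the recessive one for \<alpha>
  \<ge> 1/2, so the antiderivative that yields m' is normalized at different points in the two
  ranges.\<close>

primrec Ck_real :: "nat \<Rightarrow> (real \<Rightarrow> real) \<Rightarrow> real set \<Rightarrow> bool" where
  "Ck_real 0 f S \<longleftrightarrow> continuous_on S f"
| "Ck_real (Suc k) f S \<longleftrightarrow>
     (\<exists>f'. (\<forall>x\<in>S. (f has_field_derivative f' x) (at x)) \<and> Ck_real k f' S)"

lemma Ck_real_imp_continuous_on: "Ck_real k f S \<Longrightarrow> continuous_on S f"
  by (cases k) (auto intro!: continuous_at_imp_continuous_on intro: DERIV_isCont)

lemma Ck_real_SucD: "Ck_real (Suc k) f S \<Longrightarrow> Ck_real k f S"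
proof (induction k arbitrary: f)
  case 0
  then show ?case using Ck_real_imp_continuous_on[of "Suc 0"] by simp
next
  case (Suc k)
  then obtain f' where f': "\<forall>x\<in>S. (f has_field_derivative f' x) (at x)" "Ck_real (Suc k) f' S"
    by auto
  from Suc.IH[OF f'(2)] f'(1) show ?case by auto
qed

lemma Ck_real_cong:
  assumes "open S" "\<And>x. x \<in> S \<Longrightarrow> f x = g x" "Ck_real k f S"
  shows "Ck_real k g S"
proof (cases k)
  case 0
  then show ?thesis using assms continuous_on_cong[of S S f g] by simp
next
  case (Suc n)
  then obtain f' where f': "\<forall>x\<in>S. (f has_field_derivative f' x) (at x)" "Ck_real n f' S"
    using assms by auto
  have "(g has_field_derivative f' x) (at x)" if "x \<in> S" for x
    using has_field_derivative_transform_within_open[of f "f' x" x S g] f' assms that by auto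
  with f' Suc show ?thesis by auto
qed

lemma Ck_real_const: "Ck_real k (\<lambda>x. c) S"
proof (induction k arbitrary: c)
  case (Suc k)
  then show ?case by (auto intro!: exI[of _ "\<lambda>x. 0"])
qed auto

lemma Ck_real_id: "Ck_real k (\<lambda>x. x) S"
proof (cases k)
  case (Suc n)
  then show ?thesis using Ck_real_const by (auto intro!: exI[of _ "\<lambda>x. 1"])
qed auto

lemma Ck_real_add: "Ck_real k f S \<Longrightarrow> Ck_real k g S \<Longrightarrow> Ck_real k (\<lambda>x. f x + g x) S"
proof (induction k arbitrary: f g)
  case 0
  then show ?case by (auto intro: continuous_intros)
next
  case (Suc k)
  then obtain f' g' where "\<forall>x\<in>S. (f has_field_derivative f' x) (at x)" "Ck_real k f' S"
     "\<forall>x\<in>S. (g has_field_derivative g' x) (at x)" "Ck_real k g' S" by auto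
  then show ?case using Suc.IH by (auto intro!: exI[of _ "\<lambda>x. f' x + g' x"] derivative_intros)
qed

lemma Ck_real_mult: "Ck_real k f S \<Longrightarrow> Ck_real k g S \<Longrightarrow> Ck_real k (\<lambda>x. f x * g x) S"
proof (induction k arbitrary: f g)
  case 0
  then show ?case by (auto intro: continuous_intros)
next
  case (Suc k)
  then obtain f' g' where *: "\<forall>x\<in>S. (f has_field_derivative f' x) (at x)" "Ck_real k f' S"
     "\<forall>x\<in>S. (g has_field_derivative g' x) (at x)" "Ck_real k g' S" by auto
  have "Ck_real k (\<lambda>x. f' x * g x + g' x * f x) S"
    using Suc.prems[THEN Ck_real_SucD] * by (auto intro!: Ck_real_add Suc.IH)
  with * show ?case
    by (auto intro!: exI[of _ "\<lambda>x. f' x * g x + g' x * f x"] DERIV_mult)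
qed

lemma Ck_real_cmult: "Ck_real k f S \<Longrightarrow> Ck_real k (\<lambda>x. c * f x) S"
  by (intro Ck_real_mult Ck_real_const)

lemma Ck_real_minus: "Ck_real k f S \<Longrightarrow> Ck_real k (\<lambda>x. - f x) S"
  using Ck_real_cmult[of k f S "-1"] by simp

lemma Ck_real_diff: "Ck_real k f S \<Longrightarrow> Ck_real k g S \<Longrightarrow> Ck_real k (\<lambda>x. f x - g x) S"
  using Ck_real_add[of k f S "\<lambda>x. - g x"] Ck_real_minus by simp

lemma Ck_real_power: "Ck_real k f S \<Longrightarrow> Ck_real k (\<lambda>x. f x ^ n) S"
  by (induction n) (auto intro: Ck_real_const Ck_real_mult)

lemma Ck_real_sum: "(\<And>i. i \<in> I \<Longrightarrow> Ck_real k (f i) S) \<Longrightarrow> Ck_real k (\<lambda>x. \<Sum>i\<in>I. f i x) S"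
  by (induction I rule: infinite_finite_induct) (auto intro: Ck_real_const Ck_real_add)

lemma Ck_real_compose:
  "Ck_real k f S \<Longrightarrow> Ck_real k g T \<Longrightarrow> f ` S \<subseteq> T \<Longrightarrow> Ck_real k (\<lambda>x. g (f x)) S"
proof (induction k arbitrary: g)
  case 0
  then show ?case by (auto intro: continuous_on_compose2)
next
  case (Suc k)
  then obtain f' g' where *: "\<forall>x\<in>S. (f has_field_derivative f' x) (at x)" "Ck_real k f' S"
     "\<forall>x\<in>T. (g has_field_derivative g' x) (at x)" "Ck_real k g' T" by auto
  have "Ck_real k (\<lambda>x. g' (f x) * f' x) S"
    using Ck_real_SucD[OF Suc.prems(1)] Suc.prems(3) * Suc.IH[of g'] by (intro Ck_real_mult) auto
  moreover have "((\<lambda>x. g (f x)) has_field_derivative g' (f x) * f' x) (at x)" if "x \<in> S" for x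
    by (rule DERIV_chain2) (use * Suc.prems(3) that in auto)
  ultimately show ?case unfolding Ck_real.simps by (intro exI[of _ "\<lambda>x. g' (f x) * f' x"]) blast
qed

lemma Ck_real_powr: "S \<subseteq> {0<..} \<Longrightarrow> Ck_real k (\<lambda>x. x powr a) S"
proof (induction k arbitrary: a)
  case 0
  then show ?case by (auto intro!: continuous_intros)
next
  case (Suc k)
  have "Ck_real k (\<lambda>x. a * x powr (a - 1)) S" using Suc by (auto intro: Ck_real_cmult)
  then show ?case using Suc.prems
    by (auto intro!: exI[of _ "\<lambda>x. a * x powr (a - 1)"] derivative_eq_intros simp: powr_diff)
qed

lemma Ck_real_inverse:
  assumes "open S" "Ck_real k f S" "\<And>x. x \<in> S \<Longrightarrow> f x > 0"
  shows "Ck_real k (\<lambda>x. 1 / f x) S"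
proof -
  have "Ck_real k (\<lambda>x. f x powr (-1)) S"
    by (rule Ck_real_compose[OF assms(2) Ck_real_powr[of "{0<..}"]]) (use assms in auto)
  then show ?thesis
    by (rule Ck_real_cong[OF assms(1), rotated]) (use assms(3) in \<open>auto simp: powr_minus field_simps intro: abs_of_pos\<close>)
qed

text \<open>The witness in \<open>Ck_real\<close> is existential at every order; uniqueness of
  derivatives identifies all of them with iterates of \<open>deriv\<close>, which gives one coherent
  sequence.\<close>

lemma Ck_real_derivs:
  assumes "open S" "\<And>k. Ck_real k f S"
  obtains D where "D 0 = f" "\<And>n x. x \<in> S \<Longrightarrow> (D n has_field_derivative D (Suc n) x) (at x)"
proof
  define D where "D n = (deriv ^^ n) f" for n
  show "D 0 = f" by (simp add: D_def)
  have *: "Ck_real k (D n) S" for k n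
  proof (induction n arbitrary: k)
    case 0
    then show ?case using assms by (simp add: D_def)
  next
    case (Suc n)
    from Suc[of "Suc k"] obtain f' where
      f': "\<forall>x\<in>S. (D n has_field_derivative f' x) (at x)" "Ck_real k f' S" by auto
    moreover from f' have "f' x = D (Suc n) x" if "x \<in> S" for x
      using that f'(1) DERIV_imp_deriv[of "D n" "f' x" x] by (simp add: D_def)
    ultimately show ?case using Ck_real_cong[OF assms(1), of f' "D (Suc n)"] by blast
  qed
  show "(D n has_field_derivative D (Suc n) x) (at x)" if "x \<in> S" for n x
    using *[of "Suc 0" n] that by (auto simp: D_def DERIV_imp_deriv)
qed

lemma Ck_real_four_derivs:
  assumes "open S" "\<And>k. Ck_real k f S"
  obtains f1 f2 f3 f4 where "\<And>x. x \<in> S \<Longrightarrow> (f has_field_derivative f1 x) (at x) \<and>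
      (f1 has_field_derivative f2 x) (at x) \<and> (f2 has_field_derivative f3 x) (at x) \<and>
      (f3 has_field_derivative f4 x) (at x)"
proof -
  obtain D where D: "D 0 = f" "\<And>n x. x \<in> S \<Longrightarrow> (D n has_field_derivative D (Suc n) x) (at x)"
    using Ck_real_derivs[OF assms] by blast
  show ?thesis
    by (rule that[of "D 1" "D 2" "D 3" "D 4"])
       (use D(2)[of _ 0] D(2)[of _ 1] D(2)[of _ 2] D(2)[of _ 3] in
         \<open>simp add: D(1) numeral_eq_Suc\<close>)
qed

section \<open>Finite smoothness in several variables\<close>

text \<open>\<open>Ck_on\<close> applies \<open>partial_deriv\<close> to the function itself; an
  existential witness \<open>F\<close>, as in \<open>Ck_real\<close>, lets the closure rules supply
  derivatives by the product and chain rules. On open sets the two notions agree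
  (\<open>Ck_vec_eq_Ck_on\<close>).\<close>

primrec Ck_vec :: "nat \<Rightarrow> (real^'n::finite \<Rightarrow> 'b::real_normed_vector) \<Rightarrow> (real^'n) set \<Rightarrow> bool" where
  "Ck_vec 0 f S \<longleftrightarrow> continuous_on S f"
| "Ck_vec (Suc k) f S \<longleftrightarrow>
     (\<exists>F. (\<forall>x\<in>S. (f has_derivative (\<lambda>h. \<Sum>i\<in>UNIV. (h $ i) *\<^sub>R F i x)) (at x)) \<and>
          (\<forall>i. Ck_vec k (F i) S))"

lemma Ck_vec_imp_continuous_on: "Ck_vec k f S \<Longrightarrow> continuous_on S f"
  by (cases k) (auto intro!: continuous_at_imp_continuous_on intro: has_derivative_continuous)

lemma linear_axis_expansion:
  fixes D :: "real^'n::finite \<Rightarrow> 'b::real_normed_vector"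
  assumes "linear D"
  shows "D h = (\<Sum>i\<in>UNIV. (h $ i) *\<^sub>R D (axis i 1))"
proof -
  have "D h = D (\<Sum>i\<in>UNIV. (h $ i) *\<^sub>R axis i 1)"
    using basis_expansion[of h] by (simp add: scalar_mult_eq_scaleR)
  also have "\<dots> = (\<Sum>i\<in>UNIV. (h $ i) *\<^sub>R D (axis i 1))"
    using assms by (simp add: linear_sum linear_cmul)
  finally show ?thesis .
qed

lemma partial_deriv_cong_open:
  assumes "open S" "X \<in> S" "\<And>Y. Y \<in> S \<Longrightarrow> f Y = g Y"
  shows "partial_deriv i f X = partial_deriv i g X"
proof -
  have "(f has_derivative D) (at X) \<longleftrightarrow> (g has_derivative D) (at X)" for D
    using has_derivative_transform_within_open[OF _ assms(1,2), of f D UNIV g]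
      has_derivative_transform_within_open[OF _ assms(1,2), of g D UNIV f] assms(3) by auto
  then show ?thesis by (simp add: partial_deriv_def frechet_derivative_def)
qed

lemma Ck_on_cong:
  assumes "open S" "\<And>x. x \<in> S \<Longrightarrow> f x = g x"
  shows "Ck_on k f S \<longleftrightarrow> Ck_on k g S"
  using assms(2)
proof (induction k arbitrary: f g)
  case 0
  then show ?case by (auto cong: continuous_on_cong)
next
  case (Suc k)
  have "Ck_on k (partial_deriv i f) S \<longleftrightarrow> Ck_on k (partial_deriv i g) S" for i
    by (rule Suc.IH) (rule partial_deriv_cong_open[OF assms(1) _ Suc.prems])
  moreover have "f differentiable (at x) \<longleftrightarrow> g differentiable (at x)" if "x \<in> S" for x
    unfolding differentiable_def
    using has_derivative_transform_within_open[OF _ assms(1) that, of f _ UNIV g]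
      has_derivative_transform_within_open[OF _ assms(1) that, of g _ UNIV f] Suc.prems by metis
  ultimately show ?case by simp
qed

lemma Ck_vec_eq_Ck_on:
  assumes "open S"
  shows "Ck_vec k f S \<longleftrightarrow> Ck_on k f S"
proof (induction k arbitrary: f)
  case (Suc k)
  show ?case
  proof
    assume "Ck_vec (Suc k) f S"
    then obtain F where F: "\<forall>x\<in>S. (f has_derivative (\<lambda>h. \<Sum>i\<in>UNIV. (h $ i) *\<^sub>R F i x)) (at x)"
      "\<forall>i. Ck_on k (F i) S" unfolding Ck_vec.simps Suc by blast
    have "partial_deriv i f x = F i x" if "x \<in> S" for i x
      using frechet_derivative_at[OF F(1)[rule_format, OF that], symmetric]
      by (simp add: partial_deriv_def axis_def if_distrib[of "\<lambda>c. c *\<^sub>R _"] cong: if_cong)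
    then have "Ck_on k (partial_deriv i f) S" for i
      using F(2) Ck_on_cong[OF assms, of "partial_deriv i f" "F i"] by blast
    moreover have "f differentiable (at x)" if "x \<in> S" for x
      using F(1) that unfolding differentiable_def by blast
    ultimately show "Ck_on (Suc k) f S" by simp
  next
    assume *: "Ck_on (Suc k) f S"
    have "(f has_derivative (\<lambda>h. \<Sum>i\<in>UNIV. (h $ i) *\<^sub>R partial_deriv i f x)) (at x)"
      if "x \<in> S" for x
    proof -
      have "(f has_derivative frechet_derivative f (at x)) (at x)"
        using * that frechet_derivative_works[of f "at x"] by simp
      moreover from this have "frechet_derivative f (at x) =
        (\<lambda>h. \<Sum>i\<in>UNIV. (h $ i) *\<^sub>R partial_deriv i f x)"
        using linear_axis_expansion[OF has_derivative_linear, of f _ "at x"]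
        by (simp add: partial_deriv_def fun_eq_iff)
      ultimately show ?thesis by simp
    qed
    with * show "Ck_vec (Suc k) f S"
      unfolding Ck_vec.simps Ck_on.simps using Suc
      by (intro exI[of _ "\<lambda>i. partial_deriv i f"]) simp
  qed
qed auto

lemma smooth_on_iff_Ck_vec: "open S \<Longrightarrow> smooth_on f S \<longleftrightarrow> (\<forall>k. Ck_vec k f S)"
  by (simp add: smooth_on_def Ck_vec_eq_Ck_on)

lemma Ck_vec_SucD: "Ck_vec (Suc k) f S \<Longrightarrow> Ck_vec k f S"
proof (induction k arbitrary: f)
  case 0
  then show ?case using Ck_vec_imp_continuous_on[of "Suc 0"] by simp
next
  case (Suc k)
  then obtain F where F: "\<forall>x\<in>S. (f has_derivative (\<lambda>h. \<Sum>i\<in>UNIV. (h $ i) *\<^sub>R F i x)) (at x)"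
    "\<forall>i. Ck_vec (Suc k) (F i) S" by auto
  with Suc.IH show ?case by auto
qed

lemma Ck_vec_const: "Ck_vec k (\<lambda>x. c) S"
proof (induction k arbitrary: c)
  case (Suc k)
  then show ?case by (auto intro!: exI[of _ "\<lambda>i x. 0"])
qed auto

lemma Ck_vec_bounded_linear:
  assumes "bounded_linear L"
  shows "Ck_vec k L S"
proof (cases k)
  case 0
  then show ?thesis using assms by (simp add: linear_continuous_on)
next
  case (Suc n)
  have "L = (\<lambda>h. \<Sum>i\<in>UNIV. (h $ i) *\<^sub>R L (axis i 1))"
    by (rule ext) (rule linear_axis_expansion[OF bounded_linear.linear[OF assms]])
  then have "(L has_derivative (\<lambda>h. \<Sum>i\<in>UNIV. (h $ i) *\<^sub>R L (axis i 1))) (at x)" for x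
    using bounded_linear_imp_has_derivative[OF assms] by simp
  then show ?thesis unfolding Suc Ck_vec.simps
    by (intro exI[of _ "\<lambda>i x. L (axis i 1)"]) (simp add: Ck_vec_const)
qed

lemma Ck_vec_component: "Ck_vec k (\<lambda>x. x $ i) S"
  by (rule Ck_vec_bounded_linear) (rule bounded_linear_vec_nth)

lemma Ck_vec_add: "Ck_vec k f S \<Longrightarrow> Ck_vec k g S \<Longrightarrow> Ck_vec k (\<lambda>x. f x + g x) S"
proof (induction k arbitrary: f g)
  case 0
  then show ?case by (auto intro: continuous_intros)
next
  case (Suc k)
  then obtain F G where *: "\<forall>x\<in>S. (f has_derivative (\<lambda>h. \<Sum>i\<in>UNIV. (h $ i) *\<^sub>R F i x)) (at x)"
    "\<forall>i. Ck_vec k (F i) S" "\<forall>x\<in>S. (g has_derivative (\<lambda>h. \<Sum>i\<in>UNIV. (h $ i) *\<^sub>R G i x)) (at x)"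
    "\<forall>i. Ck_vec k (G i) S" by auto
  have "((\<lambda>x. f x + g x) has_derivative (\<lambda>h. \<Sum>i\<in>UNIV. (h $ i) *\<^sub>R (F i x + G i x))) (at x)"
    if "x \<in> S" for x
    using * that has_derivative_add[of f _ "at x" g] by (simp add: scaleR_right_distrib sum.distrib)
  then show ?case using * Suc.IH by (auto intro!: exI[of _ "\<lambda>i x. F i x + G i x"])
qed

lemma Ck_vec_scaleR:
  fixes f :: "real^'n::finite \<Rightarrow> real"
  shows "Ck_vec k f S \<Longrightarrow> Ck_vec k g S \<Longrightarrow> Ck_vec k (\<lambda>x. f x *\<^sub>R g x) S"
proof (induction k arbitrary: f g)
  case 0
  then show ?case by (auto intro: continuous_intros)
next
  case (Suc k)
  then obtain F G where *: "\<forall>x\<in>S. (f has_derivative (\<lambda>h. \<Sum>i\<in>UNIV. (h $ i) *\<^sub>R F i x)) (at x)"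
    "\<forall>i. Ck_vec k (F i) S" "\<forall>x\<in>S. (g has_derivative (\<lambda>h. \<Sum>i\<in>UNIV. (h $ i) *\<^sub>R G i x)) (at x)"
    "\<forall>i. Ck_vec k (G i) S" by auto
  have "((\<lambda>x. f x *\<^sub>R g x) has_derivative
      (\<lambda>h. \<Sum>i\<in>UNIV. (h $ i) *\<^sub>R (f x *\<^sub>R G i x + F i x *\<^sub>R g x))) (at x)"
    if "x \<in> S" for x
    using has_derivative_scaleR[OF *(1)[rule_format, OF that] *(3)[rule_format, OF that]]
    by (simp add: scaleR_right_distrib sum.distrib scaleR_sum_right scaleR_sum_left mult.commute)
  moreover have "Ck_vec k (\<lambda>x. f x *\<^sub>R G i x + F i x *\<^sub>R g x) S" for i
    using Suc.prems[THEN Ck_vec_SucD] * by (auto intro!: Ck_vec_add Suc.IH)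
  ultimately show ?case by (auto intro!: exI[of _ "\<lambda>i x. f x *\<^sub>R G i x + F i x *\<^sub>R g x"])
qed

lemma Ck_vec_mult:
  fixes f g :: "real^'n::finite \<Rightarrow> real"
  shows "Ck_vec k f S \<Longrightarrow> Ck_vec k g S \<Longrightarrow> Ck_vec k (\<lambda>x. f x * g x) S"
  using Ck_vec_scaleR[of k f S g] by simp

lemma Ck_vec_power:
  fixes f :: "real^'n::finite \<Rightarrow> real"
  shows "Ck_vec k f S \<Longrightarrow> Ck_vec k (\<lambda>x. f x ^ n) S"
  by (induction n) (auto intro: Ck_vec_const Ck_vec_mult)

lemma Ck_vec_sum: "(\<And>i. i \<in> I \<Longrightarrow> Ck_vec k (f i) S) \<Longrightarrow> Ck_vec k (\<lambda>x. \<Sum>i\<in>I. f i x) S"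
  by (induction I rule: infinite_finite_induct) (auto intro: Ck_vec_const Ck_vec_add)

lemma Ck_vec_compose_real:
  fixes f :: "real^'n::finite \<Rightarrow> real"
  shows "Ck_vec k f S \<Longrightarrow> Ck_real k \<phi> T \<Longrightarrow> f ` S \<subseteq> T \<Longrightarrow> Ck_vec k (\<lambda>x. \<phi> (f x)) S"
proof (induction k arbitrary: \<phi>)
  case 0
  then show ?case by (auto intro: continuous_on_compose2)
next
  case (Suc k)
  then obtain F \<phi>' where *: "\<forall>x\<in>S. (f has_derivative (\<lambda>h. \<Sum>i\<in>UNIV. (h $ i) *\<^sub>R F i x)) (at x)"
    "\<forall>i. Ck_vec k (F i) S" "\<forall>x\<in>T. (\<phi> has_field_derivative \<phi>' x) (at x)" "Ck_real k \<phi>' T"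
    by auto
  have "((\<lambda>x. \<phi> (f x)) has_derivative (\<lambda>h. \<Sum>i\<in>UNIV. (h $ i) *\<^sub>R (\<phi>' (f x) * F i x))) (at x)"
    if "x \<in> S" for x
  proof -
    have "(\<phi> has_field_derivative \<phi>' (f x)) (at (f x))" using * Suc.prems(3) that by auto
    from has_derivative_compose[OF *(1)[rule_format, OF that] this[unfolded has_field_derivative_def]]
    show ?thesis by (simp add: sum_distrib_left mult_ac)
  qed
  moreover have "Ck_vec k (\<lambda>x. \<phi>' (f x) * F i x) S" for i
    using Ck_vec_SucD[OF Suc.prems(1)] Suc.prems(3) * Suc.IH[of \<phi>'] by (simp add: Ck_vec_mult)
  ultimately show ?case unfolding Ck_vec.simps by (intro exI[of _ "\<lambda>i x. \<phi>' (f x) * F i x"]) blast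
qed

text \<open>It transfers the smoothness of a velocity field on \<open>slit_space\<close> to
  one-variable profiles along a meridian.\<close>

lemma Ck_real_compose_curve:
  fixes f :: "real^'n::finite \<Rightarrow> real"
  shows "Ck_vec k f S \<Longrightarrow> (\<And>i. Ck_real k (\<lambda>t. c t $ i) T) \<Longrightarrow> c ` T \<subseteq> S \<Longrightarrow>
    Ck_real k (\<lambda>t. f (c t)) T"
proof (induction k arbitrary: f)
  case 0
  have "continuous_on T (\<lambda>t. \<chi> i. c t $ i)"
    using 0 by (intro continuous_on_vec_lambda) simp
  then have c: "continuous_on T c" by (simp only: vec_lambda_eta)
  from 0(1) have "continuous_on S f" by (simp only: Ck_vec.simps)
  from continuous_on_compose2[OF this c 0(3)] show ?case by (simp only: Ck_real.simps)
next
  case (Suc k)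
  from Suc.prems(1) obtain F where F:
    "\<And>x. x \<in> S \<Longrightarrow> (f has_derivative (\<lambda>h. \<Sum>i\<in>UNIV. (h $ i) *\<^sub>R F i x)) (at x)"
    "\<And>i. Ck_vec k (F i) S" by auto
  have "\<forall>i. \<exists>c'. (\<forall>x\<in>T. ((\<lambda>t. c t $ i) has_field_derivative c' x) (at x)) \<and> Ck_real k c' T"
    using Suc.prems(2) by simp
  from choice[OF this] obtain c' where c'': "\<forall>i. (\<forall>x\<in>T. ((\<lambda>t. c t $ i) has_field_derivative c' i x) (at x)) \<and>
      Ck_real k (c' i) T" ..
  then have c': "\<And>i x. x \<in> T \<Longrightarrow> ((\<lambda>t. c t $ i) has_field_derivative c' i x) (at x)"
       "\<And>i. Ck_real k (c' i) T" by simp_all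
  have "((\<lambda>t. f (c t)) has_field_derivative (\<Sum>i\<in>UNIV. c' i t * F i (c t))) (at t)"
    if "t \<in> T" for t
  proof -
    have "(c has_derivative (\<lambda>h. \<chi> i. c' i t * h)) (at t)"
      by (subst has_derivative_componentwise_within)
         (use c'(1)[OF that] in \<open>auto simp: Basis_vec_def inner_axis has_field_derivative_def\<close>)
    have "c t \<in> S" using Suc.prems(3) that by blast
    from has_derivative_compose[OF \<open>(c has_derivative _) _\<close> F(1)[OF this]]
    have "((\<lambda>t. f (c t)) has_derivative (\<lambda>h. \<Sum>i\<in>UNIV. (c' i t * h) * F i (c t))) (at t)"
      by simp
    moreover have "(\<lambda>h. \<Sum>i\<in>UNIV. (c' i t * h) * F i (c t)) = (*) (\<Sum>i\<in>UNIV. c' i t * F i (c t))"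
      by (simp add: fun_eq_iff sum_distrib_left mult_ac)
    ultimately show ?thesis unfolding has_field_derivative_def by simp
  qed
  moreover have "Ck_real k (\<lambda>t. \<Sum>i\<in>UNIV. c' i t * F i (c t)) T"
  proof (intro Ck_real_sum Ck_real_mult c'(2))
    fix i
    show "Ck_real k (\<lambda>t. F i (c t)) T"
      by (rule Suc.IH[OF F(2) Ck_real_SucD[OF Suc.prems(2)] Suc.prems(3)])
  qed
  ultimately show ?case unfolding Ck_real.simps
    by (intro exI[of _ "\<lambda>t. \<Sum>i\<in>UNIV. c' i t * F i (c t)"] conjI ballI)
qed

section \<open>The equations for homogeneous axisymmetric fields\<close>

text \<open>Total differentiability is part of the notion: a mere directional derivative would not
  determine \<open>frechet_derivative\<close>, which \<open>partial_deriv\<close> evaluates.\<close>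

definition has_pd :: "'n::finite \<Rightarrow> (real^'n \<Rightarrow> 'b::real_normed_vector) \<Rightarrow> 'b \<Rightarrow> real^'n \<Rightarrow> bool" where
  "has_pd i f v X \<longleftrightarrow> (\<exists>D. (f has_derivative D) (at X) \<and> D (axis i 1) = v)"

lemma has_pd_imp_partial_deriv: "has_pd i f v X \<Longrightarrow> partial_deriv i f X = v"
  by (metis frechet_derivative_at has_pd_def partial_deriv_def)

lemma has_pd_cong_open:
  assumes "open S" "X \<in> S" "\<And>Y. Y \<in> S \<Longrightarrow> f Y = g Y" "has_pd i f v X"
  shows "has_pd i g v X"
  using assms unfolding has_pd_def by (metis has_derivative_transform_within_open)

lemma has_pd_const: "has_pd i (\<lambda>X. c) 0 X"
  unfolding has_pd_def by (intro exI[of _ "\<lambda>h. 0"]) simp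

lemma has_pd_bounded_linear: "bounded_linear L \<Longrightarrow> has_pd i L (L (axis i 1)) X"
  unfolding has_pd_def by (intro exI[of _ L]) (simp add: bounded_linear_imp_has_derivative)

lemma has_pd_add: "has_pd i f v X \<Longrightarrow> has_pd i g w X \<Longrightarrow> has_pd i (\<lambda>X. f X + g X) (v + w) X"
  unfolding has_pd_def by (blast intro: has_derivative_add)

lemma has_pd_diff: "has_pd i f v X \<Longrightarrow> has_pd i g w X \<Longrightarrow> has_pd i (\<lambda>X. f X - g X) (v - w) X"
  unfolding has_pd_def by (blast intro: has_derivative_diff)

lemma has_pd_scaleR:
  assumes "has_pd i f v X" "has_pd i g w X"
  shows "has_pd i (\<lambda>X. f X *\<^sub>R g X) (f X *\<^sub>R w + v *\<^sub>R g X) X"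
proof -
  from assms obtain D E where "(f has_derivative D) (at X)" "D (axis i 1) = v"
    "(g has_derivative E) (at X)" "E (axis i 1) = w" unfolding has_pd_def by auto
  with has_derivative_scaleR[OF this(1,3)] show ?thesis unfolding has_pd_def
    by (intro exI[of _ "\<lambda>h. f X *\<^sub>R E h + D h *\<^sub>R g X"]) simp
qed

lemma has_pd_mult:
  fixes f g :: "real^'n::finite \<Rightarrow> real"
  shows "has_pd i f v X \<Longrightarrow> has_pd i g w X \<Longrightarrow> has_pd i (\<lambda>X. f X * g X) (f X * w + v * g X) X"
  using has_pd_scaleR[of i f v X g w] by simp

lemma has_pd_component: "has_pd i (\<lambda>X. X $ j) (axis i 1 $ j) X"
  by (rule has_pd_bounded_linear[OF bounded_linear_vec_nth])

lemma has_pd_id: "has_pd i (\<lambda>X. X) (axis i 1) X"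
  by (rule has_pd_bounded_linear) (rule bounded_linear_ident)

section \<open>Calculus of the scalars |X|^(-n) phi(X_3 / |X|) and of axisymmetric fields\<close>

definition hom :: "nat \<Rightarrow> (real \<Rightarrow> real) \<Rightarrow> real^3 \<Rightarrow> real" where
  "hom n \<phi> X = (1 / norm X) ^ n * \<phi> (X $ 3 / norm X)"

definition rot :: "real^3 \<Rightarrow> real^3" where
  "rot X = vector [- X $ 2, X $ 1, 0]"

lemma bounded_linear_rot: "bounded_linear rot"
  unfolding rot_def
  by (intro linear_conv_bounded_linear[THEN iffD1] linearI) (auto simp: vec_eq_iff forall_3 vector_3)

text \<open>The gradients of 1 / |X| and of x = X_3 / |X| are - X / |X|^3 and e_3 / |X| - x X /
  |X|^2. A gradient is therefore again a combination of X and e_3 with coefficients of the form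
  \<open>hom\<close>, and the calculus closes under differentiation.\<close>

lemma has_pd_hom:
  assumes "X \<noteq> 0" "(\<phi> has_field_derivative \<phi>' (X $ 3 / norm X)) (at (X $ 3 / norm X))"
  shows "has_pd i (hom n \<phi>) (hom (n + 2) (\<lambda>x. - real n * \<phi> x - x * \<phi>' x) X * X $ i
                             + hom (n + 1) \<phi>' X * axis i 1 $ 3) X"
proof -
  define s x where "s = 1 / norm X" and "x = X $ 3 / norm X"
  have s: "s > 0" using assms by (simp add: s_def)
  have dn: "(norm has_derivative (\<lambda>h. h \<bullet> sgn X)) (at X)"
    using has_derivative_norm[OF assms(1)] by (simp add: inner_commute)
  have ds: "((\<lambda>X. 1 / norm X) has_derivative (\<lambda>h. - (s ^ 3) * (h \<bullet> X))) (at X)"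
    using assms(1)
    by (auto intro!: derivative_eq_intros dn simp: s_def sgn_div_norm divide_simps power3_eq_cube)
  have dx: "((\<lambda>X. X $ 3 / norm X) has_derivative (\<lambda>h. s * (h $ 3) - s\<^sup>2 * x * (h \<bullet> X))) (at X)"
    using has_derivative_mult[OF bounded_linear_imp_has_derivative[OF bounded_linear_vec_nth] ds, of 3]
    by (simp add: s_def x_def power2_eq_square power3_eq_cube mult_ac algebra_simps)
  have d1: "((\<lambda>X. \<phi> (X $ 3 / norm X)) has_derivative
      (\<lambda>h. \<phi>' x * (s * (h $ 3) - s\<^sup>2 * x * (h \<bullet> X)))) (at X)"
    using has_derivative_compose[OF dx assms(2)[unfolded has_field_derivative_def]]
    by (simp add: x_def)
  have "real n * (- (s ^ 3) * (h \<bullet> X)) * s ^ (n - 1) = - real n * s ^ (n + 2) * (h \<bullet> X)" for h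
    by (cases n) (auto simp: power3_eq_cube power_add algebra_simps)
  then have d2: "((\<lambda>X. (1 / norm X) ^ n) has_derivative (\<lambda>h. - real n * s ^ (n + 2) * (h \<bullet> X))) (at X)"
    using has_derivative_power[OF ds, of n] by (simp add: s_def)
  have "hom n \<phi> = (\<lambda>X. (1 / norm X) ^ n * \<phi> (X $ 3 / norm X))" by (simp add: hom_def fun_eq_iff)
  with has_derivative_mult[OF d2 d1] have "(hom n \<phi> has_derivative
      (\<lambda>h. s ^ n * (\<phi>' x * (s * (h $ 3) - s\<^sup>2 * x * (h \<bullet> X)))
         + - real n * s ^ (n + 2) * (h \<bullet> X) * \<phi> x)) (at X)"
    by (simp add: s_def x_def)
  moreover have "axis i 1 \<bullet> X = X $ i" by (simp add: inner_axis')
  ultimately show ?thesis unfolding has_pd_def hom_def s_def[symmetric] x_def[symmetric]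
    by (intro exI conjI) (assumption, simp add: algebra_simps power2_eq_square)
qed

text \<open>Built on X, e_3 and the rotation field instead of the spherical frame: these are linear
  or constant, so regularity on the positive axis depends only on the profiles near x = 1.\<close>

definition axifield :: "(real \<Rightarrow> real) \<Rightarrow> (real \<Rightarrow> real) \<Rightarrow> (real \<Rightarrow> real) \<Rightarrow> real^3 \<Rightarrow> real^3" where
  "axifield A g k X = hom 2 A X *\<^sub>R X - hom 1 g X *\<^sub>R axis 3 1 + hom 2 k X *\<^sub>R rot X"

text \<open>\<open>I\<close> may reach beyond 1 although X_3 / |X| never does: an open
  \<open>I\<close> containing 1 makes the cone a neighbourhood of the positive axis.\<close>

definition axial_cone :: "real set \<Rightarrow> (real^3) set" where
  "axial_cone I = {X. X \<noteq> 0 \<and> X $ 3 / norm X \<in> I}"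

lemma open_cone:
  assumes "open I"
  shows "open (axial_cone I)"
proof -
  have "continuous_on (- {0::real^3}) (\<lambda>X. X $ 3 / norm X)"
    by (intro continuous_intros) auto
  from continuous_open_preimage[OF this _ assms] have "open (- {0} \<inter> (\<lambda>X::real^3. X $ 3 / norm X) -` I)"
    by auto
  moreover have "- {0} \<inter> (\<lambda>X::real^3. X $ 3 / norm X) -` I = axial_cone I" by (auto simp: axial_cone_def)
  ultimately show ?thesis by simp
qed

definition hat :: "nat \<Rightarrow> (real \<Rightarrow> real) \<Rightarrow> (real \<Rightarrow> real) \<Rightarrow> real \<Rightarrow> real" where
  "hat n \<phi> \<phi>' x = - real n * \<phi> x - x * \<phi>' x"

definition grad_hom :: "nat \<Rightarrow> (real \<Rightarrow> real) \<Rightarrow> (real \<Rightarrow> real) \<Rightarrow> 3 \<Rightarrow> real^3 \<Rightarrow> real" where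
  "grad_hom n \<phi> \<phi>' i X = hom (n + 2) (hat n \<phi> \<phi>') X * X $ i + hom (n + 1) \<phi>' X * axis i 1 $ 3"

lemma has_pd_hom_on_cone:
  assumes "X \<in> axial_cone I" "\<And>x. x \<in> I \<Longrightarrow> (\<phi> has_field_derivative \<phi>' x) (at x)"
  shows "has_pd i (hom n \<phi>) (grad_hom n \<phi> \<phi>' i X) X"
  using has_pd_hom[of X \<phi> \<phi>' i n] assms unfolding grad_hom_def hat_def axial_cone_def by simp

lemma has_pd_grad_hom:
  assumes "X \<in> axial_cone I" "\<And>x. x \<in> I \<Longrightarrow> (\<phi> has_field_derivative \<phi>' x) (at x)"
    "\<And>x. x \<in> I \<Longrightarrow> (\<phi>' has_field_derivative \<phi>'' x) (at x)"
  shows "has_pd i (grad_hom n \<phi> \<phi>' j)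
     (hom (n + 2) (hat n \<phi> \<phi>') X * axis i 1 $ j
      + grad_hom (n + 2) (hat n \<phi> \<phi>') (hat (n + 1) \<phi>' \<phi>'') i X * X $ j
      + grad_hom (n + 1) \<phi>' \<phi>'' i X * axis j 1 $ 3) X"
proof -
  have "(hat n \<phi> \<phi>' has_field_derivative hat (n + 1) \<phi>' \<phi>'' x) (at x)" if "x \<in> I" for x
    unfolding hat_def using assms(2,3)[OF that] by (auto intro!: derivative_eq_intros simp: algebra_simps)
  from has_pd_hom_on_cone[OF assms(1) this, where n="n+2"] has_pd_hom_on_cone[OF assms(1,3), where n="n+1"]
  have "has_pd i (\<lambda>X. hom (n + 2) (hat n \<phi> \<phi>') X * X $ j + hom (n + 1) \<phi>' X * axis j 1 $ 3)
     ((hom (n + 2) (hat n \<phi> \<phi>') X * axis i 1 $ j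
      + grad_hom (n + 2) (hat n \<phi> \<phi>') (hat (n + 1) \<phi>' \<phi>'') i X * X $ j)
      + (hom (n + 1) \<phi>' X * 0 + grad_hom (n + 1) \<phi>' \<phi>'' i X * axis j 1 $ 3)) X"
    by (intro has_pd_add has_pd_mult has_pd_component has_pd_const)
  then show ?thesis by (simp add: grad_hom_def[abs_def])
qed


text \<open>The Laplacian of \<open>hom n \<phi>\<close>: the radial part of |X|^(-n) contributes n
  (n - 1), the angular part the Legendre operator ((1 - x^2) phi')'.\<close>

definition lap_hom :: "nat \<Rightarrow> (real \<Rightarrow> real) \<Rightarrow> (real \<Rightarrow> real) \<Rightarrow> (real \<Rightarrow> real) \<Rightarrow> real^3 \<Rightarrow> real" where
  "lap_hom n \<phi> \<phi>' \<phi>'' X = (1 / norm X) ^ (n + 2) *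
     (let x = X $ 3 / norm X in real n * (real n - 1) * \<phi> x + (1 - x\<^sup>2) * \<phi>'' x - 2 * x * \<phi>' x)"

lemma inverse_norm_relation:
  fixes X :: "real^3"
  assumes "X \<noteq> 0"
  shows "1 / norm X * (1 / norm X) * (X $ 1 * X $ 1 + X $ 2 * X $ 2 + X $ 3 * X $ 3) = 1"
proof -
  have "norm X ^ 2 = X $ 1 * X $ 1 + X $ 2 * X $ 2 + X $ 3 * X $ 3"
    unfolding power2_norm_eq_inner by (simp add: inner_vec_def sum_3)
  moreover have "1 / norm X * (1 / norm X) * norm X ^ 2 = 1"
    using assms by (simp add: power2_eq_square)
  ultimately show ?thesis by (simp only:)
qed

lemma sum_second_pd_hom:
  assumes "X \<noteq> 0"
  shows "(\<Sum>i\<in>UNIV. hom (n + 2) (hat n \<phi> \<phi>') X * axis i 1 $ i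
      + grad_hom (n + 2) (hat n \<phi> \<phi>') (hat (n + 1) \<phi>' \<phi>'') i X * X $ i
      + grad_hom (n + 1) \<phi>' \<phi>'' i X * axis i 1 $ 3) = lap_hom n \<phi> \<phi>' \<phi>'' X"
proof -
  \<comment> \<open>With the profile values abstracted, the claim is a polynomial identity modulo
    s^2 (a^2 + b^2 + c^2) = 1, which \<open>algebra\<close> decides. Divergence and momentum are
    computed in the same way.\<close>
  define s where "s = 1 / norm X"
  define a b c where "a = X $ 1" "b = X $ 2" "c = X $ 3"
  have s: "s * s * (a * a + b * b + c * c) = 1"
    using inverse_norm_relation assms unfolding s_def a_b_c_def by blast
  have x: "X $ 3 / norm X = s * c" by (simp add: s_def a_b_c_def)
  define q N p p' p'' where "q = s ^ n" "N = real n" "p = \<phi> (s * c)" "p' = \<phi>' (s * c)" "p'' = \<phi>'' (s * c)"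
  show ?thesis
    unfolding lap_hom_def grad_hom_def hom_def hat_def x s_def[symmetric] Let_def sum_3
    apply (simp add: axis_def a_b_c_def[symmetric] power_add power2_eq_square q_N_p_p'_p''_def[symmetric])
    using s by algebra
qed

definition axifield_pd :: "(real \<Rightarrow> real) \<Rightarrow> (real \<Rightarrow> real) \<Rightarrow> (real \<Rightarrow> real) \<Rightarrow> (real \<Rightarrow> real) \<Rightarrow>
    (real \<Rightarrow> real) \<Rightarrow> (real \<Rightarrow> real) \<Rightarrow> 3 \<Rightarrow> real^3 \<Rightarrow> real^3" where
  "axifield_pd A A' g g' k k' i X =
     (hom 2 A X *\<^sub>R axis i 1 + grad_hom 2 A A' i X *\<^sub>R X) - grad_hom 1 g g' i X *\<^sub>R axis 3 1
     + (hom 2 k X *\<^sub>R rot (axis i 1) + grad_hom 2 k k' i X *\<^sub>R rot X)"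

locale axifield_calculus =
  fixes I :: "real set" and A A1 A2 g g1 g2 k k1 k2 :: "real \<Rightarrow> real"
  assumes open_I: "open I"
    and dA: "\<And>x. x \<in> I \<Longrightarrow> (A has_field_derivative A1 x) (at x)"
    and dA1: "\<And>x. x \<in> I \<Longrightarrow> (A1 has_field_derivative A2 x) (at x)"
    and dg: "\<And>x. x \<in> I \<Longrightarrow> (g has_field_derivative g1 x) (at x)"
    and dg1: "\<And>x. x \<in> I \<Longrightarrow> (g1 has_field_derivative g2 x) (at x)"
    and dk: "\<And>x. x \<in> I \<Longrightarrow> (k has_field_derivative k1 x) (at x)"
    and dk1: "\<And>x. x \<in> I \<Longrightarrow> (k1 has_field_derivative k2 x) (at x)"
begin

lemma has_pd_axifield:
  assumes "X \<in> axial_cone I"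
  shows "has_pd i (axifield A g k) (axifield_pd A A1 g g1 k k1 i X) X"
proof -
  note h = has_pd_hom_on_cone[OF assms dA] has_pd_hom_on_cone[OF assms dg] has_pd_hom_on_cone[OF assms dk]
  have "has_pd i (\<lambda>X. hom 2 A X *\<^sub>R X - hom 1 g X *\<^sub>R axis 3 1 + hom 2 k X *\<^sub>R rot X)
    ((hom 2 A X *\<^sub>R axis i 1 + grad_hom 2 A A1 i X *\<^sub>R X) - (hom 1 g X *\<^sub>R 0 + grad_hom 1 g g1 i X *\<^sub>R axis 3 1)
     + (hom 2 k X *\<^sub>R rot (axis i 1) + grad_hom 2 k k1 i X *\<^sub>R rot X)) X"
    by (intro has_pd_add has_pd_diff has_pd_scaleR has_pd_id has_pd_const h
         has_pd_bounded_linear[OF bounded_linear_rot])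
  then show ?thesis by (simp add: axifield_pd_def axifield_def[abs_def])
qed


lemma partial_deriv_axifield: "X \<in> axial_cone I \<Longrightarrow>
    partial_deriv i (axifield A g k) X = axifield_pd A A1 g g1 k k1 i X"
  by (rule has_pd_imp_partial_deriv[OF has_pd_axifield])

text \<open>Since X and \<open>rot X\<close> are linear, the product rule leaves only a cross term:
  Delta (f X) = (Delta f) X + 2 grad f, and likewise with \<open>rot\<close>.\<close>

lemma laplacian_axifield:
  assumes X: "X \<in> axial_cone I"
  shows "laplacian (axifield A g k) X =
     (lap_hom 2 A A1 A2 X *\<^sub>R X + 2 *\<^sub>R (\<Sum>i\<in>UNIV. grad_hom 2 A A1 i X *\<^sub>R axis i 1))
     - lap_hom 1 g g1 g2 X *\<^sub>R axis 3 1
     + (lap_hom 2 k k1 k2 X *\<^sub>R rot X + 2 *\<^sub>R (\<Sum>i\<in>UNIV. grad_hom 2 k k1 i X *\<^sub>R rot (axis i 1)))"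
proof -
  define d2 where "d2 n \<phi> \<phi>' \<phi>'' i = hom (n + 2) (hat n \<phi> \<phi>') X * axis i 1 $ i
      + grad_hom (n + 2) (hat n \<phi> \<phi>') (hat (n + 1) \<phi>' \<phi>'') i X * X $ i
      + grad_hom (n + 1) \<phi>' \<phi>'' i X * axis i 1 $ 3" for n \<phi> \<phi>' \<phi>'' i
  have d2: "(\<Sum>i\<in>UNIV. d2 n \<phi> \<phi>' \<phi>'' i) = lap_hom n \<phi> \<phi>' \<phi>'' X" for n \<phi> \<phi>' \<phi>''
    unfolding d2_def using X by (intro sum_second_pd_hom) (simp add: axial_cone_def)
  note h = has_pd_hom_on_cone[OF X dA] has_pd_hom_on_cone[OF X dg] has_pd_hom_on_cone[OF X dk]
  have "has_pd i (grad_hom n \<phi> \<phi>' i) (d2 n \<phi> \<phi>' \<phi>'' i) X"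
    if "\<And>x. x \<in> I \<Longrightarrow> (\<phi> has_field_derivative \<phi>' x) (at x)"
       "\<And>x. x \<in> I \<Longrightarrow> (\<phi>' has_field_derivative \<phi>'' x) (at x)" for i n \<phi> \<phi>' \<phi>''
    using has_pd_grad_hom[OF X that] unfolding d2_def by blast
  note hh = this[OF dA dA1] this[OF dg dg1] this[OF dk dk1]
  have "has_pd i (axifield_pd A A1 g g1 k k1 i)
      (((hom 2 A X *\<^sub>R 0 + grad_hom 2 A A1 i X *\<^sub>R axis i 1)
        + (grad_hom 2 A A1 i X *\<^sub>R axis i 1 + d2 2 A A1 A2 i *\<^sub>R X))
       - (grad_hom 1 g g1 i X *\<^sub>R 0 + d2 1 g g1 g2 i *\<^sub>R axis 3 1)
       + ((hom 2 k X *\<^sub>R 0 + grad_hom 2 k k1 i X *\<^sub>R rot (axis i 1))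
        + (grad_hom 2 k k1 i X *\<^sub>R rot (axis i 1) + d2 2 k k1 k2 i *\<^sub>R rot X))) X" for i
    unfolding axifield_pd_def[abs_def]
    by (intro has_pd_add has_pd_diff has_pd_scaleR has_pd_id has_pd_const h hh
         has_pd_bounded_linear[OF bounded_linear_rot])
  note pd = has_pd_imp_partial_deriv[OF has_pd_cong_open[OF open_cone[OF open_I] X
      partial_deriv_axifield[symmetric] this]]
  have "partial_deriv i (partial_deriv i (axifield A g k)) X =
      (grad_hom 2 A A1 i X *\<^sub>R axis i 1 + grad_hom 2 A A1 i X *\<^sub>R axis i 1 + d2 2 A A1 A2 i *\<^sub>R X)
       - (d2 1 g g1 g2 i *\<^sub>R axis 3 1)
       + (grad_hom 2 k k1 i X *\<^sub>R rot (axis i 1) + grad_hom 2 k k1 i X *\<^sub>R rot (axis i 1)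
          + d2 2 k k1 k2 i *\<^sub>R rot X)" for i
    using pd[of i] by simp
  then show ?thesis
    unfolding laplacian_def scaleR_2
    by (simp only: sum.distrib sum_subtractf scaleR_sum_left[symmetric] d2)
       (simp add: algebra_simps)
qed

lemma divergence_axifield:
  assumes X: "X \<in> axial_cone I"
  defines "x \<equiv> X $ 3 / norm X"
  shows "divergence (axifield A g k) X =
    (1 / norm X)\<^sup>2 * (A x + x * g x - (1 - x\<^sup>2) * g1 x)"
proof -
  define s where "s = 1 / norm X"
  define a b c where "a = X $ 1" "b = X $ 2" "c = X $ 3"
  have s: "s * s * (a * a + b * b + c * c) = 1"
    using inverse_norm_relation X unfolding s_def a_b_c_def axial_cone_def by blast
  have x: "X $ 3 / norm X = s * c" "c / norm X = s * c" by (simp_all add: s_def a_b_c_def)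
  define p p' where "p = A (s * c)" "p' = A1 (s * c)"
  define q q' where "q = g (s * c)" "q' = g1 (s * c)"
  define r r' where "r = k (s * c)" "r' = k1 (s * c)"
  show ?thesis
    unfolding divergence_def partial_deriv_axifield[OF X] x_def x axifield_pd_def sum_3
    apply (simp add: grad_hom_def hom_def hat_def rot_def axis_def x s_def[symmetric]
      a_b_c_def[symmetric] p_p'_def[symmetric] q_q'_def[symmetric] r_r'_def[symmetric]
      power3_eq_cube power2_eq_square power4_eq_xxxx vector_3)
    using s by algebra
qed

lemma momentum_axifield:
  assumes X: "X \<in> axial_cone I"
  defines "x \<equiv> X $ 3 / norm X"
  shows "- laplacian (axifield A g k) X + convection (axifield A g k) X =
    ((1 / norm X) ^ 4 * (2 * A x - (1 - x\<^sup>2) * A2 x + 4 * x * A1 x - (A x)\<^sup>2 + 2 * x * g x * A x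
        - g x * (1 - x\<^sup>2) * A1 x - (k x)\<^sup>2)) *\<^sub>R X
    + ((1 / norm X) ^ 3 * ((1 - x\<^sup>2) * g2 x - 2 * x * g1 x - 2 * A1 x - x * (g x)\<^sup>2
        + (1 - x\<^sup>2) * g x * g1 x + x * (k x)\<^sup>2)) *\<^sub>R axis 3 1
    - ((1 / norm X) ^ 4 * ((1 - x\<^sup>2) * k2 x - 4 * x * k1 x - 2 * k x
        + g x * ((1 - x\<^sup>2) * k1 x - 2 * x * k x))) *\<^sub>R rot X"
proof -
  define s where "s = 1 / norm X"
  define a b c where "a = X $ 1" "b = X $ 2" "c = X $ 3"
  have s: "s * s * (a * a + b * b + c * c) = 1"
    using inverse_norm_relation X unfolding s_def a_b_c_def axial_cone_def by blast
  have x: "X $ 3 / norm X = s * c" "c / norm X = s * c" by (simp_all add: s_def a_b_c_def)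
  define p p' p'' where "p = A (s * c)" "p' = A1 (s * c)" "p'' = A2 (s * c)"
  define q q' q'' where "q = g (s * c)" "q' = g1 (s * c)" "q'' = g2 (s * c)"
  define r r' r'' where "r = k (s * c)" "r' = k1 (s * c)" "r'' = k2 (s * c)"
  note ss = grad_hom_def lap_hom_def hom_def hat_def rot_def axis_def x s_def[symmetric]
      a_b_c_def[symmetric] p_p'_p''_def[symmetric] q_q'_q''_def[symmetric] r_r'_r''_def[symmetric]
      power3_eq_cube power2_eq_square power4_eq_xxxx vector_3 Let_def
  show ?thesis
    unfolding laplacian_axifield[OF X] convection_def partial_deriv_axifield[OF X] x_def x
      axifield_pd_def sum_3 axifield_def vec_eq_iff forall_3
    apply (intro conjI)
    subgoal apply (simp add: ss) using s by algebra
    subgoal apply (simp add: ss) using s by algebra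
    subgoal apply (simp add: ss) using s by algebra
    done
qed

end

section \<open>Profile equations and elimination of the pressure\<close>

locale axi_profile =
  fixes I :: "real set" and g g1 g2 g3 g4 k k1 k2 :: "real \<Rightarrow> real"
  assumes open_I: "open I"
    and dg: "\<And>x. x \<in> I \<Longrightarrow> (g has_field_derivative g1 x) (at x)"
    and dg1: "\<And>x. x \<in> I \<Longrightarrow> (g1 has_field_derivative g2 x) (at x)"
    and dg2: "\<And>x. x \<in> I \<Longrightarrow> (g2 has_field_derivative g3 x) (at x)"
    and dg3: "\<And>x. x \<in> I \<Longrightarrow> (g3 has_field_derivative g4 x) (at x)"
    and dk: "\<And>x. x \<in> I \<Longrightarrow> (k has_field_derivative k1 x) (at x)"
    and dk1: "\<And>x. x \<in> I \<Longrightarrow> (k1 has_field_derivative k2 x) (at x)"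
begin

definition A where "A x = (1 - x\<^sup>2) * g1 x - x * g x"
definition A1 where "A1 x = (1 - x\<^sup>2) * g2 x - 3 * x * g1 x - g x"
definition A2 where "A2 x = (1 - x\<^sup>2) * g3 x - 5 * x * g2 x - 4 * g1 x"

text \<open>With g = 2 w' / w this is 2 w'' / w. For U = (1 - x^2) g the term 2 x U in (1 - x^2) U'
  + 2 x U + U^2 / 2 cancels and (1 - x^2)^2 \<open>q\<close> remains; \<open>H3\<close> therefore
  costs four derivatives of \<open>g\<close>.\<close>

definition q where "q x = g1 x + (g x)\<^sup>2 / 2"
definition q1 where "q1 x = g2 x + g x * g1 x"
definition q2 where "q2 x = g3 x + (g1 x)\<^sup>2 + g x * g2 x"
definition q3 where "q3 x = g4 x + 3 * g1 x * g2 x + g x * g3 x"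

definition H where "H x = (1 - x\<^sup>2)\<^sup>2 * q x"
definition H1 where "H1 x = (1 - x\<^sup>2)\<^sup>2 * q1 x - 4 * x * (1 - x\<^sup>2) * q x"
definition H2 where "H2 x = (1 - x\<^sup>2)\<^sup>2 * q2 x - 8 * x * (1 - x\<^sup>2) * q1 x
   + (8 * x\<^sup>2 - 4 * (1 - x\<^sup>2)) * q x"
definition H3 where "H3 x = (1 - x\<^sup>2)\<^sup>2 * q3 x - 12 * x * (1 - x\<^sup>2) * q2 x
   + (24 * x\<^sup>2 - 12 * (1 - x\<^sup>2)) * q1 x + 24 * x * q x"

text \<open>\<open>V1\<close> is the derivative of \<open>U\<^sub>\<phi>\<close> = (1 - x^2) k; the
  first three terms of \<open>swirl_eq\<close> are the second derivative.\<close>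

definition V1 where "V1 x = (1 - x\<^sup>2) * k1 x - 2 * x * k x"
definition swirl_eq where "swirl_eq x = (1 - x\<^sup>2) * k2 x - 4 * x * k1 x - 2 * k x + g x * V1 x"

text \<open>For a pressure \<open>P(x) / |X|\<^sup>2\<close> the components of the momentum equation along \<open>X\<close> and \<open>e\<^sub>3\<close> form
  a linear system for \<open>P\<close> and \<open>P'\<close>, with solution \<open>press\<close> and \<open>E3\<close>.\<close>

definition E3 where "E3 x = (1 - x\<^sup>2) * g2 x - 4 * x * g1 x - 2 * g x - (1 - x\<^sup>2) * g x * g1 x
   + x * (g x)\<^sup>2 - x * (k x)\<^sup>2"

definition press where "press x = (2 * ((1 - x\<^sup>2) * g1 x - 2 * x * g x) - H2 x
   - (1 - x\<^sup>2) * ((g x)\<^sup>2 + (k x)\<^sup>2)) / 2"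

text \<open>Two conditions on one unknown P are overdetermined: P = \<open>press\<close> and P' =
  \<open>E3\<close> are compatible exactly when half of \<open>H3 x + 2 * k x * V1 x\<close>, the
  difference between \<open>E3\<close> and \<open>press1\<close>, vanishes. This is where the third
  order equation for H comes from.\<close>

definition press1 where "press1 x = E3 x - (H3 x + 2 * k x * V1 x) / 2"

lemma dA: "x \<in> I \<Longrightarrow> (A has_field_derivative A1 x) (at x)"
  unfolding A_def[abs_def] A1_def
  by (auto intro!: derivative_eq_intros dg dg1 simp: algebra_simps)

lemma dA1: "x \<in> I \<Longrightarrow> (A1 has_field_derivative A2 x) (at x)"
  unfolding A1_def[abs_def] A2_def
  by (auto intro!: derivative_eq_intros dg dg1 dg2 simp: algebra_simps)

lemma dq: "x \<in> I \<Longrightarrow> (q has_field_derivative q1 x) (at x)"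
  unfolding q_def[abs_def] q1_def by (auto intro!: derivative_eq_intros dg dg1)

lemma dq1: "x \<in> I \<Longrightarrow> (q1 has_field_derivative q2 x) (at x)"
  unfolding q1_def[abs_def] q2_def
  by (auto intro!: derivative_eq_intros dg dg1 dg2 simp: power2_eq_square)

lemma dq2: "x \<in> I \<Longrightarrow> (q2 has_field_derivative q3 x) (at x)"
  unfolding q2_def[abs_def] q3_def
  by (auto intro!: derivative_eq_intros dg dg1 dg2 dg3 simp: algebra_simps)

lemma dH: "x \<in> I \<Longrightarrow> (H has_field_derivative H1 x) (at x)"
  unfolding H_def[abs_def] H1_def
  by (auto intro!: derivative_eq_intros dq simp: algebra_simps power2_eq_square)

lemma dH1: "x \<in> I \<Longrightarrow> (H1 has_field_derivative H2 x) (at x)"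
  unfolding H1_def[abs_def] H2_def
  by (auto intro!: derivative_eq_intros dq dq1 simp: algebra_simps power2_eq_square)

lemma dH2: "x \<in> I \<Longrightarrow> (H2 has_field_derivative H3 x) (at x)"
  unfolding H2_def[abs_def] H3_def
  by (auto intro!: derivative_eq_intros dq dq1 dq2 simp: algebra_simps power2_eq_square)

lemma dpress: "x \<in> I \<Longrightarrow> (press has_field_derivative press1 x) (at x)"
  unfolding press_def[abs_def] press1_def E3_def V1_def
  by (auto intro!: derivative_eq_intros dg dg1 dk dH2 simp: field_simps power2_eq_square)

sublocale axifield_calculus I A A1 A2 g g1 g2 k k1 k2
  by unfold_locales (use open_I dA dA1 dg dg1 dk dk1 in auto)

abbreviation velocity :: "real^3 \<Rightarrow> real^3" where "velocity \<equiv> axifield A g k"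

lemma divergence_velocity: "X \<in> axial_cone I \<Longrightarrow> divergence velocity X = 0"
  by (simp add: divergence_axifield A_def)

lemma momentum_velocity:
  assumes "X \<in> axial_cone I"
  defines "x \<equiv> X $ 3 / norm X"
  shows "- laplacian velocity X + convection velocity X =
    ((1 / norm X) ^ 4 * (2 * press x + x * E3 x)) *\<^sub>R X
    - ((1 / norm X) ^ 3 * E3 x) *\<^sub>R axis 3 1
    - ((1 / norm X) ^ 4 * swirl_eq x) *\<^sub>R rot X"
proof -
  have 1: "2 * A x - (1 - x\<^sup>2) * A2 x + 4 * x * A1 x - (A x)\<^sup>2 + 2 * x * g x * A x
        - g x * (1 - x\<^sup>2) * A1 x - (k x)\<^sup>2 = 2 * press x + x * E3 x" for x
    unfolding press_def A_def A1_def A2_def E3_def H2_def q_def q1_def q2_def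
    by (simp add: field_simps power2_eq_square)
  have 2: "(1 - x\<^sup>2) * g2 x - 2 * x * g1 x - 2 * A1 x - x * (g x)\<^sup>2
        + (1 - x\<^sup>2) * g x * g1 x + x * (k x)\<^sup>2 = - E3 x" for x
    unfolding A1_def E3_def by (simp add: field_simps power2_eq_square)
  have 3: "(1 - x\<^sup>2) * k2 x - 4 * x * k1 x - 2 * k x
        + g x * ((1 - x\<^sup>2) * k1 x - 2 * x * k x) = swirl_eq x" for x
    unfolding swirl_eq_def V1_def by simp
  show ?thesis
    unfolding momentum_axifield[OF assms(1)] x_def 1 2 3 by simp
qed

lemma gradient_press:
  assumes "X \<in> axial_cone I"
  shows "gradient (hom 2 press) X = hom 4 (hat 2 press press1) X *\<^sub>R X + hom 3 press1 X *\<^sub>R axis 3 1"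
  using has_pd_imp_partial_deriv[OF has_pd_hom_on_cone[OF assms dpress]]
  by (simp add: gradient_def vec_eq_iff grad_hom_def) (simp add: axis_def)

text \<open>With \<open>press\<close> as pressure the X and e_3 components fail by the same factor,
  so the system reduces to two scalar equations on \<open>I\<close>. The identity serves both
  directions: to verify constructed solutions and to extract the equations from given ones.\<close>

lemma residual_velocity:
  assumes "X \<in> axial_cone I"
  defines "x \<equiv> X $ 3 / norm X"
  shows "- laplacian velocity X + convection velocity X + gradient (hom 2 press) X =
    ((1 / norm X) ^ 4 * x * ((H3 x + 2 * k x * V1 x) / 2)) *\<^sub>R X
    - ((1 / norm X) ^ 3 * ((H3 x + 2 * k x * V1 x) / 2)) *\<^sub>R axis 3 1
    - ((1 / norm X) ^ 4 * swirl_eq x) *\<^sub>R rot X"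
proof -
  have rearrange: "a *\<^sub>R v - b *\<^sub>R w - z + (c *\<^sub>R v + d *\<^sub>R w) = (a + c) *\<^sub>R v - (b - d) *\<^sub>R w - z"
    for a b c d and v w z :: "real^3"
    by (simp add: algebra_simps)
  have 1: "(1 / norm X) ^ 4 * (2 * press x + x * E3 x) + hom 4 (hat 2 press press1) X =
      (1 / norm X) ^ 4 * x * ((H3 x + 2 * k x * V1 x) / 2)"
    by (simp add: hom_def hat_def press1_def x_def[symmetric] algebra_simps)
  have 2: "(1 / norm X) ^ 3 * E3 x - hom 3 press1 X = (1 / norm X) ^ 3 * ((H3 x + 2 * k x * V1 x) / 2)"
    by (simp add: hom_def press1_def x_def[symmetric] algebra_simps)
  show ?thesis
    unfolding momentum_velocity[OF assms(1), folded x_def] gradient_press[OF assms(1)] rearrange 1 2 ..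
qed

end

section \<open>Smoothness and homogeneity of fields on cones\<close>

lemma Ck_real_derivative:
  assumes "open S" "Ck_real (Suc k) f S" "\<And>x. x \<in> S \<Longrightarrow> (f has_field_derivative f' x) (at x)"
  shows "Ck_real k f' S"
proof -
  obtain h where h: "\<forall>x\<in>S. (f has_field_derivative h x) (at x)" "Ck_real k h S" using assms(2) by auto
  show ?thesis
    by (rule Ck_real_cong[OF assms(1) _ h(2)]) (use DERIV_unique h(1) assms(3) in blast)
qed

lemma Ck_vec_cong:
  assumes "open S" "\<And>x. x \<in> S \<Longrightarrow> f x = g x" "Ck_vec k f S"
  shows "Ck_vec k g S"
  using Ck_on_cong[OF assms(1,2), where k = k] assms(3) by (simp add: Ck_vec_eq_Ck_on[OF assms(1)])

lemma Ck_vec_subset: "Ck_vec k f S \<Longrightarrow> T \<subseteq> S \<Longrightarrow> Ck_vec k f T"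
proof (induction k arbitrary: f)
  case 0
  then show ?case using continuous_on_subset by simp blast
next
  case (Suc k)
  then obtain F where F: "\<forall>x\<in>S. (f has_derivative (\<lambda>h. \<Sum>i\<in>UNIV. (h $ i) *\<^sub>R F i x)) (at x)"
    "\<forall>i. Ck_vec k (F i) S" unfolding Ck_vec.simps by blast
  with Suc show ?case unfolding Ck_vec.simps by (intro exI[of _ F]) blast
qed

lemma Ck_vec_diff: "Ck_vec k f S \<Longrightarrow> Ck_vec k g S \<Longrightarrow> Ck_vec k (\<lambda>x. f x - g x) S"
  using Ck_vec_add[of k f S "\<lambda>x. (-1) *\<^sub>R g x"] Ck_vec_scaleR[OF Ck_vec_const, of k g S "-1"] by simp

lemma zero_notin_cone: "0 \<notin> axial_cone I"
  by (simp add: axial_cone_def)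

lemma Ck_vec_inverse_norm:
  assumes "open I"
  shows "Ck_vec k (\<lambda>X. 1 / norm X) (axial_cone I)"
proof -
  have "Ck_vec k (\<lambda>X::real^3. (\<Sum>i\<in>UNIV. X $ i * X $ i) powr (-1/2)) (axial_cone I)"
  proof (rule Ck_vec_compose_real[OF _ Ck_real_powr[of "{0<..}"]])
    show "Ck_vec k (\<lambda>X::real^3. \<Sum>i\<in>UNIV. X $ i * X $ i) (axial_cone I)"
      by (intro Ck_vec_sum Ck_vec_mult Ck_vec_component)
    have "(\<Sum>i\<in>UNIV. X $ i * X $ i) > 0" if "X \<in> axial_cone I" for X :: "real^3"
      using that zero_notin_cone[of I] inner_gt_zero_iff[of X] by (auto simp: inner_vec_def)
    then show "(\<lambda>X::real^3. \<Sum>i\<in>UNIV. X $ i * X $ i) ` axial_cone I \<subseteq> {0<..}" by auto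
  qed auto
  moreover have "(\<Sum>i\<in>UNIV. X $ i * X $ i) powr (-1/2) = 1 / norm X" if "X \<in> axial_cone I" for X :: "real^3"
  proof -
    have "(\<Sum>i\<in>UNIV. X $ i * X $ i) = (norm X)\<^sup>2"
      by (simp add: power2_norm_eq_inner inner_vec_def)
    moreover have "norm X > 0" using that zero_notin_cone[of I] by auto
    moreover have "(norm X)\<^sup>2 powr (-1/2) = (norm X powr 2) powr (-1/2)" by simp
    moreover have "\<dots> = 1 / norm X"
      unfolding powr_powr using \<open>norm X > 0\<close> by (simp add: powr_minus_divide)
    ultimately show ?thesis by simp
  qed
  ultimately show ?thesis by (rule Ck_vec_cong[OF open_cone[OF assms], rotated])
qed

lemma Ck_vec_hom:
  assumes "open I" "Ck_real k \<phi> I"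
  shows "Ck_vec k (hom n \<phi>) (axial_cone I)"
proof -
  have "Ck_vec k (\<lambda>X. X $ 3 * (1 / norm X)) (axial_cone I)"
    by (intro Ck_vec_mult Ck_vec_component Ck_vec_inverse_norm assms)
  moreover have "(\<lambda>X. X $ 3 * (1 / norm X)) ` axial_cone I \<subseteq> I" by (auto simp: axial_cone_def)
  ultimately have "Ck_vec k (\<lambda>X. \<phi> (X $ 3 * (1 / norm X))) (axial_cone I)"
    by (rule Ck_vec_compose_real[OF _ assms(2)])
  then have "Ck_vec k (\<lambda>X. (1 / norm X) ^ n * \<phi> (X $ 3 * (1 / norm X))) (axial_cone I)"
    by (intro Ck_vec_mult Ck_vec_power Ck_vec_inverse_norm assms)
  then show ?thesis by (simp add: hom_def[abs_def])
qed

lemma Ck_vec_axifield: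
  assumes "open I" "Ck_real n A I" "Ck_real n g I" "Ck_real n k I"
  shows "Ck_vec n (axifield A g k) (axial_cone I)"
  unfolding axifield_def[abs_def]
  by (intro Ck_vec_add Ck_vec_diff Ck_vec_scaleR Ck_vec_const Ck_vec_hom assms
     Ck_vec_bounded_linear[OF bounded_linear_rot] Ck_vec_bounded_linear[OF bounded_linear_ident])

lemma slit_space_eq_cone: "slit_space = axial_cone {-1<..}"
proof (intro set_eqI iffI)
  fix X :: "real^3"
  assume X: "X \<in> slit_space"
  then have "X \<noteq> 0" by (auto simp: slit_space_def)
  have n: "(norm X)\<^sup>2 = (X $ 1)\<^sup>2 + (X $ 2)\<^sup>2 + (X $ 3)\<^sup>2"
    unfolding power2_norm_eq_inner by (simp add: inner_vec_def sum_3 power2_eq_square)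
  have "- norm X < X $ 3"
  proof (rule ccontr)
    assume "\<not> - norm X < X $ 3"
    then have *: "norm X \<le> - X $ 3" by simp
    then have "(norm X)\<^sup>2 \<le> (X $ 3)\<^sup>2" using power_mono[OF *, of 2] by simp
    with n have "(X $ 1)\<^sup>2 + (X $ 2)\<^sup>2 \<le> 0" by simp
    then have "X $ 1 = 0 \<and> X $ 2 = 0" by (simp add: sum_power2_le_zero_iff)
    moreover have "X $ 3 \<le> 0" using * norm_ge_zero[of X] by linarith
    ultimately show False using X by (simp add: slit_space_def)
  qed
  then show "X \<in> axial_cone {-1<..}" using \<open>X \<noteq> 0\<close> by (simp add: axial_cone_def field_simps)
next
  fix X :: "real^3"
  assume X: "X \<in> axial_cone {-1<..}"
  show "X \<in> slit_space"
  proof (rule ccontr)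
    assume "X \<notin> slit_space"
    then have *: "X $ 1 = 0" "X $ 2 = 0" "X $ 3 \<le> 0" by (auto simp: slit_space_def)
    then have "norm X = - X $ 3" by (simp add: norm_eq_sqrt_inner inner_vec_def sum_3)
    with X show False by (auto simp: axial_cone_def split: if_splits)
  qed
qed

lemma component_le_norm_3:
  fixes X :: "real^3"
  shows "X $ 3 / norm X \<le> 1"
  using component_le_norm_cart[of X 3] by (cases "X = 0") (auto simp: field_simps)

lemma slit_space_subset_cone: "{-1<..1} \<subseteq> I \<Longrightarrow> slit_space \<subseteq> axial_cone I"
  using component_le_norm_3 by (auto simp: slit_space_eq_cone axial_cone_def)

lemma open_slit_space: "open slit_space"
  unfolding slit_space_eq_cone by (rule open_cone) simp

lemma hom_scaleR: "c > 0 \<Longrightarrow> hom n \<phi> (c *\<^sub>R X) = (1 / c) ^ n * hom n \<phi> X"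
  by (simp add: hom_def power_divide power_mult_distrib)

lemma rot_scaleR: "rot (c *\<^sub>R X) = c *\<^sub>R rot X"
  using linear_cmul[OF bounded_linear.linear[OF bounded_linear_rot]] .

lemma homogeneous_axifield: "homogeneous_on (-1) (axifield A g k) S"
  unfolding homogeneous_on_def axifield_def
  by (simp add: hom_scaleR rot_scaleR power_int_minus power2_eq_square algebra_simps)
     (simp add: field_simps)

lemma homogeneous_hom_2: "homogeneous_on (-2) (hom 2 \<phi>) S"
  unfolding homogeneous_on_def
  by (simp add: hom_scaleR power_int_minus field_simps)

lemma norm_e_r: "norm (e_r \<theta> \<phi>) = 1"
proof -
  have "(sin \<theta> * cos \<phi>)\<^sup>2 + (sin \<theta> * sin \<phi>)\<^sup>2 + (cos \<theta>)\<^sup>2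
    = (sin \<theta>)\<^sup>2 * ((sin \<phi>)\<^sup>2 + (cos \<phi>)\<^sup>2) + (cos \<theta>)\<^sup>2"
    by (simp only: power_mult_distrib algebra_simps)
  then show ?thesis
    by (simp add: norm_eq_sqrt_inner inner_vec_def sum_3 e_r_def power2_eq_square[symmetric])
qed

lemma e_r_3: "e_r \<theta> \<phi> $ 3 = cos \<theta>"
  by (simp add: e_r_def)

lemma axifield_e_r:
  "axifield A g k (e_r \<theta> \<phi>) = (A (cos \<theta>) - cos \<theta> * g (cos \<theta>)) *\<^sub>R e_r \<theta> \<phi>
     + (sin \<theta> * g (cos \<theta>)) *\<^sub>R e_theta \<theta> \<phi> + (sin \<theta> * k (cos \<theta>)) *\<^sub>R e_phi \<theta> \<phi>"
proof -
  have "axis 3 1 = cos \<theta> *\<^sub>R e_r \<theta> \<phi> - sin \<theta> *\<^sub>R e_theta \<theta> \<phi>"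
    by (simp add: vec_eq_iff forall_3 e_r_def e_theta_def axis_def flip: power2_eq_square)
  moreover have "rot (e_r \<theta> \<phi>) = sin \<theta> *\<^sub>R e_phi \<theta> \<phi>"
    by (simp add: vec_eq_iff forall_3 e_r_def e_phi_def rot_def)
  ultimately show ?thesis
    by (simp only: axifield_def hom_def norm_e_r e_r_3) (simp add: algebra_simps)
qed

context axi_profile
begin

lemma deriv_one_minus_square_mult: "x \<in> I \<Longrightarrow> deriv (\<lambda>x. (1 - x\<^sup>2) * g x) x = A x - x * g x"
  by (rule DERIV_imp_deriv)
     (auto intro!: derivative_eq_intros dg simp: A_def power2_eq_square algebra_simps)

text \<open>As \<open>I\<close> contains 1, the cone over it covers the positive axis, so smoothness
  and the equations hold there by the same formulas and no removable singularity arises.\<close>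

lemma axisymmetric_NS_solutionI:
  assumes I: "{-1<..1} \<subseteq> I"
    and smooth: "\<And>n. Ck_real n g I" "\<And>n. Ck_real n k I"
    and eqs: "\<And>x. x \<in> I \<Longrightarrow> H3 x + 2 * k x * V1 x = 0" "\<And>x. x \<in> I \<Longrightarrow> swirl_eq x = 0"
  shows "axisymmetric_NS_solution (\<lambda>x. (1 - x\<^sup>2) * g x) (\<lambda>x. (1 - x\<^sup>2) * k x)"
proof -
  have s1: "Ck_real n g1 I" for n by (rule Ck_real_derivative[OF open_I smooth(1) dg])
  have s2: "Ck_real n g2 I" for n by (rule Ck_real_derivative[OF open_I s1 dg1])
  have s3: "Ck_real n g3 I" for n by (rule Ck_real_derivative[OF open_I s2 dg2])
  note s = Ck_real_add Ck_real_diff Ck_real_mult Ck_real_const Ck_real_id Ck_real_power smooth s1 s2 s3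
  have sA: "Ck_real n A I" for n unfolding A_def[abs_def] by (intro s)
  \<comment> \<open>Division by 2 becomes a product, the form that the closure rules accept.\<close>
  have half: "press x = (1/2) * (2 * ((1 - x\<^sup>2) * g1 x - 2 * x * g x) - ((1 - x\<^sup>2)\<^sup>2 * q2 x
     - 8 * x * (1 - x\<^sup>2) * q1 x + (8 * x\<^sup>2 - 4 * (1 - x\<^sup>2)) * (g1 x + (1/2) * (g x)\<^sup>2))
     - (1 - x\<^sup>2) * ((g x)\<^sup>2 + (k x)\<^sup>2))" for x
    by (simp add: press_def H2_def q_def)
  have sp: "Ck_real n press I" for n
    unfolding half[abs_def] q1_def q2_def by (intro s)
  have sub: "slit_space \<subseteq> axial_cone I" using slit_space_subset_cone[OF I] .
  have "smooth_on velocity slit_space" "smooth_on (hom 2 press) slit_space"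
    unfolding smooth_on_iff_Ck_vec[OF open_slit_space]
    using Ck_vec_subset[OF Ck_vec_axifield[OF open_I sA smooth] sub]
      Ck_vec_subset[OF Ck_vec_hom[OF open_I sp] sub] by auto
  moreover have "stationary_NS_on velocity (hom 2 press) slit_space"
    unfolding stationary_NS_on_def
  proof (intro ballI conjI)
    fix X assume "X \<in> slit_space"
    then have X: "X \<in> axial_cone I" using sub by blast
    then have x: "X $ 3 / norm X \<in> I" by (simp add: axial_cone_def)
    show "divergence velocity X = 0" by (rule divergence_velocity[OF X])
    show "- laplacian velocity X + convection velocity X + gradient (hom 2 press) X = 0"
      unfolding residual_velocity[OF X] using eqs[OF x] by simp
  qed
  moreover have "velocity (e_r \<theta> \<phi>) = deriv (\<lambda>x. (1 - x\<^sup>2) * g x) (cos \<theta>) *\<^sub>R e_r \<theta> \<phi>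
      + ((1 - (cos \<theta>)\<^sup>2) * g (cos \<theta>) / sin \<theta>) *\<^sub>R e_theta \<theta> \<phi>
      + ((1 - (cos \<theta>)\<^sup>2) * k (cos \<theta>) / sin \<theta>) *\<^sub>R e_phi \<theta> \<phi>"
    if "0 < \<theta>" "\<theta> < pi" for \<theta> \<phi>
  proof -
    have sn: "sin \<theta> > 0" using that by (simp add: sin_gt_zero)
    have "(cos \<theta>)\<^sup>2 < 1" using sn sin_cos_squared_add[of \<theta>] zero_less_power[OF sn, of 2] by linarith
    then have "\<bar>cos \<theta>\<bar> < 1" by (simp add: abs_square_less_1)
    then have "cos \<theta> \<in> I" using I by auto
    with sn show ?thesis
      by (simp add: axifield_e_r deriv_one_minus_square_mult flip: sin_squared_eq)
         (simp add: power2_eq_square)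
  qed
  ultimately show ?thesis unfolding axisymmetric_NS_solution_def
    using homogeneous_axifield homogeneous_hom_2 by blast
qed

end

section \<open>The ordinary differential equations of a solution\<close>

lemma laplacian_cong_open:
  assumes "open S" "X \<in> S" "\<And>Y. Y \<in> S \<Longrightarrow> f Y = g Y"
  shows "laplacian f X = laplacian g X"
proof -
  have "partial_deriv i (partial_deriv i f) X = partial_deriv i (partial_deriv i g) X" for i
    by (rule partial_deriv_cong_open[OF assms(1,2)]) (rule partial_deriv_cong_open[OF assms(1) _ assms(3)])
  then show ?thesis by (simp add: laplacian_def)
qed

lemma convection_cong_open:
  assumes "open S" "X \<in> S" "\<And>Y. Y \<in> S \<Longrightarrow> f Y = g Y"
  shows "convection f X = convection g X"
  unfolding convection_def using partial_deriv_cong_open[OF assms] assms(2,3) by simp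

lemma gradient_cong_open:
  assumes "open S" "X \<in> S" "\<And>Y. Y \<in> S \<Longrightarrow> f Y = g Y"
  shows "gradient f X = gradient g X"
  unfolding gradient_def using partial_deriv_cong_open[OF assms] by simp

text \<open>Differentiate p (c X) = p X / c^2 at c = 1. The pressure of a given solution is not
  assumed to be axisymmetric; this relation computes it from its gradient, which the momentum
  equation expresses through the velocity.\<close>

lemma euler_homogeneous:
  assumes hom: "homogeneous_on (-2) p S" and X: "X \<in> S" and diff: "p differentiable (at X)"
  shows "X \<bullet> gradient p X = - 2 * p X"
proof -
  define D where "D = frechet_derivative p (at X)"
  have D: "(p has_derivative D) (at X)"
    using diff unfolding D_def by (simp add: frechet_derivative_works)
  have "D X = (\<Sum>i\<in>UNIV. X $ i * partial_deriv i p X)"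
    using linear_axis_expansion[OF has_derivative_linear[OF D], of X] by (simp add: partial_deriv_def D_def)
  then have DX: "D X = X \<bullet> gradient p X" by (simp add: inner_vec_def gradient_def)
  have "((\<lambda>c. c *\<^sub>R X) has_derivative (\<lambda>h. h *\<^sub>R X)) (at 1)"
    by (intro bounded_linear_imp_has_derivative bounded_linear_scaleR_left)
  from has_derivative_compose[OF this] D
  have "((\<lambda>c. p (c *\<^sub>R X)) has_derivative (\<lambda>h. D (h *\<^sub>R X))) (at 1)" by simp
  then have "((\<lambda>c. p (c *\<^sub>R X)) has_field_derivative D X) (at 1)"
    unfolding has_field_derivative_def
    by (simp add: linear_cmul[OF has_derivative_linear[OF D]] mult_commute_abs)
  moreover have "((\<lambda>c. (1 / c\<^sup>2) * p X) has_field_derivative - 2 * p X) (at 1)"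
    by (auto intro!: derivative_eq_intros)
  then have "((\<lambda>c. p (c *\<^sub>R X)) has_field_derivative - 2 * p X) (at 1)"
    by (rule has_field_derivative_transform_within_open[of _ _ _ "{0<..}"])
       (use hom X in \<open>auto simp: homogeneous_on_def power_int_minus divide_inverse\<close>)
  ultimately show ?thesis using DERIV_unique DX by metis
qed

text \<open>The half circle of longitude 0 parametrized by t = cos \<theta>; it is smooth for |t| <
  1 but only continuous at the north pole t = 1.\<close>

definition meridian :: "real \<Rightarrow> real^3" where
  "meridian t = vector [sqrt (1 - t\<^sup>2), 0, t]"

lemma meridian_eq_e_r: "\<bar>t\<bar> < 1 \<Longrightarrow> meridian t = e_r (arccos t) 0"
  by (simp add: meridian_def e_r_def sin_arccos_abs)

lemma meridian_in_slit_space: "-1 < t \<Longrightarrow> t \<le> 1 \<Longrightarrow> meridian t \<in> slit_space"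
  using abs_square_less_1[of t]
  by (auto simp: slit_space_def meridian_def not_le abs_if power2_eq_1_iff split: if_splits)

lemma Ck_real_sqrt_one_minus_square: "Ck_real n (\<lambda>t. sqrt (1 - t\<^sup>2)) {-1<..<1}"
proof -
  have *: "1 - t\<^sup>2 > 0" if "t \<in> {-1<..<1}" for t :: real
    using that abs_square_less_1[of t] by auto
  have "Ck_real n (\<lambda>t. (1 - t\<^sup>2) powr (1/2)) {-1<..<1}"
    by (rule Ck_real_compose[OF _ Ck_real_powr[of "{0<..}"]])
       (use * in \<open>auto intro!: Ck_real_diff Ck_real_const Ck_real_power Ck_real_id\<close>)
  then show ?thesis
    by (rule Ck_real_cong[rotated 2]) (use * in \<open>auto simp: powr_half_sqrt less_imp_le\<close>)
qed

lemma Ck_real_meridian: "Ck_real n (\<lambda>t. meridian t $ i) {-1<..<1}"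
proof -
  consider "i = 1" | "i = 2" | "i = 3" using exhaust_3[of i] by blast
  then show ?thesis
    by cases (simp_all add: meridian_def Ck_real_sqrt_one_minus_square Ck_real_const Ck_real_id)
qed

lemma cone_open_interval_obtain_angles:
  assumes "X \<in> axial_cone {-1<..<1}"
  obtains \<theta> \<phi> where "0 < \<theta>" "\<theta> < pi" "X = norm X *\<^sub>R e_r \<theta> \<phi>"
proof -
  define r where "r = norm X"
  define \<theta> where "\<theta> = arccos (X $ 3 / r)"
  have "X \<noteq> 0" and "X $ 3 / r \<in> {-1<..<1}" using assms by (simp_all add: axial_cone_def r_def)
  then have r: "r > 0" by (simp add: r_def)
  have x: "\<bar>X $ 3 / r\<bar> < 1"
    using \<open>X $ 3 / r \<in> _\<close> unfolding greaterThanLessThan_iff abs_less_iff by linarith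
  have c: "cos \<theta> = X $ 3 / r" using x by (simp add: \<theta>_def cos_arccos_abs)
  have th: "0 < \<theta>" "\<theta> < pi" using x arccos_lt_bounded[of "X $ 3 / r"] by (auto simp: \<theta>_def abs_if split: if_splits)
  then have s: "sin \<theta> > 0" by (simp add: sin_gt_zero)
  have n: "r\<^sup>2 = (X $ 1)\<^sup>2 + (X $ 2)\<^sup>2 + (X $ 3)\<^sup>2"
    unfolding r_def power2_norm_eq_inner by (simp add: inner_vec_def sum_3 power2_eq_square)
  have "(r * sin \<theta>)\<^sup>2 = (X $ 1)\<^sup>2 + (X $ 2)\<^sup>2"
  proof -
    have "(r * sin \<theta>)\<^sup>2 = r\<^sup>2 - (r * cos \<theta>)\<^sup>2"
      by (simp add: power_mult_distrib sin_squared_eq algebra_simps)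
    then show ?thesis using n r by (simp add: c)
  qed
  then have "((X $ 1)\<^sup>2 + (X $ 2)\<^sup>2) / (r * sin \<theta>)\<^sup>2 = 1"
    using r s by (metis divide_self_if less_numeral_extra(3) mult_pos_pos zero_less_power)
  then have "(X $ 1 / (r * sin \<theta>))\<^sup>2 + (X $ 2 / (r * sin \<theta>))\<^sup>2 = 1"
    by (simp only: power_divide add_divide_distrib)
  then obtain \<phi> where "X $ 1 / (r * sin \<theta>) = cos \<phi>" "X $ 2 / (r * sin \<theta>) = sin \<phi>"
    using sincos_total_2pi by metis
  then have "X = r *\<^sub>R e_r \<theta> \<phi>"
    using r s c by (simp add: vec_eq_iff forall_3 e_r_def field_simps)
  with th that show ?thesis unfolding r_def by blast
qed

lemma Ck_vec_compose_linear:
  assumes "bounded_linear L"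
  shows "Ck_vec k f S \<Longrightarrow> Ck_vec k (\<lambda>x. L (f x)) S"
proof (induction k arbitrary: f)
  case 0
  then show ?case using bounded_linear.continuous_on[OF assms] by simp
next
  case (Suc k)
  then obtain F where F: "\<forall>x\<in>S. (f has_derivative (\<lambda>h. \<Sum>i\<in>UNIV. (h $ i) *\<^sub>R F i x)) (at x)"
    "\<forall>i. Ck_vec k (F i) S" unfolding Ck_vec.simps by blast
  have "((\<lambda>x. L (f x)) has_derivative (\<lambda>h. \<Sum>i\<in>UNIV. (h $ i) *\<^sub>R L (F i x))) (at x)"
    if "x \<in> S" for x
    using bounded_linear.has_derivative[OF assms F(1)[rule_format, OF that]]
      bounded_linear.linear[OF assms] by (simp add: linear_sum linear_cmul)
  then show ?case using F(2) Suc.IH unfolding Ck_vec.simps by (intro exI[of _ "\<lambda>i x. L (F i x)"]) blast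
qed

lemma e_r_in_slit_space: "0 < \<theta> \<Longrightarrow> \<theta> < pi \<Longrightarrow> e_r \<theta> \<phi> \<in> slit_space"
  using norm_e_r[of \<theta> \<phi>] cos_monotone_0_pi[of \<theta> pi]
  by (auto simp: slit_space_eq_cone axial_cone_def e_r_3)

text \<open>On the cone over |x| < 1 the solution coincides with an \<open>axifield\<close> whose
  profiles are read off on one meridian; \<open>euler_homogeneous\<close> gives the pressure and
  \<open>residual_velocity\<close> the equations. The limit of V is the only information taken from
  the north pole.\<close>

lemma axisymmetric_NS_solutionD:
  assumes "axisymmetric_NS_solution U V"
  shows "(V \<longlongrightarrow> 0) (at_left 1)"
    and "\<exists>U1 V1 H1 H2. \<forall>x\<in>{-1<..<1}.
       (U has_field_derivative U1 x) (at x) \<and> (V has_field_derivative V1 x) (at x) \<and>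
       (V1 has_field_derivative - (U x / (1 - x\<^sup>2)) * V1 x) (at x) \<and>
       ((\<lambda>x. (1 - x\<^sup>2) * U1 x + 2 * x * U x + (U x)\<^sup>2 / 2) has_field_derivative H1 x) (at x) \<and>
       (H1 has_field_derivative H2 x) (at x) \<and>
       (H2 has_field_derivative - 2 * V x * V1 x / (1 - x\<^sup>2)) (at x)"
proof -
  let ?I = "{-1<..<1} :: real set"
  obtain u p where smooth: "smooth_on u slit_space" "smooth_on p slit_space"
    and homogeneous: "homogeneous_on (-1) u slit_space" "homogeneous_on (-2) p slit_space"
    and NS: "stationary_NS_on u p slit_space"
    and u: "\<And>\<theta> \<phi>. 0 < \<theta> \<Longrightarrow> \<theta> < pi \<Longrightarrow> u (e_r \<theta> \<phi>) = deriv U (cos \<theta>) *\<^sub>R e_r \<theta> \<phi>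
                      + (U (cos \<theta>) / sin \<theta>) *\<^sub>R e_theta \<theta> \<phi> + (V (cos \<theta>) / sin \<theta>) *\<^sub>R e_phi \<theta> \<phi>"
    using assms unfolding axisymmetric_NS_solution_def by blast
  define S where "S t = sqrt (1 - t\<^sup>2)" for t
  have pos: "1 - t\<^sup>2 > 0" if "t \<in> ?I" for t
    using that abs_square_less_1[of t] by auto
  then have S: "S t > 0" "S t * S t = 1 - t\<^sup>2" if "t \<in> ?I" for t
    using that by (simp_all add: S_def less_imp_le)
  have um: "u (meridian t) = vector [deriv U t * S t + U t / S t * t, V t / S t, deriv U t * t - U t]"
    if "t \<in> ?I" for t
  proof -
    have t: "\<bar>t\<bar> < 1" using that by auto
    have "0 < arccos t" "arccos t < pi" using arccos_lt_bounded[of t] that by auto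
    from u[OF this, of 0] t S(1)[OF that] show ?thesis
      by (simp add: meridian_eq_e_r cos_arccos_abs sin_arccos_abs S_def[symmetric])
         (simp add: vec_eq_iff forall_3 e_r_def e_theta_def e_phi_def cos_arccos_abs sin_arccos_abs S_def[symmetric])
  qed
  have cont: "continuous_on slit_space u"
    using smooth(1) by (simp add: smooth_on_def) (metis Ck_on.simps(1))
  \<comment> \<open>V is sin \<theta> times the azimuthal component of u; u is continuous at the
    north pole and sin \<theta> vanishes there.\<close>
  show "(V \<longlongrightarrow> 0) (at_left 1)"
  proof -
    have "isCont u (meridian 1)"
      using cont open_slit_space meridian_in_slit_space[of 1] by (simp add: continuous_on_eq_continuous_at)
    moreover have "(meridian \<longlongrightarrow> meridian 1) (at_left 1)"
      proof (rule vec_tendstoI)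
      fix i :: 3
      have "((\<lambda>t::real. sqrt (1 - t\<^sup>2)) \<longlongrightarrow> sqrt (1 - 1\<^sup>2)) (at_left 1)" by (intro tendsto_intros)
      then show "((\<lambda>t. meridian t $ i) \<longlongrightarrow> meridian 1 $ i) (at_left 1)"
        using exhaust_3[of i] by (auto simp: meridian_def intro: tendsto_ident_at)
    qed
    ultimately have "((\<lambda>t. u (meridian t)) \<longlongrightarrow> u (meridian 1)) (at_left 1)"
      by (rule isCont_tendsto_compose)
    then have "((\<lambda>t. S t * u (meridian t) $ 2) \<longlongrightarrow> S 1 * u (meridian 1) $ 2) (at_left 1)"
      unfolding S_def by (intro tendsto_intros)
    moreover have "eventually (\<lambda>t. S t * u (meridian t) $ 2 = V t) (at_left 1)"
      using eventually_at_left_real[of "-1" 1]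
    proof (rule eventually_mono)
      fix t :: real assume "t \<in> ?I"
      then show "S t * u (meridian t) $ 2 = V t" using um S(1)[of t] by simp
    qed simp
    ultimately show ?thesis by (simp add: S_def tendsto_cong)
  qed
  define g where "g t = U t / (1 - t\<^sup>2)" for t
  define k where "k t = V t / (1 - t\<^sup>2)" for t
  have sm: "Ck_real n (\<lambda>t. u (meridian t) $ i) ?I" for n i
  proof (rule Ck_real_compose_curve[OF Ck_vec_compose_linear[OF bounded_linear_vec_nth] Ck_real_meridian])
    show "Ck_vec n u slit_space" using smooth(1) smooth_on_iff_Ck_vec[OF open_slit_space, of u] by blast
    show "meridian ` ?I \<subseteq> slit_space" using meridian_in_slit_space by auto
  qed
  have sS: "Ck_real n (\<lambda>t. 1 / S t) ?I" for n
    by (rule Ck_real_inverse) (use S(1) Ck_real_sqrt_one_minus_square in \<open>auto simp: S_def\<close>)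
  \<comment> \<open>This combination of the first and third components cancels
    \<open>deriv U\<close>, since the differentiability of U is not known yet.\<close>
  have sg: "Ck_real n g ?I" for n
  proof (rule Ck_real_cong)
    show "Ck_real n (\<lambda>t. 1 / S t * t * u (meridian t) $ 1 - u (meridian t) $ 3) ?I"
      by (intro Ck_real_diff Ck_real_mult sS sm Ck_real_id)
    fix t assume t: "t \<in> ?I"
    have "1 / S t * t * u (meridian t) $ 1 - u (meridian t) $ 3 = U t * (t\<^sup>2 / (S t * S t) + 1)"
      using S(1)[OF t] by (simp add: um[OF t] field_simps power2_eq_square)
    also have "t\<^sup>2 / (S t * S t) + 1 = 1 / (1 - t\<^sup>2)"
      unfolding S(2)[OF t] using pos[OF t] by (simp add: field_simps)
    finally show "1 / S t * t * u (meridian t) $ 1 - u (meridian t) $ 3 = g t" by (simp add: g_def)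
  qed simp
  have sk: "Ck_real n k ?I" for n
  proof (rule Ck_real_cong)
    show "Ck_real n (\<lambda>t. 1 / S t * u (meridian t) $ 2) ?I"
      by (intro Ck_real_mult sS sm)
    fix t assume t: "t \<in> ?I"
    show "1 / S t * u (meridian t) $ 2 = k t" by (simp add: um[OF t] k_def S(2)[OF t])
  qed simp
  obtain g1 g2 g3 g4 where dg: "\<And>x. x \<in> ?I \<Longrightarrow> (g has_field_derivative g1 x) (at x) \<and>
      (g1 has_field_derivative g2 x) (at x) \<and> (g2 has_field_derivative g3 x) (at x) \<and>
      (g3 has_field_derivative g4 x) (at x)"
    using Ck_real_four_derivs[OF open_greaterThanLessThan sg] by blast
  obtain k1 k2 where dk: "\<And>x. x \<in> ?I \<Longrightarrow> (k has_field_derivative k1 x) (at x) \<and>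
      (k1 has_field_derivative k2 x) (at x)"
    using Ck_real_four_derivs[OF open_greaterThanLessThan sk] by metis
  interpret axi_profile ?I g g1 g2 g3 g4 k k1 k2
    using dg dk by unfold_locales auto
  have UG: "U x = (1 - x\<^sup>2) * g x" if "x \<in> ?I" for x
    using pos[OF that] by (simp add: g_def)
  have VK: "V x = (1 - x\<^sup>2) * k x" if "x \<in> ?I" for x
    using pos[OF that] by (simp add: k_def)
  have dU: "(U has_field_derivative A x - x * g x) (at x)" if "x \<in> ?I" for x
  proof (rule has_field_derivative_transform_within_open[where S = ?I])
    show "((\<lambda>x. (1 - x\<^sup>2) * g x) has_field_derivative A x - x * g x) (at x)"
      by (auto intro!: derivative_eq_intros dg that simp: A_def power2_eq_square algebra_simps)
  qed (use that UG in auto)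
  have dV: "(V has_field_derivative V1 x) (at x)" if "x \<in> ?I" for x
  proof (rule has_field_derivative_transform_within_open[where S = ?I])
    show "((\<lambda>x. (1 - x\<^sup>2) * k x) has_field_derivative V1 x) (at x)"
      by (auto intro!: derivative_eq_intros dk that simp: V1_def power2_eq_square algebra_simps)
  qed (use that VK in auto)
  let ?u = "axifield A g k"
  have uu: "u X = ?u X" if X: "X \<in> axial_cone ?I" for X
  proof -
    obtain \<theta> \<phi> where th: "0 < \<theta>" "\<theta> < pi" "X = norm X *\<^sub>R e_r \<theta> \<phi>"
      using cone_open_interval_obtain_angles[OF X] .
    have r: "norm X > 0" using X by (auto simp: axial_cone_def)
    have s: "sin \<theta> > 0" using th by (simp add: sin_gt_zero)
    have c: "cos \<theta> \<in> ?I" using cos_monotone_0_pi[of \<theta> pi] cos_monotone_0_pi[of 0 \<theta>] th by simp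
    have "u (e_r \<theta> \<phi>) = ?u (e_r \<theta> \<phi>)"
      using s c by (simp add: u[OF th(1,2)] axifield_e_r DERIV_imp_deriv[OF dU] UG VK
          flip: sin_squared_eq) (simp add: power2_eq_square)
    then have "u (norm X *\<^sub>R e_r \<theta> \<phi>) = ?u (norm X *\<^sub>R e_r \<theta> \<phi>)"
      using homogeneous(1) homogeneous_axifield[of A g k slit_space] r e_r_in_slit_space[OF th(1,2)]
      unfolding homogeneous_on_def by simp
    then show ?thesis using th(3) by simp
  qed
  have sub: "axial_cone ?I \<subseteq> slit_space" by (auto simp: slit_space_eq_cone axial_cone_def)
  have op: "open (axial_cone ?I)" by (simp add: open_cone)
  have NS1: "- laplacian ?u X + convection ?u X + gradient p X = 0" if "X \<in> axial_cone ?I" for X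
  proof -
    have "laplacian u X = laplacian ?u X" "convection u X = convection ?u X"
      by (rule laplacian_cong_open[OF op that uu] convection_cong_open[OF op that uu]; assumption)+
    then show ?thesis using NS subsetD[OF sub that] unfolding stationary_NS_on_def by auto
  qed
  \<comment> \<open>Pairing the momentum equation with X removes the \<open>rot X\<close> term and,
    by Euler's relation, leaves 2 p. So p is axisymmetric after all and equals the pressure used in
    \<open>residual_velocity\<close>.\<close>
  have pp: "p X = hom 2 press X" if X: "X \<in> axial_cone ?I" for X
  proof -
    define s x where "s = 1 / norm X" and "x = X $ 3 / norm X"
    have r: "norm X > 0" using X by (auto simp: axial_cone_def)
    have "p differentiable (at X)"
      using smooth(2) X sub unfolding smooth_on_def by (metis Ck_on.simps(2) subsetD)
    then have "X \<bullet> gradient p X = - 2 * p X"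
      using euler_homogeneous[OF homogeneous(2)] X sub by blast
    moreover have "gradient p X = - (- laplacian ?u X + convection ?u X)"
      using NS1[OF X] by (simp only: eq_neg_iff_add_eq_0 add.commute)
    moreover have "X \<bullet> rot X = 0" by (simp add: inner_vec_def sum_3 rot_def)
    moreover have "X \<bullet> X = (norm X)\<^sup>2" "X \<bullet> axis 3 1 = X $ 3"
      by (simp_all add: power2_norm_eq_inner inner_axis)
    ultimately have "2 * p X = s ^ 4 * (2 * press x + x * E3 x) * (norm X)\<^sup>2 - s ^ 3 * E3 x * X $ 3"
      unfolding momentum_velocity[OF X] s_def x_def by (simp add: inner_diff_right)
    also have "\<dots> = 2 * (s\<^sup>2 * press x)"
      using r by (simp add: s_def x_def field_simps power2_eq_square power3_eq_cube power4_eq_xxxx)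
    finally show ?thesis by (simp add: hom_def s_def x_def)
  qed
  have NS2: "((1 / norm X) ^ 4 * x * ((H3 x + 2 * k x * V1 x) / 2)) *\<^sub>R X
    - ((1 / norm X) ^ 3 * ((H3 x + 2 * k x * V1 x) / 2)) *\<^sub>R axis 3 1
    - ((1 / norm X) ^ 4 * swirl_eq x) *\<^sub>R rot X = 0" if "X \<in> axial_cone ?I" "x = X $ 3 / norm X" for X x
    using NS1[OF that(1)] residual_velocity[OF that(1)] gradient_cong_open[OF op that(1) pp] that(2) by simp
  have eqs: "H3 x + 2 * k x * V1 x = 0" "swirl_eq x = 0" if x: "x \<in> ?I" for x
  proof -
    have "\<bar>x\<bar> < 1" using x by auto
    then have n: "norm (meridian x) = 1" by (simp add: meridian_eq_e_r norm_e_r)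
    then have X: "meridian x \<in> axial_cone ?I" using x by (auto simp: axial_cone_def meridian_def)
    have r: "rot (meridian x) = vector [0, S x, 0]"
      by (simp add: vec_eq_iff forall_3 rot_def meridian_def S_def)
    define h where "h = (H3 x + 2 * k x * V1 x) / 2"
    have "(x * h) *\<^sub>R meridian x - h *\<^sub>R axis 3 1 - swirl_eq x *\<^sub>R vector [0, S x, 0] = 0"
      using NS2[OF X, of x] n unfolding r by (simp add: h_def) (simp add: meridian_def)
    \<comment> \<open>The first component is void at x = 0, where the third one, x^2 h = h, forces h
      = 0.\<close>
    then have "x * h * S x = 0" "swirl_eq x * S x = 0" "x * h * x = h"
      unfolding meridian_def S_def[symmetric] by (auto simp: vec_eq_iff forall_3 axis_def)
    with S(1)[OF x] have "swirl_eq x = 0" "x * h = 0" "x * h * x = h" by auto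
    then show "swirl_eq x = 0" "H3 x + 2 * k x * V1 x = 0" by (auto simp: h_def)
  qed
  show "\<exists>U1 V1 H1 H2. \<forall>x\<in>{-1<..<1}.
       (U has_field_derivative U1 x) (at x) \<and> (V has_field_derivative V1 x) (at x) \<and>
       (V1 has_field_derivative - (U x / (1 - x\<^sup>2)) * V1 x) (at x) \<and>
       ((\<lambda>x. (1 - x\<^sup>2) * U1 x + 2 * x * U x + (U x)\<^sup>2 / 2) has_field_derivative H1 x) (at x) \<and>
       (H1 has_field_derivative H2 x) (at x) \<and>
       (H2 has_field_derivative - 2 * V x * V1 x / (1 - x\<^sup>2)) (at x)"
  proof (intro exI ballI conjI)
    fix x assume x: "x \<in> ?I"
    show "(U has_field_derivative A x - x * g x) (at x)" by (rule dU[OF x])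
    show "(V has_field_derivative V1 x) (at x)" by (rule dV[OF x])
    have "(V1 has_field_derivative (1 - x\<^sup>2) * k2 x - 4 * x * k1 x - 2 * k x) (at x)"
      unfolding V1_def[abs_def]
      by (auto intro!: derivative_eq_intros dk dk1 x simp: power2_eq_square algebra_simps)
    moreover have "(1 - x\<^sup>2) * k2 x - 4 * x * k1 x - 2 * k x = - (U x / (1 - x\<^sup>2)) * V1 x"
      using eqs(2)[OF x] pos[OF x] by (simp add: swirl_eq_def UG[OF x])
    ultimately show "(V1 has_field_derivative - (U x / (1 - x\<^sup>2)) * V1 x) (at x)" by simp
    show "((\<lambda>x. (1 - x\<^sup>2) * (A x - x * g x) + 2 * x * U x + (U x)\<^sup>2 / 2) has_field_derivative H1 x) (at x)"
    proof (rule has_field_derivative_transform_within_open[OF dH[OF x]])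
      fix y assume y: "y \<in> ?I"
      show "H y = (1 - y\<^sup>2) * (A y - y * g y) + 2 * y * U y + (U y)\<^sup>2 / 2"
        by (simp add: UG[OF y] H_def q_def A_def field_simps power2_eq_square)
    qed (use x in auto)
    show "(H1 has_field_derivative H2 x) (at x)" by (rule dH1[OF x])
    have "H3 x = - 2 * V x * V1 x / (1 - x\<^sup>2)"
      using eqs(1)[OF x] pos[OF x] by (simp add: VK[OF x])
    then show "(H2 has_field_derivative - 2 * V x * V1 x / (1 - x\<^sup>2)) (at x)"
      using dH2[OF x] by simp
  qed
qed

section \<open>Vanishing of the swirl\<close>

lemma nondecreasing_of_deriv:
  fixes f :: "real \<Rightarrow> real"
  assumes "\<And>z. z \<in> {x..y} \<Longrightarrow> (f has_field_derivative f' z) (at z)"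
    "\<And>z. z \<in> {x..y} \<Longrightarrow> 0 \<le> f' z" "x \<le> y"
  shows "f x \<le> f y"
  by (rule DERIV_nonneg_imp_nondecreasing[OF assms(3)]) (use assms in auto)

lemma nonincreasing_of_deriv:
  fixes f :: "real \<Rightarrow> real"
  assumes "\<And>z. z \<in> {x..y} \<Longrightarrow> (f has_field_derivative f' z) (at z)"
    "\<And>z. z \<in> {x..y} \<Longrightarrow> f' z \<le> 0" "x \<le> y"
  shows "f y \<le> f x"
  by (rule DERIV_nonpos_imp_nonincreasing[OF assms(3)]) (use assms in auto)

lemma DERIV_ln_one_plus: "-1 < z \<Longrightarrow> ((\<lambda>x. ln (1 + x)) has_field_derivative 1 / (1 + z)) (at (z :: real))"
  by (auto intro!: derivative_eq_intros)

lemma DERIV_divide_one_plus: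
  fixes z a :: real
  assumes "-1 < z"
  shows "((\<lambda>x. a / (1 + x)) has_field_derivative - (a / (1 + z)\<^sup>2)) (at z)"
    "((\<lambda>x. a / (1 + x)\<^sup>2) has_field_derivative - (2 * a / (1 + z) ^ 3)) (at z)"
proof -
  have "((\<lambda>w. a / w) has_field_derivative - (a / w\<^sup>2)) (at w)"
    "((\<lambda>w. a / w\<^sup>2) has_field_derivative - (2 * a / w ^ 3)) (at w)" if "w \<noteq> 0" for w :: real
    using that by (auto intro!: derivative_eq_intros simp: field_simps power2_eq_square power3_eq_cube)
  from this[of "z + 1"] show "((\<lambda>x. a / (1 + x)) has_field_derivative - (a / (1 + z)\<^sup>2)) (at z)"
    "((\<lambda>x. a / (1 + x)\<^sup>2) has_field_derivative - (2 * a / (1 + z) ^ 3)) (at z)"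
    using assms by (simp_all add: DERIV_shift add.commute[of 1])
qed

lemma powr_minus_half: "0 < a \<Longrightarrow> a powr (-1/2) = 1 / sqrt a" for a :: real
  using powr_minus_divide[of a "1/2"] by (simp add: powr_half_sqrt)

text \<open>An integrating factor. The positive ratio shows at once that a solution vanishing at one
  point vanishes everywhere and that a nonzero one keeps its sign.\<close>

lemma linear_ode_ratio:
  fixes v c :: "real \<Rightarrow> real"
  assumes v: "\<And>x. x \<in> {l<..<r} \<Longrightarrow> (v has_field_derivative c x * v x) (at x)"
    and c: "continuous_on {l<..<r} c"
    and ab: "a \<in> {l<..<r}" "b \<in> {l<..<r}"
  obtains \<mu> where "\<mu> > 0" "v b = \<mu> * v a"
proof -
  define p q where "p = min a b" "q = max a b"
  have pq: "p \<le> q" "{p..q} \<subseteq> {l<..<r}" using ab by (auto simp: p_q_def)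
  obtain C where C: "\<And>x. x \<in> {p..q} \<Longrightarrow> (C has_vector_derivative c x) (at x within {p..q})"
    using antiderivative_continuous[OF continuous_on_subset[OF c pq(2)]] by blast
  have "((\<lambda>x. v x * exp (- C x)) has_field_derivative 0) (at x within {p..q})" if x: "x \<in> {p..q}" for x
  proof -
    have "(v has_field_derivative c x * v x) (at x within {p..q})"
      using v pq(2) x by (blast intro: has_field_derivative_at_within)
    moreover have "(C has_field_derivative c x) (at x within {p..q})"
      using C[OF x] by (simp add: has_real_derivative_iff_has_vector_derivative)
    ultimately show ?thesis by (auto intro!: derivative_eq_intros simp: algebra_simps)
  qed
  then obtain K where "\<And>x. x \<in> {p..q} \<Longrightarrow> v x * exp (- C x) = K"
    using has_field_derivative_zero_constant[of "{p..q}" "\<lambda>x. v x * exp (- C x)"] by auto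
  then have "v a * exp (- C a) = v b * exp (- C b)" using pq(1) by (auto simp: p_q_def)
  then have "v b = exp (C b - C a) * v a" by (simp add: exp_diff exp_minus field_simps)
  then show ?thesis using that[of "exp (C b - C a)"] by simp
qed

locale swirl_ode =
  fixes U V U1 V1 H1 H2 :: "real \<Rightarrow> real" and \<tau> :: real
  assumes dU: "\<And>x. x \<in> {-1<..<1} \<Longrightarrow> (U has_field_derivative U1 x) (at x)"
    and dV: "\<And>x. x \<in> {-1<..<1} \<Longrightarrow> (V has_field_derivative V1 x) (at x)"
    and dV1: "\<And>x. x \<in> {-1<..<1} \<Longrightarrow> (V1 has_field_derivative - (U x / (1 - x\<^sup>2)) * V1 x) (at x)"
    and dH: "\<And>x. x \<in> {-1<..<1} \<Longrightarrow>
       ((\<lambda>x. (1 - x\<^sup>2) * U1 x + 2 * x * U x + (U x)\<^sup>2 / 2) has_field_derivative H1 x) (at x)"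
    and dH1: "\<And>x. x \<in> {-1<..<1} \<Longrightarrow> (H1 has_field_derivative H2 x) (at x)"
    and dH2: "\<And>x. x \<in> {-1<..<1} \<Longrightarrow> (H2 has_field_derivative - 2 * V x * V1 x / (1 - x\<^sup>2)) (at x)"
    and V_lim: "(V \<longlongrightarrow> 0) (at_left 1)"
    and U_lim: "(U \<longlongrightarrow> \<tau>) (at_right (-1))"
    and \<tau>: "3 \<le> \<tau>"
begin

definition H where "H x = (1 - x\<^sup>2) * U1 x + 2 * x * U x + (U x)\<^sup>2 / 2"

lemma dH': "x \<in> {-1<..<1} \<Longrightarrow> (H has_field_derivative H1 x) (at x)"
  using dH unfolding H_def[abs_def] .

lemma one_minus_square_pos: "x \<in> {-1<..<1} \<Longrightarrow> (1 - x\<^sup>2 :: real) > 0"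
  using abs_square_less_1[of x] by auto

lemma V1_ratio:
  assumes "a \<in> {-1<..<1}" "b \<in> {-1<..<1}"
  obtains \<mu> where "\<mu> > 0" "V1 b = \<mu> * V1 a"
proof (rule linear_ode_ratio[OF dV1 _ assms])
  have "continuous_on {-1<..<1} U"
    using dU by (intro continuous_at_imp_continuous_on ballI) (rule DERIV_isCont)
  then show "continuous_on {-1<..<1} (\<lambda>x. - (U x / (1 - x\<^sup>2)))"
    using one_minus_square_pos by (intro continuous_intros) force+
qed

section \<open>Differential inequalities near the south pole when \<open>V1\<close> is
  negative\<close>

context
  assumes V1_neg0: "V1 0 < 0"
begin

lemma V1_neg: "x \<in> {-1<..<1} \<Longrightarrow> V1 x < 0"
  using V1_ratio[of 0 x] V1_neg0 by (metis greaterThanLessThan_iff mult_pos_neg neg_less_0_iff_less zero_less_one)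

text \<open>V decreases and tends to 0 at the north pole; here the regularity of the field on the
  positive axis enters.\<close>

lemma V_nonneg: assumes "x \<in> {-1<..<1}" shows "0 \<le> V x"
proof (rule tendsto_upperbound[OF V_lim])
  show "eventually (\<lambda>y. V y \<le> V x) (at_left 1)"
  proof (rule eventually_mono)
    show "eventually (\<lambda>y. y \<in> {x<..<1}) (at_left 1)"
      using eventually_at_left_real[of x 1] assms by auto
    fix y assume "y \<in> {x<..<1}"
    then show "V y \<le> V x"
      using assms by (intro nonincreasing_of_deriv[OF dV]) (auto intro!: less_imp_le V1_neg)
  qed
qed simp

lemma H3_nonneg: "x \<in> {-1<..<1} \<Longrightarrow> 0 \<le> - 2 * V x * V1 x / (1 - x\<^sup>2)"
  using V_nonneg[of x] V1_neg[of x] one_minus_square_pos[of x]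
  by (intro divide_nonneg_pos) (auto simp: mult_nonneg_nonpos)

text \<open>\<open>H2\<close> is nondecreasing, so H2 \<le> H2 0 on (-1, 0], and H1 x falls below H1
  0 by at most |H2 0| |x| \<le> |H2 0|.\<close>

definition M where "M = \<bar>H1 0\<bar> + \<bar>H2 0\<bar>"

lemma H1_lower: assumes "x \<in> {-1<..0}" shows "- M \<le> H1 x"
proof -
  have *: "H2 z \<le> H2 0" if "z \<in> {-1<..0}" for z
    using that H3_nonneg by (intro nondecreasing_of_deriv[OF dH2]) auto
  have "H1 0 - \<bar>H2 0\<bar> * 0 \<le> H1 x - \<bar>H2 0\<bar> * x"
  proof (rule nonincreasing_of_deriv[where f = "\<lambda>x. H1 x - \<bar>H2 0\<bar> * x"])
    fix z assume z: "z \<in> {x..0}"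
    then show "((\<lambda>x. H1 x - \<bar>H2 0\<bar> * x) has_field_derivative H2 z - \<bar>H2 0\<bar>) (at z)"
      using assms by (auto intro!: derivative_eq_intros dH1)
    show "H2 z - \<bar>H2 0\<bar> \<le> 0" using *[of z] z assms by auto
  qed (use assms in auto)
  moreover have "\<bar>H2 0\<bar> * - x \<le> \<bar>H2 0\<bar> * 1" using assms by (intro mult_left_mono) auto
  ultimately show ?thesis unfolding M_def by linarith
qed

lemma H_mono: assumes "-1 < x" "x \<le> y" "y \<le> 0" shows "H x + M * x \<le> H y + M * y"
proof (rule nondecreasing_of_deriv[where f = "\<lambda>x. H x + M * x"])
  fix z assume z: "z \<in> {x..y}"
  then show "((\<lambda>x. H x + M * x) has_field_derivative H1 z + M) (at z)"
    using assms by (auto intro!: derivative_eq_intros dH')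
  show "0 \<le> H1 z + M" using H1_lower[of z] z assms by auto
qed (use assms in auto)

text \<open>\<tau>^2 / 2 - 2 \<tau> is the limit of 2 x U + U^2 / 2, the part of H without
  derivative. If H stayed below it by \<eta>, then U1 \<le> - (\<eta> / 4) / (1 + x) near -1, and U
  would grow at least like - (\<eta> / 4) ln (1 + x) instead of converging. Monotonicity of H + M x
  carries a deficit at \<open>x0\<close> to all smaller x.\<close>

lemma H_lower: assumes x0: "x0 \<in> {-1<..0}" shows "\<tau>\<^sup>2 / 2 - 2 * \<tau> - M * (1 + x0) \<le> H x0"
proof (rule ccontr)
  define \<eta> where "\<eta> = \<tau>\<^sup>2 / 2 - 2 * \<tau> - M * (1 + x0) - H x0"
  assume "\<not> ?thesis"
  then have \<eta>: "\<eta> > 0" by (simp add: \<eta>_def)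
  have M0: "M \<ge> 0" by (simp add: M_def)
  have Hx: "H x \<le> \<tau>\<^sup>2 / 2 - 2 * \<tau> - \<eta>" if "-1 < x" "x \<le> x0" for x
  proof -
    have "M * (1 + x) \<ge> 0" using M0 that by simp
    then show ?thesis using H_mono[of x x0] that x0 by (simp add: \<eta>_def algebra_simps)
  qed
  have "((\<lambda>x. 2 * x * U x + (U x)\<^sup>2 / 2) \<longlongrightarrow> 2 * (-1) * \<tau> + \<tau>\<^sup>2 / 2) (at_right (-1))"
    by (intro tendsto_intros U_lim) simp
  then have "eventually (\<lambda>x. 2 * x * U x + (U x)\<^sup>2 / 2 > \<tau>\<^sup>2 / 2 - 2 * \<tau> - \<eta> / 2) (at_right (-1))"
    by (rule order_tendstoD) (use \<eta> in simp)
  then obtain b where b: "b > -1" "\<And>x. x > -1 \<Longrightarrow> x < b \<Longrightarrow> 2 * x * U x + (U x)\<^sup>2 / 2 > \<tau>\<^sup>2 / 2 - 2 * \<tau> - \<eta> / 2"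
    unfolding eventually_at_right_field by auto
  define x1 where "x1 = (min b x0 + -1) / 2"
  have x1: "-1 < x1" "x1 < b" "x1 < x0" "x1 \<le> 0" using b x0 by (auto simp: x1_def min_def)
  have U1: "U1 x \<le> - (\<eta> / 4) / (1 + x)" if x: "x \<in> {-1<..x1}" for x
  proof -
    have "(1 - x\<^sup>2) * U1 x \<le> - (\<eta> / 2)"
      using Hx[of x] b(2)[of x] x x1 unfolding H_def by simp
    moreover have "(1 - x\<^sup>2) = (1 + x) * (1 - x)" by (simp add: algebra_simps power2_eq_square)
    ultimately have "U1 x * (1 + x) * (1 - x) \<le> - (\<eta> / 2)" by (simp add: mult_ac)
    then have "U1 x * (1 + x) \<le> - (\<eta> / 2) / (1 - x)"
      by (subst pos_le_divide_eq) (use x x1 in auto)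
    also have "\<dots> \<le> - (\<eta> / 4)"
      using x x1 \<eta> divide_left_mono[of "1 - x" 2 "\<eta> / 2"] by simp
    finally show ?thesis by (subst pos_le_divide_eq) (use x in auto)
  qed
  have up: "U x1 + \<eta> / 4 * (ln (1 + x1) - ln (1 + x)) \<le> U x" if x: "x \<in> {-1<..x1}" for x
  proof -
    have "U x1 + \<eta> / 4 * ln (1 + x1) \<le> U x + \<eta> / 4 * ln (1 + x)"
    proof (rule nonincreasing_of_deriv[where f = "\<lambda>x. U x + \<eta> / 4 * ln (1 + x)"])
      fix z assume z: "z \<in> {x..x1}"
      then show "((\<lambda>x. U x + \<eta> / 4 * ln (1 + x)) has_field_derivative U1 z + \<eta> / 4 * (1 / (1 + z))) (at z)"
        using x x1 by (intro DERIV_add DERIV_cmult dU DERIV_ln_one_plus) auto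
      have "U1 z \<le> - (\<eta> / 4) / (1 + z)" using U1[of z] z x by simp
      also have "\<dots> = - (\<eta> / 4 * (1 / (1 + z)))" by simp
      finally show "U1 z + \<eta> / 4 * (1 / (1 + z)) \<le> 0" by simp
    qed (use x in auto)
    then show ?thesis by (simp add: algebra_simps)
  qed
  have "filterlim (\<lambda>x::real. 1 + x) (at_right 0) (at_right (-1))"
    by (auto simp: filterlim_at eventually_at_right_field intro!: tendsto_eq_intros exI[of _ 0])
  from filterlim_compose[OF ln_at_0 this]
  have "filterlim (\<lambda>x. ln (1 + x :: real)) at_bot (at_right (-1))" .
  then have "eventually (\<lambda>x. ln (1 + x :: real) < ln (1 + x1) - (\<tau> + 1 - U x1) / (\<eta> / 4)) (at_right (-1))"
    by (simp add: filterlim_at_bot_dense)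
  moreover have "eventually (\<lambda>x. x \<in> {-1<..<x1}) (at_right (-1))"
    using eventually_at_right_real x1 by blast
  moreover have "eventually (\<lambda>x. U x < \<tau> + 1) (at_right (-1))"
    by (rule order_tendstoD[OF U_lim]) simp
  ultimately have "eventually (\<lambda>x. False) (at_right (-1 :: real))"
  proof eventually_elim
    case (elim x)
    from elim(1) \<eta> have "(\<tau> + 1 - U x1) < \<eta> / 4 * (ln (1 + x1) - ln (1 + x))" by (simp add: field_simps)
    with up[of x] elim show False by auto
  qed
  then show False by simp
qed

text \<open>M accounts for the loss in \<open>H_lower\<close>; 6 bounds 2 U for U \<le> 3, as 2 x U
  = - 2 U + 2 (1 + x) U.\<close>

definition C where "C = M + 6"

text \<open>A linear rate is enough to control the exponent in \<open>V1\<close>, because C (1 + x)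
  divided by 1 + x is integrable. It comes from a barrier: W = U + C (1 + x) tends to \<tau> \<ge> 3
  at -1, and W' \<ge> 0 near -1 wherever W < 3.\<close>

lemma U_lower:
  obtains x1 where "-1 < x1" "x1 \<le> 0" "\<And>x. x \<in> {-1<..x1} \<Longrightarrow> 3 - C * (1 + x) \<le> U x"
proof -
  have "eventually (\<lambda>x. U x > 2) (at_right (-1))"
    by (rule order_tendstoD[OF U_lim]) (use \<tau> in simp)
  then obtain b where b: "b > -1" "\<And>x. x > -1 \<Longrightarrow> x < b \<Longrightarrow> U x > 2"
    unfolding eventually_at_right_field by auto
  define x1 where "x1 = (min b 0 + -1) / 2"
  have x1: "-1 < x1" "x1 < b" "x1 \<le> 0" using b by (auto simp: x1_def min_def)
  have C0: "C \<ge> 0" by (simp add: C_def M_def)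
  define W where "W x = U x + C * (1 + x)" for x
  have dW: "(W has_field_derivative U1 x + C) (at x)" if "x \<in> {-1<..<1}" for x
    unfolding W_def[abs_def] using that by (auto intro!: derivative_eq_intros dU)
  have W1: "0 \<le> U1 x + C" if x: "x \<in> {-1<..x1}" and W: "W x < 3" for x
  proof -
    have "C * (1 + x) \<ge> 0" using C0 x by simp
    then have U: "2 < U x" "U x < 3" using b(2)[of x] x x1 W by (auto simp: W_def)
    \<comment> \<open>u^2 / 2 - 2 u takes the value -3/2 at u = 1 and at u = 3, lies below it in
      between and above it beyond 3; so U and \<tau> are on different sides of this value.\<close>
    have "0 \<le> (U x - 1) * (3 - U x)" using U by simp
    then have "- (3/2) \<le> (U x)\<^sup>2 / (-2) + 2 * U x - 3" by (simp add: field_simps power2_eq_square)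
    moreover have "0 \<le> (\<tau> - 1) * (\<tau> - 3)" using \<tau> by simp
    then have "- (3/2) \<le> \<tau>\<^sup>2 / 2 - 2 * \<tau>" by (simp add: field_simps power2_eq_square)
    ultimately have "- (M * (1 + x)) - 2 * (1 + x) * U x \<le> (1 - x\<^sup>2) * U1 x"
      using H_lower[of x] x x1 unfolding H_def by (simp add: algebra_simps)
    moreover have "(1 + x) * U x \<le> (1 + x) * 3" using U x by (intro mult_left_mono) auto
    ultimately have "- C * (1 + x) \<le> (1 - x\<^sup>2) * U1 x" by (simp add: C_def algebra_simps)
    also have "(1 - x\<^sup>2) * U1 x = ((1 - x) * U1 x) * (1 + x)" by (simp add: algebra_simps power2_eq_square)
    finally have "- C * (1 + x) \<le> ((1 - x) * U1 x) * (1 + x)" .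
    then have "- C \<le> (1 - x) * U1 x" by (rule mult_right_le_imp_le) (use x in simp)
    then have "- C / (1 - x) \<le> U1 x"
      by (subst pos_divide_le_eq) (use x x1 in \<open>auto simp: mult.commute\<close>)
    moreover have "- C \<le> - C / (1 - x)" using x x1 C0 divide_left_mono[of 1 "1 - x" C] by simp
    ultimately show ?thesis by linarith
  qed
  have "3 \<le> W x" if x: "x \<in> {-1<..x1}" for x
  proof (rule ccontr)
    assume "\<not> 3 \<le> W x"
    \<comment> \<open>w lies strictly between W x and 3. After the last point s of [z, x] with W s
      \<ge> w the barrier makes W nondecreasing, whence w \<le> W s \<le> W x < w.\<close>
    define w where "w = (3 + W x) / 2"
    have w: "W x < w" "w < 3" using \<open>\<not> 3 \<le> W x\<close> by (auto simp: w_def)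
    have "(W \<longlongrightarrow> \<tau> + C * (1 + -1)) (at_right (-1))"
      unfolding W_def[abs_def] by (intro tendsto_intros U_lim)
    then have "eventually (\<lambda>z. W z > w) (at_right (-1))"
      by (rule order_tendstoD) (use w \<tau> in simp)
    moreover have "eventually (\<lambda>z. z \<in> {-1<..<x}) (at_right (-1))"
      using eventually_at_right_real x by auto
    ultimately have "\<exists>z. W z > w \<and> z \<in> {-1<..<x}"
      by (intro eventually_happens'[OF trivial_limit_at_right_real]) (rule eventually_conj)
    then obtain z where z: "W z > w" "z \<in> {-1<..<x}" by blast
    have cW: "continuous_on {z..x} W"
      using z x x1 by (auto intro!: continuous_at_imp_continuous_on intro: DERIV_isCont[OF dW])
    have "compact {t \<in> {z..x}. w \<le> W t}"
      unfolding compact_eq_bounded_closed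
    proof
      show "bounded {t \<in> {z..x}. w \<le> W t}"
        by (rule bounded_subset[OF bounded_closed_interval[of z x]]) auto
      show "closed {t \<in> {z..x}. w \<le> W t}"
        by (rule continuous_on_closed_Collect_le[OF continuous_on_const cW]) simp
    qed
    moreover have "z \<in> {t \<in> {z..x}. w \<le> W t}" using z by auto
    ultimately obtain s where s: "s \<in> {z..x}" "w \<le> W s" "\<And>t. t \<in> {z..x} \<Longrightarrow> w \<le> W t \<Longrightarrow> t \<le> s"
      using compact_attains_sup[of "{t \<in> {z..x}. w \<le> W t}"] by blast
    have "W s \<le> W x"
    proof (rule DERIV_nonneg_imp_increasing_open[of s x W])
      fix t assume "s < t" "t < x"
      then have "W t < 3" using s(3)[of t] s(1) w by (cases "w \<le> W t") auto
      then show "\<exists>y. (W has_field_derivative y) (at t) \<and> 0 \<le> y"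
        using dW[of t] W1[of t] \<open>s < t\<close> \<open>t < x\<close> s(1) z x x1 by (intro exI conjI) auto
    next
      show "continuous_on {s..x} W" by (rule continuous_on_subset[OF cW]) (use s(1) in auto)
    qed (use s(1) in auto)
    with s w show False by simp
  qed
  then have "3 - C * (1 + x) \<le> U x" if "x \<in> {-1<..x1}" for x
    using that unfolding W_def by force
  then show ?thesis using that[OF x1(1,3)] by blast
qed

text \<open>Three integrations turn H''' \<ge> d / (1 + x)^3 into H'' \<le> - d / (2 (1 + x)^2), H'
  \<ge> d / (2 (1 + x)) and H \<le> (d / 2) ln (1 + x), up to constants. The logarithm contradicts
  \<open>H_lower\<close>; 3 is the smallest exponent for which this happens.\<close>

lemma V1_neg_impossible: False
proof -
  obtain x1 where x1: "-1 < x1" "x1 \<le> 0" "\<And>x. x \<in> {-1<..x1} \<Longrightarrow> 3 - C * (1 + x) \<le> U x"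
    using U_lower by blast
  have C0: "C \<ge> 0" by (simp add: C_def M_def)
  \<comment> \<open>Squaring removes the sign of \<open>V1\<close>. The exponent 3 is twice the 3/2
    that corresponds to U = 3, since 1 - x^2 ~ 2 (1 + x); the exponential absorbs the error C (1 +
    x) of \<open>U_lower\<close>.\<close>
  define R where "R x = (V1 x)\<^sup>2 * (1 + x) ^ 3 * exp (- 2 * C * (1 + x))" for x
  have R_mono: "R x1 \<le> R x" if x: "x \<in> {-1<..x1}" for x
  proof (rule nonincreasing_of_deriv[where f = "R"])
    fix z assume "z \<in> {x..x1}"
    then have z: "z \<in> {-1<..<1}" "z \<in> {-1<..x1}" using x x1 by auto
    define e where "e = (V1 z)\<^sup>2 * (1 + z)\<^sup>2 * exp (- 2 * C * (1 + z))"
    have "e \<ge> 0" by (simp add: e_def)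
    have 1: "(1 + z) * (U z / (1 - z\<^sup>2)) = U z / (1 - z)"
    proof -
      have "1 - z\<^sup>2 = (1 + z) * (1 - z)" by (simp add: algebra_simps power2_eq_square)
      then show ?thesis using z by simp
    qed
    have "(R has_field_derivative e * (3 - 2 * ((1 + z) * (U z / (1 - z\<^sup>2))) - 2 * C * (1 + z))) (at z)"
      unfolding R_def[abs_def]
      by (auto intro!: derivative_eq_intros dV1 z simp: e_def power2_eq_square power3_eq_cube algebra_simps
        simp del: times_divide_eq_right times_divide_eq_left)
    then show "(R has_field_derivative e * (3 - 2 * (U z / (1 - z)) - 2 * C * (1 + z))) (at z)"
      unfolding 1 .
    have "3 * (1 - z) - 2 * C * (1 + z) * (1 - z) \<le> 2 * (3 - C * (1 + z))"
    proof -
      have "0 \<le> (2 * C * (1 + z)) * (- z)"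
        by (rule mult_nonneg_nonneg) (use z x1 C0 in auto)
      then have "0 \<le> 3 * (1 + z) + 2 * C * (1 + z) * (- z)" using z by (intro add_nonneg_nonneg) auto
      then show ?thesis by (simp add: algebra_simps)
    qed
    also have "\<dots> \<le> 2 * U z" using x1(3)[OF z(2)] by simp
    finally have "(3 - 2 * C * (1 + z)) * (1 - z) \<le> 2 * U z" by (simp add: algebra_simps)
    then have "3 - 2 * C * (1 + z) \<le> 2 * U z / (1 - z)"
      by (subst pos_le_divide_eq) (use z in auto)
    then show "e * (3 - 2 * (U z / (1 - z)) - 2 * C * (1 + z)) \<le> 0"
      using \<open>e \<ge> 0\<close> by (intro mult_nonneg_nonpos) auto
  qed (use x in auto)
  define c where "c = sqrt (R x1)"
  have "R x1 > 0" using V1_neg[of x1] x1 by (auto simp: R_def intro!: mult_pos_pos)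
  then have c: "c > 0" "c * c = R x1" by (auto simp: c_def)
  have V1_up: "c * (1 + x) powr (-3/2) \<le> - V1 x" if x: "x \<in> {-1<..x1}" for x
  proof -
    have y: "1 + x > 0" using x by simp
    have "R x \<le> (V1 x)\<^sup>2 * (1 + x) ^ 3 * 1" unfolding R_def using C0 y by (intro mult_left_mono) auto
    with R_mono[OF x] have "c * c \<le> (V1 x)\<^sup>2 * (1 + x) ^ 3" by (simp add: c)
    then have "sqrt (c * c) \<le> sqrt ((V1 x)\<^sup>2 * (1 + x) ^ 3)" by (rule real_sqrt_le_mono)
    also have "\<dots> = - V1 x * (1 + x) powr (3/2)"
    proof -
      have "V1 x < 0" using V1_neg[of x] x x1 by auto
      moreover have "sqrt ((1 + x) ^ 3) = (1 + x) powr (3/2)"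
        using y by (simp add: powr_half_sqrt[symmetric] powr_powr flip: powr_numeral)
      ultimately show ?thesis by (simp add: real_sqrt_mult)
    qed
    finally have "c \<le> - V1 x * (1 + x) powr (3/2)" using c(1) by simp
    then have "c / (1 + x) powr (3/2) \<le> - V1 x" using y by (simp add: pos_divide_le_eq)
    then show ?thesis by (simp add: powr_minus_divide[of "1 + x" "3/2"])
  qed
  have V_up: "2 * c * ((1 + x) powr (-1/2) - (1 + x1) powr (-1/2)) \<le> V x" if x: "x \<in> {-1<..x1}" for x
  proof -
    have "V x1 - 2 * c * (1 + x1) powr (-1/2) \<le> V x - 2 * c * (1 + x) powr (-1/2)"
    proof (rule nonincreasing_of_deriv[where f = "\<lambda>x. V x - 2 * c * (1 + x) powr (-1/2)"])
      fix z assume "z \<in> {x..x1}"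
      then have z: "z \<in> {-1<..<1}" "z \<in> {-1<..x1}" using x x1 by auto
      show "((\<lambda>x. V x - 2 * c * (1 + x) powr (-1/2)) has_field_derivative
          V1 z + c * (1 + z) powr (-3/2)) (at z)"
        using z by (auto intro!: derivative_eq_intros dV simp: powr_diff field_simps)
      show "V1 z + c * (1 + z) powr (-3/2) \<le> 0" using V1_up[OF z(2)] by simp
    qed (use x in auto)
    then show ?thesis using V_nonneg[of x1] x1 by (simp add: algebra_simps)
  qed
  \<comment> \<open>Passing from y1 to a quarter of it doubles the power -1/2, so the term
    subtracted in \<open>V_up\<close> costs at most half of the main one.\<close>
  define y1 y2 x2 where "y1 = 1 + x1" and "y2 = y1 / 4" and "x2 = y2 - 1"
  have y: "0 < y1" "0 < y2" "x2 < x1" "-1 < x2" using x1(1,2) by (simp_all add: y1_def y2_def x2_def field_simps)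
  define d where "d = c * c"
  have d: "d > 0" using c(1) by (simp add: d_def)
  have H3: "d / (1 + x) ^ 3 \<le> - 2 * V x * V1 x / (1 - x\<^sup>2)" if x: "x \<in> {-1<..x2}" for x
  proof -
    have y0: "1 + x > 0" "1 + x \<le> y1 / 4" and x': "x \<in> {-1<..x1}" using x y by (auto simp: x2_def y2_def)
    have "(y1 / 4) powr (-1/2) \<le> (1 + x) powr (-1/2)"
      using y0 by (intro powr_mono2') auto
    moreover have "(y1 / 4) powr (-1/2) = 2 * y1 powr (-1/2)"
      using y(1) unfolding powr_minus_half[OF y(1)] by (subst powr_minus_half) (simp_all add: real_sqrt_divide)
    ultimately have "c * (1 + x) powr (-1/2) \<le> V x"
    proof -
      assume "(y1 / 4) powr (-1/2) \<le> (1 + x) powr (-1/2)" "(y1 / 4) powr (-1/2) = 2 * y1 powr (-1/2)"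
      then have "c * (2 * y1 powr (-1/2)) \<le> c * (1 + x) powr (-1/2)" using c by (intro mult_left_mono) auto
      then show ?thesis using V_up[OF x'] by (simp add: y1_def algebra_simps)
    qed
    then have "(c * (1 + x) powr (-1/2)) * (c * (1 + x) powr (-3/2)) \<le> V x * - V1 x"
    proof (rule mult_mono[OF _ V1_up[OF x']])
      show "0 \<le> V x" using V_nonneg[of x] x' x1(2) by simp
      show "0 \<le> c * (1 + x) powr (-3/2)" using c(1) by simp
    qed
    moreover have "(1 + x) powr (-1/2) * (1 + x) powr (-3/2) = (1 + x) powr (-2)"
      unfolding powr_add[symmetric] by simp
    moreover have "(1 + x) powr (-2) = 1 / (1 + x)\<^sup>2"
      using y0 by (simp add: powr_minus_divide)
    ultimately have *: "d / (1 + x)\<^sup>2 \<le> V x * - V1 x" by (simp add: d_def mult_ac)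
    have "d / a ^ 3 = 2 * (d / a\<^sup>2) / (2 * a)" for a :: real
      by (simp add: power2_eq_square power3_eq_cube mult.assoc)
    then have "d / (1 + x) ^ 3 = 2 * (d / (1 + x)\<^sup>2) / (2 * (1 + x))" .
    also have "\<dots> \<le> 2 * (V x * - V1 x) / (2 * (1 + x))"
      using * y0 by (intro divide_right_mono mult_left_mono) auto
    also have "\<dots> \<le> 2 * (V x * - V1 x) / (1 - x\<^sup>2)"
    proof (rule divide_left_mono)
      show "1 - x\<^sup>2 \<le> 2 * (1 + x)" using zero_le_power2[of "x + 1"] by (simp add: power2_eq_square algebra_simps)
      have "0 \<le> d / (1 + x)\<^sup>2" using d by simp
      with * show "0 \<le> 2 * (V x * - V1 x)" by linarith
      show "0 < 2 * (1 + x) * (1 - x\<^sup>2)" using y0 one_minus_square_pos[of x] x y x1 by (intro mult_pos_pos) auto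
    qed
    finally show ?thesis by simp
  qed
  define B where "B = H2 x2 + d / 2 / (1 + x2)\<^sup>2"
  have H2_up: "H2 x + d / 2 / (1 + x)\<^sup>2 \<le> B" if x: "x \<in> {-1<..x2}" for x
    unfolding B_def
  proof (rule nondecreasing_of_deriv[where f = "\<lambda>x. H2 x + d / 2 / (1 + x)\<^sup>2"])
    fix z assume "z \<in> {x..x2}"
    then have z: "z \<in> {-1<..x2}" "z \<in> {-1<..<1}" using x y x1(2) by auto
    then show "((\<lambda>x. H2 x + d / 2 / (1 + x)\<^sup>2) has_field_derivative
        - 2 * V z * V1 z / (1 - z\<^sup>2) + - (2 * (d / 2) / (1 + z) ^ 3)) (at z)"
      by (intro DERIV_add dH2 DERIV_divide_one_plus) auto
    show "0 \<le> - 2 * V z * V1 z / (1 - z\<^sup>2) + - (2 * (d / 2) / (1 + z) ^ 3)" using H3[OF z(1)] by simp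
  qed (use x in auto)
  define B1 where "B1 = H1 x2 - B * x2 - d / 2 / (1 + x2)"
  have H1_up: "d / 2 / (1 + x) - (\<bar>B\<bar> + \<bar>B1\<bar>) \<le> H1 x" if x: "x \<in> {-1<..x2}" for x
  proof -
    have "B1 \<le> H1 x - B * x - d / 2 / (1 + x)"
      unfolding B1_def
    proof (rule nonincreasing_of_deriv[where f = "\<lambda>x. H1 x - B * x - d / 2 / (1 + x)"])
      fix z assume "z \<in> {x..x2}"
      then have z: "z \<in> {-1<..x2}" "z \<in> {-1<..<1}" using x y x1(2) by auto
      then show "((\<lambda>x. H1 x - B * x - d / 2 / (1 + x)) has_field_derivative
          H2 z - B * 1 - - (d / 2 / (1 + z)\<^sup>2)) (at z)"
        by (intro DERIV_diff dH1 DERIV_divide_one_plus DERIV_cmult DERIV_ident) auto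
      show "H2 z - B * 1 - - (d / 2 / (1 + z)\<^sup>2) \<le> 0" using H2_up[OF z(1)] by simp
    qed (use x in auto)
    moreover have "\<bar>B * x\<bar> \<le> \<bar>B\<bar> * 1" unfolding abs_mult using x y x1(2) by (intro mult_left_mono) auto
    ultimately show ?thesis by linarith
  qed
  define B2 where "B2 = \<bar>B\<bar> + \<bar>B1\<bar>"
  define B3 where "B3 = H x2 - d / 2 * ln (1 + x2) + B2 * x2"
  have H_up: "H x \<le> d / 2 * ln (1 + x) + B2 + B3" if x: "x \<in> {-1<..x2}" for x
  proof -
    have "H x - d / 2 * ln (1 + x) + B2 * x \<le> B3"
      unfolding B3_def
    proof (rule nondecreasing_of_deriv[where f = "\<lambda>x. H x - d / 2 * ln (1 + x) + B2 * x"])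
      fix z assume "z \<in> {x..x2}"
      then have z: "z \<in> {-1<..x2}" "z \<in> {-1<..<1}" using x y x1(2) by auto
      then show "((\<lambda>x. H x - d / 2 * ln (1 + x) + B2 * x) has_field_derivative
          H1 z - d / 2 * (1 / (1 + z)) + B2 * 1) (at z)"
        by (intro DERIV_add DERIV_diff dH' DERIV_ln_one_plus DERIV_cmult DERIV_ident) auto
      show "0 \<le> H1 z - d / 2 * (1 / (1 + z)) + B2 * 1" using H1_up[OF z(1)] by (simp add: B2_def)
    qed (use x in auto)
    moreover have "B2 * - x \<le> B2 * 1" using x by (intro mult_left_mono) (auto simp: B2_def)
    ultimately show ?thesis by linarith
  qed
  \<comment> \<open>L is the lower bound that \<open>H_lower\<close> and \<open>H_up\<close> force
    on ln (1 + x); the point x is then taken so close to -1 that ln (1 + x) \<le> L - 1.\<close>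
  define L where "L = (\<tau>\<^sup>2 / 2 - 2 * \<tau> - M - B2 - B3) / (d / 2)"
  define x where "x = min y2 (exp (L - 1)) - 1"
  have x: "x \<in> {-1<..x2}" "x \<in> {-1<..0}" using y x1(2) by (auto simp: x_def x2_def)
  have "M * (1 + x) \<le> M * 1" using x by (intro mult_left_mono) (auto simp: M_def)
  then have "\<tau>\<^sup>2 / 2 - 2 * \<tau> - M - B2 - B3 \<le> d / 2 * ln (1 + x)"
    using H_lower[OF x(2)] H_up[OF x(1)] by simp
  then have "L \<le> ln (1 + x)" using d by (simp add: L_def field_simps)
  also have "\<dots> \<le> ln (exp (L - 1))" using x by (intro ln_mono) (auto simp: x_def)
  finally show False by simp
qed

end

lemma V_eq_0:
  assumes V1_0: "\<not> 0 < V1 0" and x: "x \<in> {-1<..<1}"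
  shows "V x = 0"
proof -
  have "V1 0 = 0" using V1_neg_impossible V1_0 by (meson linorder_neqE_linordered_idom)
  then have 0: "V1 y = 0" if "y \<in> {-1<..<1}" for y using V1_ratio[of 0 y] that by auto
  have "V y = V x" if "y \<in> {x<..<1}" for y
    using that x by (intro antisym nondecreasing_of_deriv[OF dV] nonincreasing_of_deriv[OF dV]) (auto simp: 0)
  then have "eventually (\<lambda>y. V y = V x) (at_left 1)"
    using eventually_at_left_real[of x 1] x by (auto elim: eventually_mono)
  then have "((\<lambda>y. V x) \<longlongrightarrow> 0) (at_left (1 :: real))" using V_lim by (simp cong: tendsto_cong)
  then show ?thesis by (simp add: tendsto_const_iff)
qed

end

text \<open>The equations are invariant under a change of sign of V, which reduces the case V1 0 > 0
  to the excluded one.\<close>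

lemma (in swirl_ode) swirl_zero: 
  assumes x: "x \<in> {-1<..<1}"
  shows "V x = 0"
proof (cases "V1 0 > 0")
  case True
  interpret neg: swirl_ode U "\<lambda>x. - V x" U1 "\<lambda>x. - V1 x" H1 H2 \<tau>
    by unfold_locales
      (use dU dV dV1 dH dH1 dH2 V_lim U_lim \<tau> in \<open>auto intro!: derivative_eq_intros tendsto_eq_intros\<close>)
  show ?thesis using neg.V_eq_0[OF _ x] True by simp
qed (rule V_eq_0[OF _ x])

section \<open>Integral operators with power weights\<close>

text \<open>\<open>(y - 2) ^ Suc n * avg n h y\<close> is the antiderivative of \<open>(y - 2) ^ n * h y\<close> that vanishes at the
  north pole \<open>y = 2\<close>. With averages in place of antiderivatives no division by \<open>1 - x = 2 - y\<close>
  is needed.\<close>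

definition avg :: "nat \<Rightarrow> (real \<Rightarrow> real) \<Rightarrow> real \<Rightarrow> real" where
  "avg n h y = integral {0..1} (\<lambda>t. t ^ n * h (2 + t * (y - 2)))"

lemma avg_arg_bounds:
  fixes y t :: real
  assumes "0 < y" "0 \<le> t" "t \<le> 1"
  shows "min y 2 \<le> 2 + t * (y - 2)" "2 + t * (y - 2) \<le> max y 2" "0 < 2 + t * (y - 2)"
proof -
  have *: "min y 2 \<le> 2 + t * (y - 2) \<and> 2 + t * (y - 2) \<le> max y 2"
  proof (cases "2 \<le> y")
    case True
    have "t * (y - 2) \<le> 1 * (y - 2)" by (rule mult_right_mono) (use assms True in auto)
    moreover have "0 \<le> t * (y - 2)" by (rule mult_nonneg_nonneg) (use assms True in auto)
    ultimately show ?thesis using True by auto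
  next
    case False
    have "t * (2 - y) \<le> 1 * (2 - y)" by (rule mult_right_mono) (use assms False in auto)
    moreover have "0 \<le> t * (2 - y)" by (rule mult_nonneg_nonneg) (use assms False in auto)
    ultimately show ?thesis using False by (auto simp: algebra_simps)
  qed
  then show "min y 2 \<le> 2 + t * (y - 2)" "2 + t * (y - 2) \<le> max y 2" by auto
  with assms(1) show "0 < 2 + t * (y - 2)" by linarith
qed

lemma avg_arg:
  "y \<in> {0<..3} \<Longrightarrow> t \<in> {0..1} \<Longrightarrow> 2 + t * (y - 2) \<in> {0<..3}" for y t :: real
  using avg_arg_bounds[of y t] by (auto simp: max_def split: if_splits)

lemma avg_arg_open:
  "y \<in> {0<..<3} \<Longrightarrow> t \<in> {0..1} \<Longrightarrow> 2 + t * (y - 2) \<in> {0<..<3}" for y t :: real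
  using avg_arg_bounds[of y t] by (auto simp: max_def split: if_splits)

lemma continuous_on_avg_integrand:
  fixes h :: "real \<Rightarrow> real"
  assumes "continuous_on S h" "\<And>y t. y \<in> S \<Longrightarrow> t \<in> {0..1} \<Longrightarrow> 2 + t * (y - 2) \<in> S"
  shows "continuous_on (S \<times> {0..1}) (\<lambda>(y, t). t ^ n * h (2 + t * (y - 2)))"
  unfolding split_def
  by (intro continuous_intros continuous_on_compose2[OF assms(1)]) (use assms(2) in auto)

lemma continuous_on_avg:
  fixes h :: "real \<Rightarrow> real"
  assumes "continuous_on S h" "\<And>y t. y \<in> S \<Longrightarrow> t \<in> {0..1} \<Longrightarrow> 2 + t * (y - 2) \<in> S"
  shows "continuous_on S (avg n h)"
  using integral_continuous_on_param[of S 0 1 "\<lambda>y t. t ^ n * h (2 + t * (y - 2))"]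
    continuous_on_avg_integrand[OF assms] by (simp add: avg_def[abs_def])

lemma avg_integrable:
  fixes h :: "real \<Rightarrow> real"
  assumes "continuous_on {0<..3} h" "y \<in> {0<..3}"
  shows "(\<lambda>t. t ^ n * h (2 + t * (y - 2))) integrable_on {0..1}"
  by (intro integrable_continuous_interval continuous_intros continuous_on_compose2[OF assms(1)])
     (use avg_arg[OF assms(2)] in auto)

text \<open>Substitute s = 2 + t (y - 2) in an antiderivative on [a, 3]; a is positive because
  \<open>h\<close> may be singular at 0.\<close>

lemma DERIV_avg:
  assumes h: "continuous_on {0<..3} h" and y0: "y0 \<in> {0<..<3}"
  shows "((\<lambda>y. (y - 2) ^ Suc n * avg n h y) has_field_derivative (y0 - 2) ^ n * h y0) (at y0)"
proof -
  define a where "a = min (y0 / 2) 1"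
  have a: "0 < a" "a < y0" "a < 2" using y0 by (auto simp: a_def)
  have "continuous_on {a..3} (\<lambda>s. (s - 2) ^ n * h s)"
    by (intro continuous_intros continuous_on_subset[OF h]) (use a in auto)
  from antiderivative_continuous[OF this] obtain \<Phi> where
    \<Phi>: "\<And>s. s \<in> {a..3} \<Longrightarrow> (\<Phi> has_vector_derivative (s - 2) ^ n * h s) (at s within {a..3})" by blast
  have eq: "\<Phi> y - \<Phi> 2 = (y - 2) ^ Suc n * avg n h y" if y: "y \<in> {a<..<3}" for y
  proof -
    have arg: "2 + t * (y - 2) \<in> {a..3}" if "t \<in> {0..1}" for t
    proof -
      have "min y 2 \<le> 2 + t * (y - 2)" "2 + t * (y - 2) \<le> max y 2"
        using avg_arg_bounds[of y t] that y a by auto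
      moreover have "a \<le> min y 2" "max y 2 \<le> 3" using y a by auto
      ultimately show ?thesis by (meson atLeastAtMost_iff order_trans)
    qed
    have "((\<lambda>t. (2 + t * (y - 2) - 2) ^ n * h (2 + t * (y - 2)) * (y - 2)) has_integral
        \<Phi> (2 + 1 * (y - 2)) - \<Phi> (2 + 0 * (y - 2))) {0..1}"
    proof (rule fundamental_theorem_of_calculus)
      fix t :: real assume t: "t \<in> {0..1}"
      have "((\<lambda>t. 2 + t * (y - 2)) has_field_derivative y - 2) (at t within {0..1})"
        by (auto intro!: derivative_eq_intros)
      moreover have "(\<Phi> has_field_derivative (2 + t * (y - 2) - 2) ^ n * h (2 + t * (y - 2)))
          (at (2 + t * (y - 2)) within (\<lambda>t. 2 + t * (y - 2)) ` {0..1})"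
        using \<Phi>[OF arg[OF t]] unfolding has_real_derivative_iff_has_vector_derivative[symmetric]
        by (rule DERIV_subset) (use arg in auto)
      ultimately have "((\<lambda>t. \<Phi> (2 + t * (y - 2))) has_field_derivative
           (2 + t * (y - 2) - 2) ^ n * h (2 + t * (y - 2)) * (y - 2)) (at t within {0..1})"
        using DERIV_image_chain[of \<Phi> _ "\<lambda>t. 2 + t * (y - 2)" t "{0..1}"] by (simp add: o_def)
      then show "((\<lambda>t. \<Phi> (2 + t * (y - 2))) has_vector_derivative
           (2 + t * (y - 2) - 2) ^ n * h (2 + t * (y - 2)) * (y - 2)) (at t within {0..1})"
        by (simp add: has_real_derivative_iff_has_vector_derivative)
    qed simp
    moreover have "(\<lambda>t. (2 + t * (y - 2) - 2) ^ n * h (2 + t * (y - 2)) * (y - 2)) =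
        (\<lambda>t. (y - 2) ^ Suc n * (t ^ n * h (2 + t * (y - 2))))"
      by (simp add: fun_eq_iff power_mult_distrib)
    ultimately have "((\<lambda>t. (y - 2) ^ Suc n * (t ^ n * h (2 + t * (y - 2)))) has_integral \<Phi> y - \<Phi> 2) {0..1}"
      by simp
    from integral_unique[OF this] show ?thesis
      unfolding avg_def by (simp only: integral_mult_right)
  qed
  have "(\<Phi> has_field_derivative (y0 - 2) ^ n * h y0) (at y0 within {a..3})"
    using \<Phi>[of y0] a y0 by (simp add: has_real_derivative_iff_has_vector_derivative)
  then have "(\<Phi> has_field_derivative (y0 - 2) ^ n * h y0) (at y0)"
    using a y0 by (simp add: at_within_Icc_at)
  then have "((\<lambda>y. \<Phi> y - \<Phi> 2) has_field_derivative (y0 - 2) ^ n * h y0) (at y0)"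
    by (auto intro!: derivative_eq_intros)
  then show ?thesis
    by (rule has_field_derivative_transform_within_open[of _ _ _ "{a<..<3}"]) (use a y0 eq in auto)
qed

text \<open>Differentiation under the integral turns \<open>avg n h\<close> into
  \<open>avg (Suc n) h'\<close>, so averaging preserves every order of smoothness across y = 2, with
  no quotient to examine.\<close>

lemma Ck_real_avg: "Ck_real k h {0<..<3} \<Longrightarrow> Ck_real k (avg n h) {0<..<3}"
proof (induction k arbitrary: h n)
  case 0
  then show ?case using continuous_on_avg[of "{0<..<3}" h n] avg_arg_open by simp
next
  case (Suc k)
  then obtain h' where h': "\<And>x. x \<in> {0<..<3} \<Longrightarrow> (h has_field_derivative h' x) (at x)"
    "Ck_real k h' {0<..<3}" unfolding Ck_real.simps by blast
  have ch: "continuous_on {0<..<3} h" by (rule Ck_real_imp_continuous_on[OF Suc.prems])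
  have ch': "continuous_on {0<..<3} h'" by (rule Ck_real_imp_continuous_on[OF h'(2)])
  have "(avg n h has_field_derivative avg (Suc n) h' y) (at y)" if y: "y \<in> {0<..<3}" for y
  proof -
    have "((\<lambda>y. integral (cbox 0 1) (\<lambda>t. t ^ n * h (2 + t * (y - 2)))) has_field_derivative
      integral (cbox 0 1) (\<lambda>t. t ^ Suc n * h' (2 + t * (y - 2)))) (at y within {0<..<3})"
    proof (rule leibniz_rule_field_derivative)
      fix x t :: real assume x: "x \<in> {0<..<3}" and t: "t \<in> cbox 0 1"
      have "(h has_field_derivative h' (2 + t * (x - 2))) (at (2 + t * (x - 2)))"
        using h'(1) avg_arg_open x t by auto
      then have "((\<lambda>x. t ^ n * h (2 + t * (x - 2))) has_field_derivative
          t ^ n * (h' (2 + t * (x - 2)) * t)) (at x)"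
        by (auto intro!: derivative_eq_intros DERIV_chain2[of h])
      moreover have "t ^ n * (h' (2 + t * (x - 2)) * t) = t ^ Suc n * h' (2 + t * (x - 2))" by simp
      ultimately have "((\<lambda>x. t ^ n * h (2 + t * (x - 2))) has_field_derivative
          t ^ Suc n * h' (2 + t * (x - 2))) (at x)" by (simp only:)
      then show "((\<lambda>x. t ^ n * h (2 + t * (x - 2))) has_field_derivative
          t ^ Suc n * h' (2 + t * (x - 2))) (at x within {0<..<3})"
        by (rule has_field_derivative_at_within)
    next
      fix x :: real assume x: "x \<in> {0<..<3}"
      show "(\<lambda>t. t ^ n * h (2 + t * (x - 2))) integrable_on cbox 0 1"
        unfolding cbox_interval
        by (intro integrable_continuous_interval continuous_intros continuous_on_compose2[OF ch])
           (use avg_arg_open[OF x] in auto)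
    next
      show "continuous_on ({0<..<3} \<times> cbox 0 1) (\<lambda>(x, t). t ^ Suc n * h' (2 + t * (x - 2)))"
        using continuous_on_avg_integrand[OF ch' avg_arg_open, of "Suc n"] by simp
    qed (use y in auto)
    then show ?thesis
      unfolding avg_def[abs_def] cbox_interval at_within_open[OF y open_greaterThanLessThan] .
  qed
  with Suc.IH[OF h'(2)] show ?case unfolding Ck_real.simps by blast
qed

definition bnd :: "real \<Rightarrow> real \<Rightarrow> (real \<Rightarrow> real) \<Rightarrow> bool" where
  "bnd r M h \<longleftrightarrow> continuous_on {0<..3} h \<and> (\<forall>y\<in>{0<..3}. \<bar>h y\<bar> \<le> M * y powr (- r))"

lemma bnd_nonneg: "bnd r M h \<Longrightarrow> 0 \<le> M"
  unfolding bnd_def by (auto dest: bspec[of _ _ 1])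

lemma bnd_cong: "(\<And>y. y \<in> {0<..3} \<Longrightarrow> f y = g y) \<Longrightarrow> bnd r M f \<longleftrightarrow> bnd r M g"
  unfolding bnd_def using continuous_on_cong[of "{0<..3}" "{0<..3}" f g] by auto

lemma bnd_mono_const: "bnd r M h \<Longrightarrow> M \<le> M' \<Longrightarrow> bnd r M' h"
  unfolding bnd_def by (fastforce intro: order_trans mult_right_mono)

lemma bnd_mono:
  assumes "bnd r M h" "r \<le> s"
  shows "bnd s (3 powr (s - r) * M) h"
  unfolding bnd_def
proof (intro conjI ballI)
  fix y :: real assume y: "y \<in> {0<..3}"
  have "y powr (- r) = y powr (s - r) * y powr (- s)" by (simp flip: powr_add)
  also have "\<dots> \<le> 3 powr (s - r) * y powr (- s)"
    using y assms(2) by (intro mult_right_mono powr_mono2) auto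
  finally have "M * y powr (- r) \<le> M * (3 powr (s - r) * y powr (- s))"
    using bnd_nonneg[OF assms(1)] by (rule mult_left_mono)
  with assms(1) y show "\<bar>h y\<bar> \<le> 3 powr (s - r) * M * y powr (- s)"
    unfolding bnd_def by (fastforce simp: mult_ac)
qed (use assms in \<open>simp add: bnd_def\<close>)

lemma bnd_mult:
  assumes "bnd r M f" "bnd s N g"
  shows "bnd (r + s) (M * N) (\<lambda>y. f y * g y)"
  unfolding bnd_def
proof (intro conjI ballI)
  fix y :: real assume y: "y \<in> {0<..3}"
  have "\<bar>f y\<bar> * \<bar>g y\<bar> \<le> (M * y powr (- r)) * (N * y powr (- s))"
    using assms y bnd_nonneg[OF assms(1)] by (intro mult_mono) (auto simp: bnd_def)
  then show "\<bar>f y * g y\<bar> \<le> M * N * y powr (- (r + s))"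
    using powr_add[of y "- r" "- s"] by (simp add: abs_mult mult_ac)
qed (use assms in \<open>auto simp: bnd_def intro!: continuous_intros\<close>)

lemma bnd_add:
  assumes "bnd r M f" "bnd r N g"
  shows "bnd r (M + N) (\<lambda>y. f y + g y)"
  using assms unfolding bnd_def
  by (auto intro!: continuous_intros simp: distrib_right intro: order_trans[OF abs_triangle_ineq add_mono])

lemma bnd_powr: "bnd (- a) 1 (\<lambda>y. y powr a)"
  unfolding bnd_def by (auto intro!: continuous_intros)

lemma bnd_const: "bnd 0 \<bar>c\<bar> (\<lambda>y. c)"
  unfolding bnd_def by auto

text \<open>Bounded linear maps from order r to order s. Linearity is stated for differences, the
  form that Lipschitz estimates use, and on \<open>{0<..3}\<close>, where \<open>bnd\<close>
  controls the values.\<close>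

definition linop :: "real \<Rightarrow> real \<Rightarrow> ((real \<Rightarrow> real) \<Rightarrow> real \<Rightarrow> real) \<Rightarrow> bool" where
  "linop r s T \<longleftrightarrow> (\<exists>c\<ge>0. \<forall>M h. bnd r M h \<longrightarrow> bnd s (c * M) (T h)) \<and>
     (\<forall>M N f g. bnd r M f \<longrightarrow> bnd r N g \<longrightarrow>
        (\<forall>y\<in>{0<..3}. T (\<lambda>y. f y - g y) y = T f y - T g y))"

lemma linop_bnd:
  assumes "linop r s T"
  obtains c where "0 \<le> c" "\<And>M h. bnd r M h \<Longrightarrow> bnd s (c * M) (T h)"
  using assms unfolding linop_def by blast

lemma linop_diff:
  "linop r s T \<Longrightarrow> bnd r M f \<Longrightarrow> bnd r N g \<Longrightarrow> y \<in> {0<..3} \<Longrightarrow>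
    T (\<lambda>y. f y - g y) y = T f y - T g y"
  unfolding linop_def by blast

lemma powr_avg_integral:
  fixes y r :: real
  assumes "0 < y" "y < 2" "r \<noteq> 1"
  shows "((\<lambda>t. (2 + t * (y - 2)) powr (- r)) has_integral
     (2 powr (1 - r) - y powr (1 - r)) / ((1 - r) * (2 - y))) {0..1}"
proof -
  define F where "F t = - ((2 + t * (y - 2)) powr (1 - r) / ((1 - r) * (2 - y)))" for t
  have "((\<lambda>t. (2 + t * (y - 2)) powr (- r)) has_integral F 1 - F 0) {0..1}"
  proof (rule fundamental_theorem_of_calculus)
    fix t :: real assume t: "t \<in> {0..1}"
    then have pos: "0 < 2 + t * (y - 2)" using avg_arg_bounds[of y t] assms by auto
    have "((\<lambda>t. (2 + t * (y - 2)) powr (1 - r)) has_field_derivative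
        (1 - r) * (2 + t * (y - 2)) powr (- r) * (y - 2)) (at t)"
      using DERIV_fun_powr[of "\<lambda>t. 2 + t * (y - 2)" "y - 2" t "1 - r"] pos
      by (auto intro!: derivative_eq_intros)
    from DERIV_cmult[OF this, of "- 1 / ((1 - r) * (2 - y))"]
    have "(F has_field_derivative - 1 / ((1 - r) * (2 - y)) *
        ((1 - r) * (2 + t * (y - 2)) powr (- r) * (y - 2))) (at t)"
      by (simp add: F_def[abs_def])
    moreover have "- 1 / ((1 - r) * (2 - y)) * ((1 - r) * (2 + t * (y - 2)) powr (- r) * (y - 2)) =
        (2 + t * (y - 2)) powr (- r)"
      using assms by (simp add: divide_simps) (simp add: algebra_simps)
    ultimately have "(F has_field_derivative (2 + t * (y - 2)) powr (- r)) (at t)" by simp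
    then show "(F has_vector_derivative (2 + t * (y - 2)) powr (- r)) (at t within {0..1})"
      unfolding has_real_derivative_iff_has_vector_derivative[symmetric]
      by (rule has_field_derivative_at_within)
  qed simp
  moreover have "F 1 - F 0 = (2 powr (1 - r) - y powr (1 - r)) / ((1 - r) * (2 - y))"
    by (simp add: F_def diff_divide_distrib)
  ultimately show ?thesis by simp
qed

lemma avg_bound_small:
  assumes h: "bnd r M h" and y: "0 < y" "y < 2" and r: "r \<noteq> 1"
  shows "\<bar>avg n h y\<bar> \<le> M * ((2 powr (1 - r) - y powr (1 - r)) / ((1 - r) * (2 - y)))"
proof -
  have i: "((\<lambda>t. M * (2 + t * (y - 2)) powr (- r)) has_integral
     M * ((2 powr (1 - r) - y powr (1 - r)) / ((1 - r) * (2 - y)))) {0..1}"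
    by (rule has_integral_mult_right[OF powr_avg_integral[OF y r]])
  have "norm (avg n h y) \<le> integral {0..1} (\<lambda>t. M * (2 + t * (y - 2)) powr (- r))"
    unfolding avg_def
  proof (rule integral_norm_bound_integral)
    show "(\<lambda>t. t ^ n * h (2 + t * (y - 2))) integrable_on {0..1}"
      using avg_integrable[of h y n] h y by (auto simp: bnd_def)
    show "(\<lambda>t. M * (2 + t * (y - 2)) powr (- r)) integrable_on {0..1}" using i by blast
    fix t :: real assume t: "t \<in> {0..1}"
    have "\<bar>t ^ n\<bar> * \<bar>h (2 + t * (y - 2))\<bar> \<le> 1 * (M * (2 + t * (y - 2)) powr (- r))"
      using h t avg_arg[of y t] y by (intro mult_mono) (auto simp: bnd_def power_le_one)
    then show "norm (t ^ n * h (2 + t * (y - 2))) \<le> M * (2 + t * (y - 2)) powr (- r)"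
      by (simp add: abs_mult)
  qed
  then show ?thesis using integral_unique[OF i] by simp
qed

lemma avg_bound_large:
  assumes h: "bnd r M h" and y: "1 \<le> y" "y \<le> 3" and r: "0 \<le> r"
  shows "\<bar>avg n h y\<bar> \<le> M"
proof -
  have "norm (avg n h y) \<le> integral {0..1} (\<lambda>t::real. M)"
    unfolding avg_def
  proof (rule integral_norm_bound_integral)
    show "(\<lambda>t. t ^ n * h (2 + t * (y - 2))) integrable_on {0..1}"
      using avg_integrable[of h y n] h y by (auto simp: bnd_def)
    fix t :: real assume t: "t \<in> {0..1}"
    have a: "1 \<le> 2 + t * (y - 2)" using avg_arg_bounds[of y t] t y by (auto simp: min_def split: if_splits)
    have "\<bar>h (2 + t * (y - 2))\<bar> \<le> M * (2 + t * (y - 2)) powr (- r)"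
      using h avg_arg[of y t] t y by (auto simp: bnd_def)
    also have "\<dots> \<le> M * 1"
      using a r bnd_nonneg[OF h] by (intro mult_left_mono) (auto simp: powr_minus_divide ge_one_powr_ge_zero)
    finally have "\<bar>t ^ n\<bar> * \<bar>h (2 + t * (y - 2))\<bar> \<le> 1 * M"
      using t by (intro mult_mono) (auto simp: power_le_one)
    then show "norm (t ^ n * h (2 + t * (y - 2))) \<le> M"
      by (simp add: abs_mult)
  qed (rule integrable_const_ivl)
  then show ?thesis by simp
qed

lemma avg_diff:
  fixes f g :: "real \<Rightarrow> real"
  assumes "continuous_on {0<..3} f" "continuous_on {0<..3} g" "y \<in> {0<..3}"
  shows "avg n (\<lambda>y. f y - g y) y = avg n f y - avg n g y"
  unfolding avg_def right_diff_distrib[of "_ ^ _"]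
  by (rule integral_diff[OF avg_integrable avg_integrable]) (use assms in auto)

text \<open>Integrating s powr (-r) from y to 2 gives the order y powr (1 - r), and division by 2 -
  y is harmless for y < 1. That bound degenerates at y = 2, but for y \<ge> 1 the integrand is
  simply bounded by M.\<close>

lemma linop_avg:
  assumes r: "1 < r"
  shows "linop r (r - 1) (avg n)"
  unfolding linop_def
proof (intro conjI exI allI impI)
  define c where "c = 1 / (r - 1) + 3 powr (r - 1)"
  show "0 \<le> c" using r by (simp add: c_def)
  fix M h assume h: "bnd r M h"
  note M = bnd_nonneg[OF h]
  show "bnd (r - 1) (c * M) (avg n h)"
    unfolding bnd_def
  proof (intro conjI ballI)
    show "continuous_on {0<..3} (avg n h)"
      using h by (intro continuous_on_avg avg_arg) (auto simp: bnd_def)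
    fix y :: real assume y: "y \<in> {0<..3}"
    show "\<bar>avg n h y\<bar> \<le> c * M * y powr (- (r - 1))"
    proof (cases "y < 1")
      case True
      have "(2 powr (1 - r) - y powr (1 - r)) / ((1 - r) * (2 - y)) =
          (y powr (1 - r) - 2 powr (1 - r)) / ((r - 1) * (2 - y))"
        by (metis minus_diff_eq minus_divide_divide mult_minus_left)
      also have "\<dots> \<le> y powr (1 - r) / ((r - 1) * 1)"
        using True r y by (intro frac_le mult_left_mono) auto
      also have "\<dots> \<le> c * y powr (1 - r)" by (simp add: c_def distrib_right)
      finally show ?thesis
        using avg_bound_small[OF h, of y n] True y r mult_left_mono[OF _ M]
        by (fastforce simp: mult_ac)
    next
      case False
      have "1 = 3 powr (r - 1) * 3 powr (1 - r)" by (simp flip: powr_add)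
      also have "\<dots> \<le> 3 powr (r - 1) * y powr (1 - r)"
        using y r by (intro mult_left_mono powr_mono2') auto
      also have "\<dots> \<le> c * y powr (1 - r)" using r by (simp add: c_def distrib_right)
      finally have "M * 1 \<le> M * (c * y powr (1 - r))" using M by (rule mult_left_mono)
      then show ?thesis using avg_bound_large[OF h, of y n] False y r by (simp add: mult_ac)
    qed
  qed
qed (auto simp: bnd_def avg_diff)

lemma linop_avg_bounded:
  assumes r: "0 \<le> r" "r < 1"
  shows "linop r 0 (avg n)"
  unfolding linop_def
proof (intro conjI exI allI impI)
  define c where "c = 2 powr (1 - r) / (1 - r) + 1"
  show "0 \<le> c" using r by (simp add: c_def)
  fix M h assume h: "bnd r M h"
  note M = bnd_nonneg[OF h]
  show "bnd 0 (c * M) (avg n h)"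
    unfolding bnd_def
  proof (intro conjI ballI)
    show "continuous_on {0<..3} (avg n h)"
      using h by (intro continuous_on_avg avg_arg) (auto simp: bnd_def)
    fix y :: real assume y: "y \<in> {0<..3}"
    have "\<bar>avg n h y\<bar> \<le> c * M"
    proof (cases "y < 1")
      case True
      have "(2 powr (1 - r) - y powr (1 - r)) / ((1 - r) * (2 - y)) \<le> 2 powr (1 - r) / ((1 - r) * 1)"
        using True r y by (intro frac_le mult_left_mono) auto
      also have "\<dots> \<le> c" by (simp add: c_def)
      finally show ?thesis
        using avg_bound_small[OF h, of y n] True y r mult_left_mono[OF _ M]
        by (fastforce simp: mult_ac)
    next
      case False
      have "1 * M \<le> c * M" using M r by (intro mult_right_mono) (auto simp: c_def)
      then show ?thesis using avg_bound_large[OF h, of y n] False y r by simp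
    qed
    then show "\<bar>avg n h y\<bar> \<le> c * M * y powr (- 0)" using y by simp
  qed
qed (auto simp: bnd_def avg_diff)

text \<open>The integrand is cut off outside \<open>{0<..3}\<close> because \<open>bnd\<close> says
  nothing about the value at 0; r < 1 makes the singularity integrable.\<close>

definition int0 :: "(real \<Rightarrow> real) \<Rightarrow> real \<Rightarrow> real" where
  "int0 h y = integral {0..y} (\<lambda>t. if t \<in> {0<..3} then h t else 0)"

lemma int0_integrable:
  assumes h: "bnd r M h" and r: "r < 1" and y: "y \<in> {0..3}"
  shows "(\<lambda>t. if t \<in> {0<..3} then h t else 0) integrable_on {0..y}"
proof (rule measurable_bounded_by_integrable_imp_integrable)
  have "continuous_on (- {0<..3}) (\<lambda>t::real. 0 :: real)" by simp
  then have "(\<lambda>t. if t \<in> {0<..3} then h t else 0) \<in> borel_measurable borel"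
    using h by (intro borel_measurable_continuous_on_if) (auto simp: bnd_def)
  then show "(\<lambda>t. if t \<in> {0<..3} then h t else 0) \<in> borel_measurable (lebesgue_on {0..y})"
    by (intro measurable_restrict_space1 measurable_completion) simp
  show "(\<lambda>t. M * t powr (- r)) integrable_on {0..y}"
    using has_integral_powr_from_0[of "- r" y] r y by (intro integrable_on_mult_right) auto
  fix t :: real assume "t \<in> {0..y}"
  then show "norm (if t \<in> {0<..3} then h t else 0) \<le> M * t powr (- r)"
    using h bnd_nonneg[OF h] by (auto simp: bnd_def)
qed simp

lemma int0_bound:
  assumes h: "bnd r M h" and r: "r < 1" and y: "y \<in> {0<..3}"
  shows "\<bar>int0 h y\<bar> \<le> 1 / (1 - r) * M * y powr (- (r - 1))"
proof -
  have i: "((\<lambda>t. M * t powr (- r)) has_integral M * (y powr (- r + 1) / (- r + 1))) {0..y}"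
    using r y by (intro has_integral_mult_right has_integral_powr_from_0) auto
  have "norm (int0 h y) \<le> integral {0..y} (\<lambda>t. M * t powr (- r))"
    unfolding int0_def
  proof (rule integral_norm_bound_integral)
    show "(\<lambda>t. if t \<in> {0<..3} then h t else 0) integrable_on {0..y}"
      using int0_integrable[OF h r] y by auto
    show "(\<lambda>t. M * t powr (- r)) integrable_on {0..y}" using i by blast
    fix t :: real assume "t \<in> {0..y}"
    then show "norm (if t \<in> {0<..3} then h t else 0) \<le> M * t powr (- r)"
      using h bnd_nonneg[OF h] by (auto simp: bnd_def)
  qed
  then show ?thesis using integral_unique[OF i] by (simp add: algebra_simps)
qed

lemma DERIV_int0:
  assumes h: "bnd r M h" and r: "r < 1" and y: "y \<in> {0<..<3}"
  shows "(int0 h has_field_derivative h y) (at y)"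
proof -
  define a where "a = y / 2"
  have a: "0 < a" "a < y" using y by (auto simp: a_def)
  let ?f = "\<lambda>t. if t \<in> {0<..3} then h t else 0"
  have "continuous_on {a..3} ?f \<longleftrightarrow> continuous_on {a..3} h"
    by (rule continuous_on_cong) (use a in auto)
  moreover have "continuous_on {a..3} h"
    by (rule continuous_on_subset[of "{0<..3}"]) (use h a in \<open>auto simp: bnd_def\<close>)
  ultimately have "((\<lambda>x. integral {a..x} ?f) has_field_derivative ?f y) (at y within {a..3})"
    using a y by (intro integral_has_real_derivative) auto
  then have "((\<lambda>x. integral {a..x} ?f) has_field_derivative h y) (at y)"
    using a y by (simp add: at_within_Icc_at)
  then have "((\<lambda>x. integral {0..a} ?f + integral {a..x} ?f) has_field_derivative h y) (at y)"
    by (auto intro!: derivative_eq_intros)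
  then show ?thesis
  proof (rule has_field_derivative_transform_within_open)
    fix x assume x: "x \<in> {a<..<3}"
    show "integral {0..a} ?f + integral {a..x} ?f = int0 h x"
      unfolding int0_def using int0_integrable[OF h r, of x] a x
      by (intro Henstock_Kurzweil_Integration.integral_combine) auto
  qed (use a y in auto)
qed

lemma linop_int0:
  assumes r: "r < 1"
  shows "linop r (r - 1) int0"
  unfolding linop_def
proof (intro conjI exI allI impI ballI)
  show "0 \<le> 1 / (1 - r)" using r by simp
  fix M h assume h: "bnd r M h"
  have "continuous_on {0..3} (int0 h)"
    using indefinite_integral_continuous_1[OF int0_integrable[OF h r, of 3]] by (simp add: int0_def[abs_def])
  then have "continuous_on {0<..3} (int0 h)" by (rule continuous_on_subset) auto
  then show "bnd (r - 1) (1 / (1 - r) * M) (int0 h)"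
    using int0_bound[OF h r] by (simp add: bnd_def)
next
  fix M N f g and y :: real assume f: "bnd r M f" and g: "bnd r N g" and y: "y \<in> {0<..3}"
  let ?c = "\<lambda>h t. if t \<in> {0<..3::real} then h t else 0 :: real"
  have "?c (\<lambda>y. f y - g y) = (\<lambda>t. ?c f t - ?c g t)" by auto
  then show "int0 (\<lambda>y. f y - g y) y = int0 f y - int0 g y"
    unfolding int0_def using int0_integrable[OF f r, of y] int0_integrable[OF g r, of y] y
    by (simp only:) (intro integral_diff, auto)
qed

text \<open>\<open>S\<close> respects differences only on \<open>{0<..3}\<close>, so
  \<open>T\<close> has to ignore all other values.\<close>

lemma linop_comp:
  assumes S: "linop r s S" and T: "linop s q T" and cong: "\<And>f g y. (\<And>y. y \<in> {0<..3} \<Longrightarrow> f y = g y) \<Longrightarrow> y \<in> {0<..3} \<Longrightarrow> T f y = T g y"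
  shows "linop r q (\<lambda>h. T (S h))"
proof -
  obtain c where c: "0 \<le> c" "\<And>M h. bnd r M h \<Longrightarrow> bnd s (c * M) (S h)" using linop_bnd[OF S] by blast
  obtain d where d: "0 \<le> d" "\<And>M h. bnd s M h \<Longrightarrow> bnd q (d * M) (T h)" using linop_bnd[OF T] by blast
  have "T (S (\<lambda>y. f y - g y)) y = T (S f) y - T (S g) y"
    if "bnd r M f" "bnd r N g" "y \<in> {0<..3}" for M N f g y
  proof -
    have "T (S (\<lambda>y. f y - g y)) y = T (\<lambda>y. S f y - S g y) y"
      by (rule cong[OF linop_diff[OF S that(1,2)] that(3)])
    then show ?thesis using linop_diff[OF T c(2)[OF that(1)] c(2)[OF that(2)] that(3)] by simp
  qed
  moreover have "bnd q (d * c * M) (T (S h))" if "bnd r M h" for M h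
    using d(2)[OF c(2)[OF that]] by (simp add: mult.assoc)
  ultimately show ?thesis unfolding linop_def using c d by (intro conjI exI[of _ "d * c"]) auto
qed

lemma linop_mult:
  assumes T: "linop r s T" and \<phi>: "bnd q N \<phi>"
  shows "linop r (q + s) (\<lambda>h y. \<phi> y * T h y)"
proof -
  obtain c where c: "0 \<le> c" "\<And>M h. bnd r M h \<Longrightarrow> bnd s (c * M) (T h)" using linop_bnd[OF T] by blast
  have "bnd (q + s) (N * c * M) (\<lambda>y. \<phi> y * T h y)" if "bnd r M h" for M h
    using bnd_mult[OF \<phi> c(2)[OF that]] by (simp add: mult.assoc)
  moreover have "\<phi> y * T (\<lambda>y. f y - g y) y = \<phi> y * T f y - \<phi> y * T g y"
    if "bnd r M f" "bnd r M' g" "y \<in> {0<..3}" for M M' f g y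
    using linop_diff[OF T that] by (simp add: right_diff_distrib)
  ultimately show ?thesis
    unfolding linop_def using c bnd_nonneg[OF \<phi>] by (intro conjI exI[of _ "N * c"]) auto
qed

lemma avg_cong: "(\<And>y. y \<in> {0<..3} \<Longrightarrow> f y = g y) \<Longrightarrow> y \<in> {0<..3} \<Longrightarrow> avg n f y = avg n g y"
  unfolding avg_def by (rule integral_cong) (use avg_arg in auto)

lemma int0_cong: "(\<And>y. y \<in> {0<..3} \<Longrightarrow> f y = g y) \<Longrightarrow> int0 f y = int0 g y"
  unfolding int0_def by (rule integral_cong) auto

lemma bnd_shift: "bnd 0 2 (\<lambda>y. y - 2)"
  unfolding bnd_def by (auto intro!: continuous_intros)

text \<open>An antiderivative normalized at \<open>y = 2\<close> or at \<open>y = 0\<close>, depending on whether functions of order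
  \<open>y powr (- r)\<close> are integrable at 0.\<close>

definition antider :: "real \<Rightarrow> (real \<Rightarrow> real) \<Rightarrow> real \<Rightarrow> real" where
  "antider r = (if 1 < r then (\<lambda>h y. (y - 2) * avg 0 h y) else int0)"

lemma linop_antider: "r \<noteq> 1 \<Longrightarrow> linop r (r - 1) (antider r)"
  using linop_mult[OF linop_avg[of r 0] bnd_shift] linop_int0[of r] by (auto simp: antider_def)

lemma DERIV_antider:
  assumes "r \<noteq> 1" "bnd r M h" "y \<in> {0<..<3}"
  shows "(antider r h has_field_derivative h y) (at y)"
  using DERIV_avg[of h y 0] DERIV_int0[of r M h y] assms by (auto simp: antider_def bnd_def)

text \<open>Let \<open>J\<close> be the triple antiderivative of \<open>- 2 * f\<close> that vanishes to third order at \<open>y = 2\<close>. Then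
  \<open>defect f y = J 0 / 4 - J y / (2 - y)\<^sup>2\<close>. The first term is the choice of the free constant in
  \<open>H\<close> for which the defect vanishes at \<open>y = 0\<close>; it fixes \<open>U\<^sub>\<theta> (-1)\<close>.\<close>

definition defect_slope :: "(real \<Rightarrow> real) \<Rightarrow> real \<Rightarrow> real" where
  "defect_slope f y = 2 * (y - 2)\<^sup>2 * avg 1 (avg 0 f) y"

definition defect :: "(real \<Rightarrow> real) \<Rightarrow> real \<Rightarrow> real" where
  "defect f y = int0 (defect_slope f) 2 / 4 + (y - 2) * (2 * avg 2 (avg 1 (avg 0 f)) y)"

lemma linop_avg_avg: "2 < r \<Longrightarrow> linop r (r - 2) (\<lambda>f. avg 1 (avg 0 f))"
  using linop_comp[OF linop_avg[of r 0] linop_avg[of "r - 1" 1] avg_cong] by simp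

lemma linop_avg_avg_avg: "2 < r \<Longrightarrow> r < 3 \<Longrightarrow> linop r 0 (\<lambda>f. avg 2 (avg 1 (avg 0 f)))"
  using linop_comp[OF linop_avg_avg[of r] linop_avg_bounded[of "r - 2" 2] avg_cong] by simp

lemma linop_defect_slope:
  assumes "2 < r"
  shows "linop r (r - 2) defect_slope"
proof -
  have "bnd (0 + (0 + 0)) (\<bar>2\<bar> * (2 * 2)) (\<lambda>y. 2 * ((y - 2) * (y - 2)))"
    by (intro bnd_mult bnd_const bnd_shift)
  from linop_mult[OF linop_avg_avg[OF assms] this] show ?thesis
    by (simp add: defect_slope_def[abs_def] power2_eq_square)
qed

text \<open>Both sides are J y: \<open>defect_slope f\<close> is - J', hence
  \<open>int0 (defect_slope f) y\<close> is J 0 - J y. The left side is explicit at y = 2, the right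
  side at y = 0.\<close>

lemma defect_eq:
  assumes f: "bnd r M f" and r: "2 < r" "r < 3" and y: "y \<in> {0<..<3}"
  shows "(2 - y) ^ 3 * (2 * avg 2 (avg 1 (avg 0 f)) y) = int0 (defect_slope f) 2 - int0 (defect_slope f) y"
proof -
  obtain M1 where M1: "bnd (r - 2) M1 (defect_slope f)" using linop_bnd[OF linop_defect_slope] r f by metis
  have c1: "continuous_on {0<..3} (avg 0 f)"
    using f by (intro continuous_on_avg avg_arg) (auto simp: bnd_def)
  have c2: "continuous_on {0<..3} (avg 1 (avg 0 f))" by (rule continuous_on_avg[OF c1 avg_arg])
  let ?F = "\<lambda>y. 2 * ((y - 2) ^ Suc 2 * avg 2 (avg 1 (avg 0 f)) y) - int0 (defect_slope f) y"
  have "(?F has_field_derivative 0) (at y within {0<..<3})" if y: "y \<in> {0<..<3}" for y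
  proof -
    have "(?F has_field_derivative 2 * ((y - 2) ^ 2 * avg 1 (avg 0 f) y) - defect_slope f y) (at y)"
      using r y by (intro DERIV_diff DERIV_cmult DERIV_avg c2 DERIV_int0[OF M1]) auto
    moreover have "2 * ((y - 2) ^ 2 * avg 1 (avg 0 f) y) - defect_slope f y = 0"
      by (simp add: defect_slope_def)
    ultimately have "(?F has_field_derivative 0) (at y)" by (simp only:)
    then show ?thesis by (rule has_field_derivative_at_within)
  qed
  then obtain k where "\<And>y. y \<in> {0<..<3} \<Longrightarrow> ?F y = k"
    using has_field_derivative_zero_constant[of "{0<..<3::real}" ?F] by auto
  from this[OF y] this[of 2] have "?F y = ?F 2" by simp
  then show ?thesis by (simp add: power3_eq_cube algebra_simps)
qed

text \<open>The defect is (J 0 - J y) / (2 - y)^2 - J 0 (1 / (2 - y)^2 - 1/4). Near 0 the first part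
  is O(y powr (3 - r)) and the second O(y), which is no worse because 3 - r < 1. This cancellation
  is the purpose of J 0 / 4; for y \<ge> 1 boundedness suffices.\<close>

lemma linop_defect:
  assumes r: "2 < r" "r < 3"
  shows "linop r (r - 3) defect"
proof -
  obtain c where c: "0 \<le> c" "\<And>M h. bnd r M h \<Longrightarrow> bnd (r - 3) (c * M) (int0 (defect_slope h))"
    using linop_bnd[OF linop_comp[OF linop_defect_slope[OF r(1)] linop_int0 int0_cong]] r by auto
  obtain d where d: "0 \<le> d" "\<And>M h. bnd r M h \<Longrightarrow> bnd 0 (d * M) (avg 2 (avg 1 (avg 0 h)))"
    using linop_bnd[OF linop_avg_avg_avg[OF r]] by auto
  define e where "e = c * 2 powr (3 - r)"
  have e: "e \<ge> 0" using c by (simp add: e_def)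
  have E2: "\<bar>int0 (defect_slope f) 2\<bar> \<le> e * M" if "bnd r M f" for M f
    using c(2)[OF that] by (auto simp: bnd_def e_def mult_ac dest!: bspec[of _ _ 2])
  have "bnd (r - 3) ((2 * e + c + 2 * d) * M) (defect f)" if f: "bnd r M f" for M f
    unfolding bnd_def
  proof (intro conjI ballI)
    note M = bnd_nonneg[OF f]
    show "continuous_on {0<..3} (defect f)"
      using d(2)[OF f] unfolding defect_def[abs_def] by (intro continuous_intros) (auto simp: bnd_def)
    fix y :: real assume y: "y \<in> {0<..3}"
    show "\<bar>defect f y\<bar> \<le> (2 * e + c + 2 * d) * M * y powr (- (r - 3))"
    proof (cases "y < 1")
      case True
      define z where "z = 2 - y"
      have z: "1 < z" "z < 2" using True y by (auto simp: z_def)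
      let ?E = "int0 (defect_slope f)"
      have "z * (2 * avg 2 (avg 1 (avg 0 f)) y) = (?E 2 - ?E y) / z\<^sup>2"
        using defect_eq[OF f r, of y] True y z
        by (simp add: z_def[symmetric] power3_eq_cube power2_eq_square field_simps)
      then have "defect f y = ?E 2 / 4 - (?E 2 - ?E y) / z\<^sup>2"
        unfolding defect_def by (simp add: z_def algebra_simps)
      also have "\<dots> = - (?E 2 * ((4 - z\<^sup>2) / (4 * z\<^sup>2))) + ?E y / z\<^sup>2"
        using z by (simp add: field_simps)
      finally have D: "defect f y = - (?E 2 * ((4 - z\<^sup>2) / (4 * z\<^sup>2))) + ?E y / z\<^sup>2" .
      have z2: "1 \<le> z\<^sup>2" using z by simp
      have "(4 - z\<^sup>2) / (4 * z\<^sup>2) \<le> (4 - z\<^sup>2) / 4"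
        using z z2 power_mono[of z 2 2] by (intro divide_left_mono) auto
      also have "\<dots> \<le> y" using y by (simp add: z_def power2_eq_square algebra_simps)
      also have "y \<le> y powr (3 - r)"
        using True y r powr_mono'[of "3 - r" 1 y] by simp
      finally have "\<bar>?E 2\<bar> * ((4 - z\<^sup>2) / (4 * z\<^sup>2)) \<le> (e * M) * y powr (3 - r)"
        using E2[OF f] z2 power_mono[of z 2 2] z e M by (intro mult_mono) auto
      moreover have "\<bar>?E y\<bar> / z\<^sup>2 \<le> \<bar>?E y\<bar> / 1" using z2 by (intro divide_left_mono) auto
      moreover have "\<bar>?E y\<bar> \<le> c * M * y powr (3 - r)"
        using c(2)[OF f] y by (auto simp: bnd_def)
      moreover have "\<bar>?E 2 * ((4 - z\<^sup>2) / (4 * z\<^sup>2))\<bar> = \<bar>?E 2\<bar> * ((4 - z\<^sup>2) / (4 * z\<^sup>2))"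
        using z2 power_mono[of z 2 2] z by (simp add: abs_mult)
      moreover have "\<bar>?E y / z\<^sup>2\<bar> = \<bar>?E y\<bar> / z\<^sup>2" by simp
      ultimately have "\<bar>defect f y\<bar> \<le> (e * M) * y powr (3 - r) + c * M * y powr (3 - r)"
        unfolding D by linarith
      also have "\<dots> = (e + c) * (M * y powr (3 - r))" by (simp add: algebra_simps)
      also have "\<dots> \<le> (2 * e + c + 2 * d) * (M * y powr (3 - r))"
        using e d M by (intro mult_right_mono) auto
      finally show ?thesis by (simp add: mult_ac)
    next
      case False
      have "\<bar>avg 2 (avg 1 (avg 0 f)) y\<bar> \<le> d * M" using d(2)[OF f] y by (auto simp: bnd_def)
      moreover have "\<bar>y - 2\<bar> \<le> 1" using y False by auto
      ultimately have "\<bar>y - 2\<bar> * \<bar>2 * avg 2 (avg 1 (avg 0 f)) y\<bar> \<le> 1 * (2 * (d * M))"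
        by (intro mult_mono) auto
      then have "\<bar>defect f y\<bar> \<le> e * M / 4 + 2 * (d * M)"
        using E2[OF f] unfolding defect_def by (intro order_trans[OF abs_triangle_ineq] add_mono) (auto simp: abs_mult)
      also have "\<dots> \<le> ((2 * e + c + 2 * d) * M) * 1"
        using M e c(1) mult_nonneg_nonneg[OF e M] mult_nonneg_nonneg[OF c(1) M] by (simp add: algebra_simps)
      also have "\<dots> \<le> ((2 * e + c + 2 * d) * M) * y powr (- (r - 3))"
        using False r M e c d by (intro mult_left_mono) (auto intro: ge_one_powr_ge_zero)
      finally show ?thesis .
    qed
  qed
  moreover have "defect (\<lambda>y. f y - g y) y = defect f y - defect g y"
    if f: "bnd r M f" and g: "bnd r N g" and y: "y \<in> {0<..3}" for M N f g y
  proof -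
    have "int0 (defect_slope (\<lambda>y. f y - g y)) 2 = int0 (defect_slope f) 2 - int0 (defect_slope g) 2"
      using r by (intro linop_diff[OF linop_comp[OF linop_defect_slope[OF r(1)] linop_int0 int0_cong] f g]) auto
    then show ?thesis
      unfolding defect_def linop_diff[OF linop_avg_avg_avg[OF r] f g y]
      by (simp add: algebra_simps diff_divide_distrib)
  qed
  ultimately show ?thesis
    unfolding linop_def using e c d by (intro conjI exI[of _ "2 * e + c + 2 * d"]) auto
qed

section \<open>The fixed point problem\<close>

text \<open>The ball of radius 1/2 around 1 in the sup norm: m stays at least 1/2, so 1 / m is
  bounded and depends on m in a Lipschitz way.\<close>

definition near1 :: "(real \<Rightarrow> real) set" where
  "near1 = {m. continuous_on {0<..3} m \<and> (\<forall>y\<in>{0<..3}. \<bar>m y - 1\<bar> \<le> 1 / 2)}"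

text \<open>Lipschitz maps from the sup norm into functions of order r. The class is stable under
  products and under \<open>linop\<close>, so estimating the whole nonlinear operator amounts to
  adding up exponents.\<close>

definition lip :: "real \<Rightarrow> ((real \<Rightarrow> real) \<Rightarrow> real \<Rightarrow> real) \<Rightarrow> bool" where
  "lip r G \<longleftrightarrow> (\<exists>C\<ge>0. (\<forall>m\<in>near1. bnd r C (G m)) \<and>
     (\<forall>m1\<in>near1. \<forall>m2\<in>near1. \<forall>d. (\<forall>y\<in>{0<..3}. \<bar>m1 y - m2 y\<bar> \<le> d) \<longrightarrow>
        bnd r (C * d) (\<lambda>y. G m1 y - G m2 y)))"

lemma lipE:
  assumes "lip r G"
  obtains C where "0 \<le> C" "\<And>m. m \<in> near1 \<Longrightarrow> bnd r C (G m)"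
    "\<And>m1 m2 d. m1 \<in> near1 \<Longrightarrow> m2 \<in> near1 \<Longrightarrow> (\<And>y. y \<in> {0<..3} \<Longrightarrow> \<bar>m1 y - m2 y\<bar> \<le> d) \<Longrightarrow>
        bnd r (C * d) (\<lambda>y. G m1 y - G m2 y)"
  using assms unfolding lip_def by blast

lemma lipI:
  assumes "0 \<le> C" "\<And>m. m \<in> near1 \<Longrightarrow> bnd r C (G m)"
    "\<And>m1 m2 d. m1 \<in> near1 \<Longrightarrow> m2 \<in> near1 \<Longrightarrow> 0 \<le> d \<Longrightarrow> (\<And>y. y \<in> {0<..3} \<Longrightarrow> \<bar>m1 y - m2 y\<bar> \<le> d) \<Longrightarrow>
        bnd r (C * d) (\<lambda>y. G m1 y - G m2 y)"
  shows "lip r G"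
proof -
  have "0 \<le> d" if "\<forall>y\<in>{0<..3::real}. \<bar>m1 y - m2 y\<bar> \<le> d" for m1 m2 :: "real \<Rightarrow> real" and d
    using bspec[OF that, of 1] by (auto intro: order_trans[OF abs_ge_zero])
  then show ?thesis unfolding lip_def using assms by (intro exI[of _ C] conjI ballI allI impI) auto
qed

lemma lip_linop:
  assumes G: "lip r G" and T: "linop r s T"
  shows "lip s (\<lambda>m. T (G m))"
proof -
  obtain C where C: "0 \<le> C" "\<And>m. m \<in> near1 \<Longrightarrow> bnd r C (G m)"
    "\<And>m1 m2 d. m1 \<in> near1 \<Longrightarrow> m2 \<in> near1 \<Longrightarrow> (\<And>y. y \<in> {0<..3} \<Longrightarrow> \<bar>m1 y - m2 y\<bar> \<le> d) \<Longrightarrow>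
        bnd r (C * d) (\<lambda>y. G m1 y - G m2 y)" using lipE[OF G] by blast
  obtain c where c: "0 \<le> c" "\<And>M h. bnd r M h \<Longrightarrow> bnd s (c * M) (T h)" using linop_bnd[OF T] by blast
  show ?thesis
  proof (rule lipI[of "c * C"])
    fix m1 m2 d assume m: "m1 \<in> near1" "m2 \<in> near1" and d: "\<And>y. y \<in> {0<..3} \<Longrightarrow> \<bar>m1 y - m2 y\<bar> \<le> d"
    have "bnd s (c * (C * d)) (T (\<lambda>y. G m1 y - G m2 y))" using c(2)[OF C(3)[OF m d]] .
    then show "bnd s (c * C * d) (\<lambda>y. T (G m1) y - T (G m2) y)"
      using bnd_cong[OF linop_diff[OF T C(2)[OF m(1)] C(2)[OF m(2)]]] by (simp add: mult.assoc)
  qed (use c C in auto)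
qed

lemma lip_mult:
  assumes "lip r G" "lip s F"
  shows "lip (r + s) (\<lambda>m y. G m y * F m y)"
proof -
  obtain C where C: "0 \<le> C" "\<And>m. m \<in> near1 \<Longrightarrow> bnd r C (G m)"
    "\<And>m1 m2 d. m1 \<in> near1 \<Longrightarrow> m2 \<in> near1 \<Longrightarrow> (\<And>y. y \<in> {0<..3} \<Longrightarrow> \<bar>m1 y - m2 y\<bar> \<le> d) \<Longrightarrow>
        bnd r (C * d) (\<lambda>y. G m1 y - G m2 y)" using lipE[OF assms(1)] by blast
  obtain D where D: "0 \<le> D" "\<And>m. m \<in> near1 \<Longrightarrow> bnd s D (F m)"
    "\<And>m1 m2 d. m1 \<in> near1 \<Longrightarrow> m2 \<in> near1 \<Longrightarrow> (\<And>y. y \<in> {0<..3} \<Longrightarrow> \<bar>m1 y - m2 y\<bar> \<le> d) \<Longrightarrow>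
        bnd s (D * d) (\<lambda>y. F m1 y - F m2 y)" using lipE[OF assms(2)] by blast
  show ?thesis
  proof (rule lipI[of "2 * (C * D)"])
    fix m1 m2 d assume m: "m1 \<in> near1" "m2 \<in> near1" and d: "\<And>y. y \<in> {0<..3} \<Longrightarrow> \<bar>m1 y - m2 y\<bar> \<le> d"
    have "bnd (r + s) (C * d * D + C * (D * d))
        (\<lambda>y. (G m1 y - G m2 y) * F m1 y + G m2 y * (F m1 y - F m2 y))"
      using C D m d by (intro bnd_add bnd_mult) auto
    then show "bnd (r + s) (2 * (C * D) * d) (\<lambda>y. G m1 y * F m1 y - G m2 y * F m2 y)"
      by (simp add: algebra_simps)
  next
    fix m assume "m \<in> near1"
    then show "bnd (r + s) (2 * (C * D)) (\<lambda>y. G m y * F m y)"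
      using bnd_mono_const[OF bnd_mult[OF C(2) D(2)], of m m "2 * (C * D)"] C(1) D(1) by simp
  qed (use C D in auto)
qed

lemma lip_const: "bnd r N \<phi> \<Longrightarrow> lip r (\<lambda>m. \<phi>)"
  by (rule lipI[of N]) (auto simp: bnd_nonneg, auto simp: bnd_def bnd_nonneg intro!: mult_nonneg_nonneg
     dest: bnd_nonneg[unfolded bnd_def, OF conjI])

lemma lip_mono: "lip r G \<Longrightarrow> r \<le> s \<Longrightarrow> lip s G"
proof -
  assume G: "lip r G" and rs: "r \<le> s"
  obtain C where C: "0 \<le> C" "\<And>m. m \<in> near1 \<Longrightarrow> bnd r C (G m)"
    "\<And>m1 m2 d. m1 \<in> near1 \<Longrightarrow> m2 \<in> near1 \<Longrightarrow> (\<And>y. y \<in> {0<..3} \<Longrightarrow> \<bar>m1 y - m2 y\<bar> \<le> d) \<Longrightarrow>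
        bnd r (C * d) (\<lambda>y. G m1 y - G m2 y)" using lipE[OF G] by blast
  show ?thesis
    by (rule lipI[of "3 powr (s - r) * C"])
       (use C bnd_mono[OF C(2) rs] bnd_mono[OF C(3) rs] in \<open>auto simp: mult.assoc\<close>)
qed

lemma near1_bounds: "m \<in> near1 \<Longrightarrow> y \<in> {0<..3} \<Longrightarrow> 1 / 2 \<le> m y \<and> m y \<le> 3 / 2"
  unfolding near1_def using abs_le_D1[of "m y - 1" "1/2"] abs_le_D2[of "m y - 1" "1/2"] by force

lemma lip_ident: "lip 0 (\<lambda>m. m)"
proof (rule lipI[of "3/2"])
  fix m assume m: "m \<in> near1"
  then show "bnd 0 (3/2) m" using near1_bounds[OF m] unfolding bnd_def by (force simp: near1_def)
next
  fix m1 m2 d assume m: "m1 \<in> near1" "m2 \<in> near1" and "0 \<le> d" and d: "\<And>y. y \<in> {0<..3} \<Longrightarrow> \<bar>m1 y - m2 y\<bar> \<le> d"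
  then show "bnd 0 (3/2 * d) (\<lambda>y. m1 y - m2 y)"
    unfolding bnd_def using order_trans[OF d, of _ "3/2 * d"]
    by (auto simp: near1_def intro!: continuous_intros)
qed simp

lemma lip_inverse: "lip 0 (\<lambda>m y. 1 / m y)"
proof (rule lipI[of 4])
  fix m assume m: "m \<in> near1"
  have "1 / m y \<le> 1 / (1/2)" "m y > 0" if "y \<in> {0<..3}" for y
    using near1_bounds[OF m that] by (auto simp: divide_le_eq)
  then show "bnd 0 4 (\<lambda>y. 1 / m y)" using m unfolding bnd_def
    by (force simp: near1_def intro!: continuous_intros)
next
  fix m1 m2 d assume m: "m1 \<in> near1" "m2 \<in> near1" and "0 \<le> d" and d: "\<And>y. y \<in> {0<..3} \<Longrightarrow> \<bar>m1 y - m2 y\<bar> \<le> d"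
  have pos: "m1 y > 0" "m2 y > 0" if "y \<in> {0<..3}" for y
    using near1_bounds[OF m(1) that] near1_bounds[OF m(2) that] by auto
  have "\<bar>1 / m1 y - 1 / m2 y\<bar> \<le> 4 * d" if y: "y \<in> {0<..3}" for y
  proof -
    have "1 / 2 * (1 / 2) \<le> m1 y * m2 y"
      using near1_bounds[OF m(1) y] near1_bounds[OF m(2) y] by (intro mult_mono) auto
    moreover have "1 / m1 y - 1 / m2 y = (m2 y - m1 y) / (m1 y * m2 y)"
      using pos[OF y] by (simp add: field_simps)
    then have "\<bar>1 / m1 y - 1 / m2 y\<bar> = \<bar>m1 y - m2 y\<bar> / (m1 y * m2 y)"
      using pos[OF y] by (simp add: abs_minus_commute abs_mult)
    ultimately show ?thesis
      using d[OF y] \<open>0 \<le> d\<close> frac_le[of d "\<bar>m1 y - m2 y\<bar>" "1/4" "m1 y * m2 y"] by simp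
  qed
  then show "bnd 0 (4 * d) (\<lambda>y. 1 / m1 y - 1 / m2 y)"
    using m pos unfolding bnd_def by (force simp: near1_def intro!: continuous_intros)
qed simp

text \<open>\<epsilon> C \<le> 1/2 serves twice: it keeps the image within distance 1/2 of 1 and it
  gives the contraction factor 1/2. The size of the swirl is thus an output of the argument.\<close>

lemma lip_fixed_point:
  assumes T: "lip 0 T"
  obtains \<epsilon> m where "0 < \<epsilon>" "m \<in> near1" "\<And>y. y \<in> {0<..3} \<Longrightarrow> m y = 1 + \<epsilon> * T m y"
proof -
  obtain C where C: "0 \<le> C" "\<And>m. m \<in> near1 \<Longrightarrow> bnd 0 C (T m)"
    "\<And>m1 m2 d. m1 \<in> near1 \<Longrightarrow> m2 \<in> near1 \<Longrightarrow> (\<And>y. y \<in> {0<..3} \<Longrightarrow> \<bar>m1 y - m2 y\<bar> \<le> d) \<Longrightarrow>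
        bnd 0 (C * d) (\<lambda>y. T m1 y - T m2 y)" using lipE[OF T] by blast
  define \<epsilon> where "\<epsilon> = 1 / (2 * C + 2)"
  have \<epsilon>: "0 < \<epsilon>" "\<epsilon> * C \<le> 1 / 2" using C(1) by (auto simp: \<epsilon>_def field_simps)
  \<comment> \<open>\<open>\<sigma>\<close> maps the line onto \<open>{0<..3}\<close>, with right inverse \<open>\<rho>\<close>; functions on \<open>{0<..3}\<close> thereby become
    bounded continuous functions on the line, with no condition imposed at \<open>y = 0\<close>\<close>
  define \<sigma> :: "real \<Rightarrow> real" where "\<sigma> s = 3 / (1 + s\<^sup>2)" for s
  define \<rho> :: "real \<Rightarrow> real" where "\<rho> y = sqrt (3 / y - 1)" for y
  have \<sigma>: "\<sigma> s \<in> {0<..3}" for s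
    unfolding \<sigma>_def by (auto simp: add_pos_nonneg divide_le_eq)
  have \<sigma>\<rho>: "\<sigma> (\<rho> y) = y" if "y \<in> {0<..3}" for y
    using that by (simp add: \<sigma>_def \<rho>_def field_simps)
  have c\<sigma>: "continuous_on UNIV \<sigma>"
    unfolding \<sigma>_def[abs_def] by (intro continuous_intros) (metis add_pos_nonneg less_irrefl zero_le_power2 zero_less_one)
  have c\<rho>: "continuous_on {0<..3} \<rho>" unfolding \<rho>_def[abs_def] by (intro continuous_intros) auto
  define S where "S = cball (const_bcontfun 1 :: real \<Rightarrow>\<^sub>C real) (1/2)"
  define unf where "unf f = (\<lambda>y. apply_bcontfun f (\<rho> y))" for f :: "real \<Rightarrow>\<^sub>C real"
  define \<Phi> where "\<Phi> f = Bcontfun (\<lambda>s. 1 + \<epsilon> * T (unf f) (\<sigma> s))" for f :: "real \<Rightarrow>\<^sub>C real"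
  have unf: "unf f \<in> near1" if "f \<in> S" for f
  proof -
    have "\<bar>apply_bcontfun f s - 1\<bar> \<le> 1 / 2" for s
      using that dist_bounded[of f s "const_bcontfun 1"] unfolding S_def
      by (simp add: dist_commute dist_real_def abs_minus_commute)
    moreover have "continuous_on {0<..3} (unf f)"
      unfolding unf_def by (rule continuous_on_compose2[OF continuous_on_apply_bcontfun[of UNIV] c\<rho>]) auto
    ultimately show ?thesis by (auto simp: near1_def unf_def)
  qed
  have Tb: "\<bar>T m y\<bar> \<le> C" if "m \<in> near1" "y \<in> {0<..3}" for m y
    using C(2)[OF that(1)] that(2) by (auto simp: bnd_def)
  have \<Phi>: "apply_bcontfun (\<Phi> f) s = 1 + \<epsilon> * T (unf f) (\<sigma> s)" if "f \<in> S" for f s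
  proof -
    have "(\<lambda>s. 1 + \<epsilon> * T (unf f) (\<sigma> s)) \<in> bcontfun"
    proof (rule bcontfun_normI)
      have "continuous_on {0<..3} (T (unf f))" using C(2)[OF unf[OF that]] by (simp add: bnd_def)
      then have "continuous_on UNIV (\<lambda>s. T (unf f) (\<sigma> s))"
        by (rule continuous_on_compose2[OF _ c\<sigma>]) (use \<sigma> in auto)
      then show "continuous_on UNIV (\<lambda>s. 1 + \<epsilon> * T (unf f) (\<sigma> s))" by (intro continuous_intros)
      fix s
      have "\<epsilon> * \<bar>T (unf f) (\<sigma> s)\<bar> \<le> \<epsilon> * C" using Tb[OF unf[OF that] \<sigma>] \<epsilon> by (intro mult_left_mono) auto
      then show "norm (1 + \<epsilon> * T (unf f) (\<sigma> s)) \<le> 1 + \<epsilon> * C"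
        using \<epsilon>(1) by (intro order_trans[OF norm_triangle_ineq]) (auto simp: abs_mult)
    qed
    then show ?thesis unfolding \<Phi>_def by (simp add: Bcontfun_inverse)
  qed
  have "\<exists>!f\<in>S. \<Phi> f = f"
  proof (rule Banach_fix[of S "1/2"])
    show "complete S" unfolding S_def by (simp add: complete_eq_closed)
    show "S \<noteq> {}" by (simp add: S_def)
    show "\<Phi> ` S \<subseteq> S"
    proof safe
      fix f assume f: "f \<in> S"
      have "dist (\<Phi> f) (const_bcontfun 1) \<le> 1 / 2"
      proof (rule dist_bound)
        fix s
        have "\<bar>\<epsilon>\<bar> * \<bar>T (unf f) (\<sigma> s)\<bar> \<le> \<epsilon> * C" using Tb[OF unf[OF f] \<sigma>] \<epsilon> by (intro mult_mono) auto
        also note \<epsilon>(2)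
        finally show "dist (apply_bcontfun (\<Phi> f) s) (apply_bcontfun (const_bcontfun 1) s) \<le> 1 / 2"
          by (simp add: \<Phi>[OF f] dist_real_def abs_mult)
      qed
      then show "\<Phi> f \<in> S" by (simp add: S_def dist_commute)
    qed
    fix f g assume fg: "f \<in> S" "g \<in> S"
    show "dist (\<Phi> f) (\<Phi> g) \<le> 1 / 2 * dist f g"
    proof (rule dist_bound)
      fix s
      have "\<bar>unf f y - unf g y\<bar> \<le> dist f g" for y
        using dist_bounded[of f "\<rho> y" g] by (simp add: unf_def dist_real_def)
      then have "bnd 0 (C * dist f g) (\<lambda>y. T (unf f) y - T (unf g) y)"
        using C(3)[OF unf unf] fg by blast
      then have "\<bar>T (unf f) (\<sigma> s) - T (unf g) (\<sigma> s)\<bar> \<le> C * dist f g"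
        using \<sigma>[of s] by (auto simp: bnd_def)
      then have "\<epsilon> * \<bar>T (unf f) (\<sigma> s) - T (unf g) (\<sigma> s)\<bar> \<le> \<epsilon> * (C * dist f g)"
        using \<epsilon> by (intro mult_left_mono) auto
      also have "\<dots> \<le> 1 / 2 * dist f g"
        using mult_right_mono[OF \<epsilon>(2), of "dist f g"] by (simp add: mult.assoc)
      finally show "dist (apply_bcontfun (\<Phi> f) s) (apply_bcontfun (\<Phi> g) s) \<le> 1 / 2 * dist f g"
        using \<epsilon>(1) fg by (simp add: \<Phi> dist_real_def abs_mult flip: right_diff_distrib)
    qed
  qed auto
  then obtain f where f: "f \<in> S" "\<Phi> f = f" by blast
  have "unf f y = 1 + \<epsilon> * T (unf f) y" if "y \<in> {0<..3}" for y
    using \<Phi>[OF f(1), of "\<rho> y"] f(2) \<sigma>\<rho>[OF that] by (simp add: unf_def)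
  with that[OF \<epsilon>(1) unf[OF f(1)]] show ?thesis by blast
qed

section \<open>Solutions with swirl\<close>

text \<open>In terms of \<open>w = y powr \<alpha> * m\<close>: \<open>weight\<close> is \<open>1 / w\<^sup>2\<close>, \<open>source\<close> is \<open>- U\<^sub>\<phi> U\<^sub>\<phi>' / (\<epsilon> (1 - x\<^sup>2))\<close>,
  \<open>potential\<close> is \<open>K\<close>, and \<open>slope\<close> is \<open>m' / \<epsilon>\<close>.\<close>

definition weight :: "real \<Rightarrow> (real \<Rightarrow> real) \<Rightarrow> real \<Rightarrow> real" where
  "weight \<alpha> m y = y powr (- 2 * \<alpha>) * (1 / m y * (1 / m y))"

definition source :: "real \<Rightarrow> (real \<Rightarrow> real) \<Rightarrow> real \<Rightarrow> real" where
  "source \<alpha> m y = avg 0 (weight \<alpha> m) y * weight \<alpha> m y * (1 / y)"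

definition potential :: "real \<Rightarrow> (real \<Rightarrow> real) \<Rightarrow> real \<Rightarrow> real" where
  "potential \<alpha> m y = defect (source \<alpha> m) y * (1 / 2 * (1 / y * (1 / y)))"

text \<open>Because y powr \<alpha> solves the unperturbed equation, m satisfies m'' + (2 \<alpha> /
  y) m' = \<epsilon> K m, in divergence form \<open>(y powr (2 * \<alpha>) * m')' = \<epsilon> * y
  powr (2 * \<alpha>) * K * m\<close>. The flux is
  \<open>y powr (2 * \<alpha>) * m' / \<epsilon>\<close>.\<close>

definition flux :: "real \<Rightarrow> real \<Rightarrow> (real \<Rightarrow> real) \<Rightarrow> real \<Rightarrow> real" where
  "flux \<alpha> r m = antider r (\<lambda>y. y powr (2 * \<alpha>) * (potential \<alpha> m y * m y))"

definition slope :: "real \<Rightarrow> real \<Rightarrow> (real \<Rightarrow> real) \<Rightarrow> real \<Rightarrow> real" where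
  "slope \<alpha> r m y = y powr (- 2 * \<alpha>) * flux \<alpha> r m y"

lemma bnd_inverse: "bnd 1 1 (\<lambda>y. 1 / y)"
  unfolding bnd_def by (auto intro!: continuous_intros simp: powr_minus_divide)

lemma lip_weight:
  assumes "2 * \<alpha> \<le> p"
  shows "lip p (weight \<alpha>)"
proof -
  have "lip (2 * \<alpha> + (0 + 0)) (\<lambda>m y. y powr (- 2 * \<alpha>) * (1 / m y * (1 / m y)))"
    using bnd_powr[of "- 2 * \<alpha>"] by (intro lip_mult lip_inverse lip_const[where N = 1]) simp
  then have "lip (2 * \<alpha>) (weight \<alpha>)" by (simp add: weight_def[abs_def])
  then show ?thesis using assms by (rule lip_mono)
qed

text \<open>Orders at y = 0, given p for \<open>weight\<close>: p - 1 for its average, 2 p for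
  \<open>source\<close>, 2 p - 3 for its defect, 2 p - 1 for \<open>potential\<close> and 2 p - 2 <
  1 for \<open>slope\<close>. The condition p > 1 puts \<open>weight\<close> and
  \<open>source\<close> in the range of \<open>linop_avg\<close> and \<open>linop_defect\<close>; if
  2 \<alpha> is smaller, the bound on \<open>weight\<close> is relaxed to p.\<close>

lemma lip_source:
  assumes "2 * \<alpha> \<le> p" "1 < p"
  shows "lip (2 * p) (source \<alpha>)"
proof -
  have "lip (p - 1 + p + 1) (\<lambda>m y. avg 0 (weight \<alpha> m) y * weight \<alpha> m y * (1 / y))"
    using assms by (intro lip_mult lip_linop[OF lip_weight linop_avg] lip_weight lip_const[OF bnd_inverse])
  then show ?thesis by (simp add: source_def[abs_def])
qed

lemma lip_potential:
  assumes "2 * \<alpha> \<le> p" "1 < p" "p < 3 / 2"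
  shows "lip (2 * p - 1) (potential \<alpha>)"
proof -
  have "lip (2 * p - 3 + (0 + (1 + 1))) (\<lambda>m y. defect (source \<alpha> m) y * (1 / 2 * (1 / y * (1 / y))))"
    using assms by (intro lip_mult lip_linop[OF lip_source linop_defect] lip_const[OF bnd_inverse]
      lip_const[OF bnd_const]) auto
  then show ?thesis by (simp add: potential_def[abs_def])
qed

lemma lip_integrand:
  assumes "2 * \<alpha> \<le> p" "1 < p" "p < 3 / 2"
  shows "lip (2 * p - 1 - 2 * \<alpha>) (\<lambda>m y. y powr (2 * \<alpha>) * (potential \<alpha> m y * m y))"
proof -
  have "lip (- (2 * \<alpha>) + (2 * p - 1 + 0)) (\<lambda>m y. y powr (2 * \<alpha>) * (potential \<alpha> m y * m y))"
    using assms by (intro lip_mult lip_potential lip_ident lip_const[OF bnd_powr])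
  then show ?thesis by (simp add: algebra_simps)
qed

lemma lip_slope:
  assumes "2 * \<alpha> \<le> p" "1 < p" "p < 3 / 2" "p \<noteq> 1 + \<alpha>"
  shows "lip (2 * p - 2) (slope \<alpha> (2 * p - 1 - 2 * \<alpha>))"
proof -
  have "bnd (2 * \<alpha>) 1 (\<lambda>y. y powr (- 2 * \<alpha>))" using bnd_powr[of "- 2 * \<alpha>"] by simp
  then have "lip (2 * \<alpha> + (2 * p - 1 - 2 * \<alpha> - 1))
     (\<lambda>m y. y powr (- 2 * \<alpha>) * antider (2 * p - 1 - 2 * \<alpha>)
          (\<lambda>y. y powr (2 * \<alpha>) * (potential \<alpha> m y * m y)) y)"
    using assms by (intro lip_mult lip_linop[OF lip_integrand linop_antider] lip_const) auto
  then show ?thesis by (simp add: slope_def[abs_def] flux_def algebra_simps)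
qed

lemma lip_bnd: "lip r G \<Longrightarrow> m \<in> near1 \<Longrightarrow> \<exists>M. bnd r M (G m)"
  unfolding lip_def by blast

section \<open>From the fixed point back to the differential equations\<close>

lemma Ck_real_shift:
  "Ck_real n f {0<..<3} \<Longrightarrow> Ck_real n (\<lambda>x. f (1 + x)) {-1<..<2}"
  by (rule Ck_real_compose[of n "\<lambda>x. 1 + x" _ f "{0<..<3}"]) (auto intro!: Ck_real_add Ck_real_const Ck_real_id)

lemma DERIV_shift_one: "(f has_field_derivative D) (at (1 + x)) \<Longrightarrow> ((\<lambda>x. f (1 + x)) has_field_derivative D) (at x)"
  for f :: "real \<Rightarrow> real"
  by (simp add: DERIV_shift add.commute[of 1])

lemma Ck_real_inverse_id: "Ck_real n (\<lambda>y. 1 / y) {0<..<3 :: real}"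
  by (rule Ck_real_inverse) (auto intro: Ck_real_id)

lemma DERIV_unique_on:
  assumes "open S" "x \<in> S" "\<And>x. x \<in> S \<Longrightarrow> f x = f' x"
    "(f has_field_derivative D) (at x)" "(f' has_field_derivative D') (at x)"
  shows "D = (D' :: real)"
  using DERIV_unique[OF has_field_derivative_transform_within_open[OF assms(4,1,2,3)] assms(5)] by simp

text \<open>The auxiliary exponent \<open>p\<close> satisfies \<open>1 / w\<^sup>2 = O(y powr (- p))\<close>; \<open>p < 3/2\<close> makes the triple
  antiderivative of \<open>source\<close> continuous at \<open>y = 0\<close>, and \<open>p \<noteq> 1 + \<alpha>\<close> avoids a logarithm.\<close>

locale swirl_construction =
  fixes \<alpha> p \<epsilon> :: real and m :: "real \<Rightarrow> real"
  assumes p: "2 * \<alpha> \<le> p" "1 < p" "p < 3 / 2" "p \<noteq> 1 + \<alpha>"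
    and \<epsilon>: "0 < \<epsilon>"
    and m: "m \<in> near1"
    and fixed: "\<And>y. y \<in> {0<..3} \<Longrightarrow> m y = 1 + \<epsilon> * int0 (slope \<alpha> (2 * p - 1 - 2 * \<alpha>) m) y"
begin

abbreviation "W \<equiv> weight \<alpha> m"
abbreviation "F \<equiv> source \<alpha> m"
abbreviation "N \<equiv> slope \<alpha> (2 * p - 1 - 2 * \<alpha>) m"
abbreviation "Pot \<equiv> potential \<alpha> m"

lemma m_pos: "y \<in> {0<..3} \<Longrightarrow> 0 < m y"
  using near1_bounds[OF m, of y] by auto

lemma DERIV_m: "y \<in> {0<..<3} \<Longrightarrow> (m has_field_derivative \<epsilon> * N y) (at y)"
proof -
  assume y: "y \<in> {0<..<3}"
  obtain M where "bnd (2 * p - 2) M N" using lip_bnd[OF lip_slope m] p by blast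
  then have "(int0 N has_field_derivative N y) (at y)" using p y by (intro DERIV_int0) auto
  then have "((\<lambda>y. 1 + \<epsilon> * int0 N y) has_field_derivative \<epsilon> * N y) (at y)"
    by (auto intro!: derivative_eq_intros)
  then show ?thesis
    by (rule has_field_derivative_transform_within_open[of _ _ _ "{0<..<3}"]) (use y fixed in auto)
qed

lemma DERIV_N:
  assumes y: "y \<in> {0<..<3}"
  shows "(N has_field_derivative Pot y * m y - 2 * \<alpha> / y * N y) (at y)"
proof -
  let ?r = "2 * p - 1 - 2 * \<alpha>"
  obtain M where "bnd ?r M (\<lambda>y. y powr (2 * \<alpha>) * (Pot y * m y))"
    using lip_bnd[OF lip_integrand m] p by blast
  then have "(flux \<alpha> ?r m has_field_derivative y powr (2 * \<alpha>) * (Pot y * m y)) (at y)"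
    unfolding flux_def using p y by (intro DERIV_antider) auto
  moreover have "((\<lambda>y. y powr (- 2 * \<alpha>)) has_field_derivative - 2 * \<alpha> * y powr (- 2 * \<alpha> - 1)) (at y)"
    using has_real_derivative_powr[of y "- 2 * \<alpha>"] y by simp
  ultimately have "(N has_field_derivative (- 2 * \<alpha> * y powr (- 2 * \<alpha> - 1)) * flux \<alpha> ?r m y
      + (y powr (2 * \<alpha>) * (Pot y * m y)) * y powr (- 2 * \<alpha>)) (at y)"
    unfolding slope_def[abs_def] by (intro DERIV_mult)
  moreover have "y powr (- 2 * \<alpha> - 1) = y powr (- 2 * \<alpha>) / y" using y by (simp add: powr_diff)
  moreover have "y powr (2 * \<alpha>) * y powr (- 2 * \<alpha>) = 1" using y by (simp flip: powr_add)
  then have "(y powr (2 * \<alpha>) * (Pot y * m y)) * y powr (- 2 * \<alpha>) = Pot y * m y"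
    by (metis mult.commute mult.left_commute mult_1)
  moreover have "- 2 * \<alpha> * (y powr (- 2 * \<alpha>) / y) * flux \<alpha> ?r m y + Pot y * m y
      = Pot y * m y - 2 * \<alpha> / y * N y"
    by (simp add: slope_def)
  ultimately show ?thesis by (simp only:)
qed

text \<open>Bootstrap: m' and N' are expressed by m, N, averages and powers of y, none of which
  loses smoothness, so each round gains one derivative. \<open>int0\<close> enters
  \<open>defect\<close> only through a constant.\<close>

lemma Ck_real_m_N: "Ck_real n m {0<..<3} \<and> Ck_real n N {0<..<3}"
proof (induction n)
  case 0
  have "continuous_on {0<..<3} m" "continuous_on {0<..<3} N"
    by (auto intro!: continuous_at_imp_continuous_on DERIV_isCont[OF DERIV_m] DERIV_isCont[OF DERIV_N])
  then show ?case by simp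
next
  case (Suc n)
  then have mN: "Ck_real n m {0<..<3}" "Ck_real n N {0<..<3}" by auto
  note s = Ck_real_mult Ck_real_const Ck_real_id Ck_real_add Ck_real_diff Ck_real_avg
  have 1: "Ck_real n (\<lambda>y. 1 / m y) {0<..<3}"
    by (rule Ck_real_inverse) (use mN m_pos in auto)
  have W: "Ck_real n W {0<..<3}"
    unfolding weight_def[abs_def] by (intro s 1 Ck_real_powr) auto
  have F: "Ck_real n F {0<..<3}"
    unfolding source_def[abs_def] by (intro s Ck_real_inverse_id W)
  have P: "Ck_real n Pot {0<..<3}"
    unfolding potential_def[abs_def] defect_def by (intro s Ck_real_inverse_id F)
  have "Ck_real n (\<lambda>y. \<epsilon> * N y) {0<..<3}" by (intro s mN)
  moreover have "Ck_real n (\<lambda>y. Pot y * m y - 2 * \<alpha> * (1 / y) * N y) {0<..<3}"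
    by (intro s P Ck_real_inverse_id mN)
  ultimately show ?case
    unfolding Ck_real.simps using DERIV_m DERIV_N
    by (intro conjI exI[of _ "\<lambda>y. \<epsilon> * N y"] exI[of _ "\<lambda>y. Pot y * m y - 2 * \<alpha> * (1 / y) * N y"]) auto
qed

lemma continuous_W: "continuous_on {0<..3} W"
  using lip_bnd[OF lip_weight m] p by (auto simp: bnd_def)

lemma continuous_F: "continuous_on {0<..3} F"
  using lip_bnd[OF lip_source m] p by (auto simp: bnd_def)

lemma W_pos: "y \<in> {0<..3} \<Longrightarrow> 0 < W y"
  using m_pos[of y] by (simp add: weight_def)

text \<open>This is 2 w' / w for w = y powr \<alpha> * m, the profile g in the variable y = 1 + x.
  As \<open>W\<close> is 1 / w^2, its logarithmic derivative is the negative of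
  \<open>drift\<close>.\<close>

definition drift where "drift y = 2 * \<alpha> / y + 2 * \<epsilon> * (N y / m y)"

lemma DERIV_W:
  assumes y: "y \<in> {0<..<3}"
  shows "(W has_field_derivative - drift y * W y) (at y)"
proof -
  have mp: "m y > 0" using m_pos y by simp
  have "((\<lambda>y. y powr (- 2 * \<alpha>)) has_field_derivative - 2 * \<alpha> * y powr (- 2 * \<alpha> - 1)) (at y)"
    using has_real_derivative_powr[of y "- 2 * \<alpha>"] y by simp
  moreover have "((\<lambda>y. 1 / m y * (1 / m y)) has_field_derivative - 2 * \<epsilon> * N y / m y * (1 / m y * (1 / m y))) (at y)"
    using mp by (auto intro!: derivative_eq_intros DERIV_m y simp: field_simps)
  ultimately have "(W has_field_derivative (- 2 * \<alpha> * y powr (- 2 * \<alpha> - 1)) * (1 / m y * (1 / m y))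
      + (- 2 * \<epsilon> * N y / m y * (1 / m y * (1 / m y))) * y powr (- 2 * \<alpha>)) (at y)"
    unfolding weight_def[abs_def] by (rule DERIV_mult)
  moreover have "y powr (- 2 * \<alpha> - 1) = y powr (- 2 * \<alpha>) / y" using y by (simp add: powr_diff)
  ultimately show ?thesis by (simp add: weight_def drift_def algebra_simps)
qed

text \<open>The Riccati form of the equation for w: the derivative of 2 w' / w is 2 w'' / w - (2 w'
  / w)^2 / 2.\<close>

lemma DERIV_drift:
  assumes y: "y \<in> {0<..<3}"
  shows "(drift has_field_derivative 2 * \<alpha> * (\<alpha> - 1) / y\<^sup>2 + 2 * \<epsilon> * Pot y - (drift y)\<^sup>2 / 2) (at y)"
proof -
  have mp: "m y > 0" using m_pos y by simp
  have "((\<lambda>y. N y / m y) has_field_derivative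
      ((Pot y * m y - 2 * \<alpha> / y * N y) * m y - N y * (\<epsilon> * N y)) / (m y * m y)) (at y)"
    using mp by (intro DERIV_divide DERIV_m DERIV_N y) auto
  moreover have "((\<lambda>y. 2 * \<alpha> / y) has_field_derivative - (2 * \<alpha> / y\<^sup>2)) (at y)"
    using y by (auto intro!: derivative_eq_intros simp: power2_eq_square)
  ultimately have "(drift has_field_derivative - (2 * \<alpha> / y\<^sup>2) + 2 * \<epsilon> *
     (((Pot y * m y - 2 * \<alpha> / y * N y) * m y - N y * (\<epsilon> * N y)) / (m y * m y))) (at y)"
    unfolding drift_def[abs_def] by (intro DERIV_add DERIV_cmult)
  moreover have "((Pot y * m y - 2 * \<alpha> / y * N y) * m y - N y * (\<epsilon> * N y)) / (m y * m y) =
      Pot y - 2 * \<alpha> / y * (N y / m y) - \<epsilon> * (N y / m y)\<^sup>2"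
    using mp by (simp add: diff_divide_distrib power2_eq_square)
  moreover have "- (2 * \<alpha> / y\<^sup>2) + 2 * \<epsilon> * (Pot y - 2 * \<alpha> / y * n - \<epsilon> * n\<^sup>2) =
      2 * \<alpha> * (\<alpha> - 1) / y\<^sup>2 + 2 * \<epsilon> * Pot y - (2 * \<alpha> / y + 2 * \<epsilon> * n)\<^sup>2 / 2" for n
    using y by (simp add: power2_eq_square field_simps)
  ultimately show ?thesis by (simp only: drift_def)
qed

text \<open>N has order 2 p - 2 < 1. The limit removes the correction to 2 \<alpha> in y * drift y
  and thereby fixes the value 4 \<alpha> at the south pole.\<close>

lemma y_N_tendsto_0: "((\<lambda>y. y * N y) \<longlongrightarrow> 0) (at_right 0)"
proof -
  obtain M where M: "bnd (2 * p - 2) M N" using lip_bnd[OF lip_slope m] p by blast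
  have "((\<lambda>y. M * y powr (3 - 2 * p)) \<longlongrightarrow> M * 0 powr (3 - 2 * p)) (at_right 0)"
    using p by (intro tendsto_intros tendsto_powr') (auto simp: eventually_at_filter)
  then have lim: "((\<lambda>y. M * y powr (3 - 2 * p)) \<longlongrightarrow> 0) (at_right 0)" by simp
  have "eventually (\<lambda>y. y \<in> {0<..<3}) (at_right (0::real))" by (rule eventually_at_right_real) simp
  then have "eventually (\<lambda>y. norm (y * N y) \<le> M * y powr (3 - 2 * p)) (at_right 0)"
  proof eventually_elim
    case (elim y)
    have "\<bar>N y\<bar> \<le> M * y powr (- (2 * p - 2))" using M elim by (auto simp: bnd_def)
    then have "y * \<bar>N y\<bar> \<le> y * (M * y powr (- (2 * p - 2)))" using elim by (intro mult_left_mono) auto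
    moreover have "y * y powr (- (2 * p - 2)) = y powr (3 - 2 * p)"
      using elim powr_mult_base[of y "- (2 * p - 2)"] by (simp add: algebra_simps)
    ultimately show ?case using elim by (simp add: abs_mult mult_ac)
  qed
  then show ?thesis by (rule Lim_null_comparison[OF _ lim])
qed

definition E2 where "E2 = int0 (defect_slope F) 2"

text \<open>H as a function of y: (2 - y)^2 times 2 \<alpha> (\<alpha> - 1) + \<epsilon>
  \<open>defect F y\<close>, expanded into the products \<open>(y - 2) ^ Suc n * avg n\<close> that
  \<open>DERIV_avg\<close> differentiates. Three derivatives remove the quadratic part and leave the
  source.\<close>

definition h0 where "h0 y = 2 * \<alpha> * (\<alpha> - 1) * (y - 2)\<^sup>2
   + \<epsilon> * ((y - 2)\<^sup>2 * E2 / 4 + 2 * ((y - 2) ^ Suc 2 * avg 2 (avg 1 (avg 0 F)) y))"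
definition h1 where "h1 y = 4 * \<alpha> * (\<alpha> - 1) * (y - 2)
   + \<epsilon> * ((y - 2) * E2 / 2 + 2 * ((y - 2) ^ Suc 1 * avg 1 (avg 0 F) y))"
definition h2 where "h2 y = 4 * \<alpha> * (\<alpha> - 1) + \<epsilon> * (E2 / 2 + 2 * ((y - 2) ^ Suc 0 * avg 0 F y))"

lemma DERIV_h:
  assumes y: "y \<in> {0<..<3}"
  shows "(h0 has_field_derivative h1 y) (at y)" "(h1 has_field_derivative h2 y) (at y)"
    "(h2 has_field_derivative 2 * \<epsilon> * F y) (at y)"
proof -
  have c1: "continuous_on {0<..3} (avg 0 F)" by (rule continuous_on_avg[OF continuous_F avg_arg])
  have c2: "continuous_on {0<..3} (avg 1 (avg 0 F))" by (rule continuous_on_avg[OF c1 avg_arg])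
  have "(h0 has_field_derivative 2 * \<alpha> * (\<alpha> - 1) * (2 * (y - 2))
      + \<epsilon> * (2 * (y - 2) * E2 / 4 + 2 * ((y - 2) ^ 2 * avg 1 (avg 0 F) y))) (at y)"
    unfolding h0_def[abs_def]
    by (intro DERIV_add DERIV_cmult DERIV_avg c2 y) (auto intro!: derivative_eq_intros)
  moreover have "2 * \<alpha> * (\<alpha> - 1) * (2 * (y - 2))
      + \<epsilon> * (2 * (y - 2) * E2 / 4 + 2 * ((y - 2) ^ 2 * avg 1 (avg 0 F) y)) = h1 y"
    by (simp add: h1_def power2_eq_square) (simp add: field_simps)
  ultimately show "(h0 has_field_derivative h1 y) (at y)" by (simp only:)
  have "(h1 has_field_derivative 4 * \<alpha> * (\<alpha> - 1) * 1
      + \<epsilon> * (E2 / 2 + 2 * ((y - 2) ^ 1 * avg 0 F y))) (at y)"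
    unfolding h1_def[abs_def]
    by (intro DERIV_add DERIV_cmult DERIV_avg c1 y) (auto intro!: derivative_eq_intros)
  then show "(h1 has_field_derivative h2 y) (at y)" by (simp add: h2_def)
  have "(h2 has_field_derivative 0 + \<epsilon> * (0 + 2 * ((y - 2) ^ 0 * F y))) (at y)"
    unfolding h2_def[abs_def]
    by (intro DERIV_add DERIV_cmult DERIV_avg continuous_F y DERIV_const)
  then show "(h2 has_field_derivative 2 * \<epsilon> * F y) (at y)" by (simp add: mult_ac)
qed

definition g where "g x = drift (1 + x)"
text \<open>(1 - x^2) k is the antiderivative of - sqrt \<epsilon> / w^2 that vanishes at the north
  pole; the average carries out the division by 1 - x.\<close>

definition k where "k x = sqrt \<epsilon> * (avg 0 W (1 + x) * (1 / (1 + x)))"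

lemma Ck_real_g: "Ck_real n g {-1<..<2}"
proof -
  have "Ck_real n (\<lambda>y. 1 / m y) {0<..<3}"
    by (rule Ck_real_inverse) (use Ck_real_m_N m_pos in auto)
  then have "Ck_real n (\<lambda>y. 2 * \<alpha> * (1 / y) + 2 * \<epsilon> * (N y * (1 / m y))) {0<..<3}"
    using Ck_real_m_N Ck_real_inverse_id by (intro Ck_real_add Ck_real_mult Ck_real_const) auto
  then have "Ck_real n drift {0<..<3}" by (simp add: drift_def[abs_def])
  then show ?thesis unfolding g_def[abs_def] by (rule Ck_real_shift)
qed

lemma Ck_real_k: "Ck_real n k {-1<..<2}"
proof -
  have "Ck_real n (\<lambda>y. 1 / m y) {0<..<3}"
    by (rule Ck_real_inverse) (use Ck_real_m_N m_pos in auto)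
  then have "Ck_real n W {0<..<3}"
    unfolding weight_def[abs_def] by (intro Ck_real_mult Ck_real_powr) auto
  then have "Ck_real n (\<lambda>y. sqrt \<epsilon> * (avg 0 W y * (1 / y))) {0<..<3}"
    using Ck_real_inverse_id by (intro Ck_real_mult Ck_real_const Ck_real_avg)
  then show ?thesis unfolding k_def[abs_def] by (rule Ck_real_shift)
qed

lemma DERIV_swirl:
  assumes x: "x \<in> {-1<..<2}"
  shows "((\<lambda>x. (1 - x\<^sup>2) * k x) has_field_derivative - sqrt \<epsilon> * W (1 + x)) (at x)"
proof (rule has_field_derivative_transform_within_open[of _ _ _ "{-1<..<2}"])
  have "((\<lambda>y. - sqrt \<epsilon> * ((y - 2) ^ Suc 0 * avg 0 W y)) has_field_derivative
      - sqrt \<epsilon> * ((1 + x - 2) ^ 0 * W (1 + x))) (at (1 + x))"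
    using x by (intro DERIV_cmult DERIV_avg continuous_W) auto
  then show "((\<lambda>x. - sqrt \<epsilon> * ((1 + x - 2) ^ Suc 0 * avg 0 W (1 + x))) has_field_derivative
      - sqrt \<epsilon> * W (1 + x)) (at x)"
    using DERIV_shift_one[of "\<lambda>y. - sqrt \<epsilon> * ((y - 2) ^ Suc 0 * avg 0 W y)"] by simp
  fix x :: real assume x: "x \<in> {-1<..<2}"
  have "1 - x\<^sup>2 = (1 - x) * (1 + x)" by (simp add: power2_eq_square algebra_simps)
  then have "(1 - x\<^sup>2) * k x = (1 - x) * sqrt \<epsilon> * avg 0 W (1 + x) * ((1 + x) * (1 / (1 + x)))"
    by (simp only: k_def mult_ac)
  also have "(1 + x) * (1 / (1 + x)) = 1" using x by simp
  finally show "- sqrt \<epsilon> * ((1 + x - 2) ^ Suc 0 * avg 0 W (1 + x)) = (1 - x\<^sup>2) * k x"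
    by (simp add: algebra_simps)
qed (use x in auto)

text \<open>H = \<open>h0\<close> holds on a whole open interval, so uniqueness of derivatives gives
  \<open>H3\<close> without formulas for \<open>g2\<close>, \<open>g3\<close> and \<open>g4\<close>.
  The interval reaches past the north pole x = 1.\<close>

lemma solution: "axisymmetric_NS_solution (\<lambda>x. (1 - x\<^sup>2) * g x) (\<lambda>x. (1 - x\<^sup>2) * k x)"
proof -
  let ?I = "{-1<..<2} :: real set"
  obtain g1 g2 g3 g4 where dg: "\<And>x. x \<in> ?I \<Longrightarrow> (g has_field_derivative g1 x) (at x) \<and>
      (g1 has_field_derivative g2 x) (at x) \<and> (g2 has_field_derivative g3 x) (at x) \<and>
      (g3 has_field_derivative g4 x) (at x)"
    using Ck_real_four_derivs[OF open_greaterThanLessThan Ck_real_g] by blast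
  obtain k1 k2 where dk: "\<And>x. x \<in> ?I \<Longrightarrow> (k has_field_derivative k1 x) (at x) \<and>
      (k1 has_field_derivative k2 x) (at x)"
    using Ck_real_four_derivs[OF open_greaterThanLessThan Ck_real_k] by metis
  interpret axi_profile ?I g g1 g2 g3 g4 k k1 k2
    using dg dk by unfold_locales auto
  have V1: "V1 x = - sqrt \<epsilon> * W (1 + x)" if x: "x \<in> ?I" for x
  proof (rule DERIV_unique[OF _ DERIV_swirl[OF x]])
    show "((\<lambda>x. (1 - x\<^sup>2) * k x) has_field_derivative V1 x) (at x)"
      using dk[OF x] by (auto intro!: derivative_eq_intros simp: V1_def power2_eq_square algebra_simps)
  qed
  have g1: "g1 x = 2 * \<alpha> * (\<alpha> - 1) / (1 + x)\<^sup>2 + 2 * \<epsilon> * Pot (1 + x) - (g x)\<^sup>2 / 2" if x: "x \<in> ?I" for x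
  proof (rule DERIV_unique)
    show "(g has_field_derivative g1 x) (at x)" using dg[OF x] by simp
    show "(g has_field_derivative 2 * \<alpha> * (\<alpha> - 1) / (1 + x)\<^sup>2 + 2 * \<epsilon> * Pot (1 + x) - (g x)\<^sup>2 / 2) (at x)"
      using DERIV_shift_one[OF DERIV_drift[of "1 + x"]] x unfolding g_def[abs_def] by simp
  qed
  have H: "H x = h0 (1 + x)" if x: "x \<in> ?I" for x
  proof -
    define y where "y = 1 + x"
    have y: "y > 0" and xy: "x = y - 1" using x by (auto simp: y_def)
    have "(1 - x\<^sup>2)\<^sup>2 = (y - 2)\<^sup>2 * y\<^sup>2" by (simp add: xy power2_eq_square algebra_simps)
    moreover have "g1 x + (g x)\<^sup>2 / 2 = 2 * \<alpha> * (\<alpha> - 1) / y\<^sup>2 + \<epsilon> * defect F y / y\<^sup>2"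
      by (simp add: g1[OF x] potential_def y_def power2_eq_square)
    ultimately have "H x = (y - 2)\<^sup>2 * (2 * \<alpha> * (\<alpha> - 1) + \<epsilon> * defect F y)"
      using y by (simp add: H_def q_def distrib_left)
    moreover have "z\<^sup>2 * (c + \<epsilon> * (e / 4 + z * (2 * a))) = c * z\<^sup>2 + \<epsilon> * (z\<^sup>2 * e / 4 + 2 * (z ^ Suc 2 * a))"
      for a c e z :: real
      by (simp add: power2_eq_square power3_eq_cube algebra_simps)
    ultimately show ?thesis by (simp only: h0_def defect_def E2_def y_def[symmetric])
  qed
  have H1: "H1 x = h1 (1 + x)" if x: "x \<in> ?I" for x
    by (rule DERIV_unique_on[OF open_I x H dH[OF x] DERIV_shift_one[OF DERIV_h(1)]]) (use x in auto)
  have H2: "H2 x = h2 (1 + x)" if x: "x \<in> ?I" for x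
    by (rule DERIV_unique_on[OF open_I x H1 dH1[OF x] DERIV_shift_one[OF DERIV_h(2)]]) (use x in auto)
  have H3: "H3 x = 2 * \<epsilon> * F (1 + x)" if x: "x \<in> ?I" for x
    by (rule DERIV_unique_on[OF open_I x H2 dH2[OF x] DERIV_shift_one[OF DERIV_h(3)]]) (use x in auto)
  show ?thesis
  proof (rule axisymmetric_NS_solutionI)
    show "Ck_real n g ?I" "Ck_real n k ?I" for n by (rule Ck_real_g Ck_real_k)+
    fix x assume x: "x \<in> ?I"
    have "sqrt \<epsilon> * sqrt \<epsilon> = \<epsilon>" using \<epsilon> by simp
    then show "H3 x + 2 * k x * V1 x = 0"
      by (simp add: H3[OF x] V1[OF x] k_def source_def)
    have "(1 - x\<^sup>2) * k2 x - 4 * x * k1 x - 2 * k x = - sqrt \<epsilon> * (- drift (1 + x) * W (1 + x))"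
    proof (rule DERIV_unique_on[OF open_I x])
      show "(V1 has_field_derivative (1 - x\<^sup>2) * k2 x - 4 * x * k1 x - 2 * k x) (at x)"
        unfolding V1_def[abs_def]
        by (auto intro!: derivative_eq_intros dk dk1 x simp: power2_eq_square algebra_simps)
      show "((\<lambda>x. - sqrt \<epsilon> * W (1 + x)) has_field_derivative - sqrt \<epsilon> * (- drift (1 + x) * W (1 + x))) (at x)"
        using x by (intro DERIV_cmult DERIV_shift_one DERIV_W) auto
    qed (rule V1)
    then show "swirl_eq x = 0" by (simp add: swirl_eq_def V1[OF x] g_def)
  qed auto
qed

lemma nonzero_swirl: "\<not> zero_swirl (\<lambda>x. (1 - x\<^sup>2) * k x)"
proof
  assume "zero_swirl (\<lambda>x. (1 - x\<^sup>2) * k x)"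
  then have z: "(1 - x\<^sup>2) * k x = 0" if "x \<in> {-1<..<1}" for x using that by (simp add: zero_swirl_def)
  have "- sqrt \<epsilon> * W (1 + 0) = 0"
    by (rule DERIV_unique_on[of "{-1<..<1}" 0 _ "\<lambda>x. 0", OF _ _ z DERIV_swirl]) auto
  then show False using W_pos[of 1] \<epsilon> by simp
qed

lemma limit: "((\<lambda>x. (1 - x\<^sup>2) * g x) \<longlongrightarrow> 4 * \<alpha>) (at_right (-1))"
proof -
  have lim: "((\<lambda>y. (2 - y) * (2 * \<alpha> + 2 * \<epsilon> * (y * N y * (1 / m y)))) \<longlongrightarrow>
      (2 - 0) * (2 * \<alpha> + 2 * \<epsilon> * 0)) (at_right 0)"
  proof (intro tendsto_intros)
    have "eventually (\<lambda>y. y \<in> {0<..<3}) (at_right (0::real))" by (rule eventually_at_right_real) simp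
    then have "eventually (\<lambda>y. norm (y * N y * (1 / m y)) \<le> \<bar>y * N y\<bar> * 2) (at_right 0)"
    proof eventually_elim
      case (elim y)
      then have "\<bar>1 / m y\<bar> \<le> 2" using near1_bounds[OF m, of y] by (auto simp: divide_le_eq)
      then show ?case unfolding real_norm_def abs_mult[of "y * N y"] by (intro mult_left_mono) auto
    qed
    moreover have "((\<lambda>y. \<bar>y * N y\<bar> * 2) \<longlongrightarrow> \<bar>0\<bar> * 2) (at_right 0)"
      by (intro tendsto_intros y_N_tendsto_0)
    ultimately show "((\<lambda>y. y * N y * (1 / m y)) \<longlongrightarrow> 0) (at_right 0)"
      unfolding abs_zero mult_zero_left by (rule Lim_null_comparison)
  qed
  have "filterlim (\<lambda>x::real. 1 + x) (at_right 0) (at_right (-1))"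
    by (auto simp: filterlim_at eventually_at_right_field intro!: tendsto_eq_intros exI[of _ 0])
  from filterlim_compose[OF lim this]
  have "((\<lambda>x. (2 - (1 + x)) * (2 * \<alpha> + 2 * \<epsilon> * ((1 + x) * N (1 + x) * (1 / m (1 + x))))) \<longlongrightarrow> 4 * \<alpha>)
      (at_right (-1))" by simp
  moreover have "eventually (\<lambda>x. (2 - (1 + x)) * (2 * \<alpha> + 2 * \<epsilon> * ((1 + x) * N (1 + x) * (1 / m (1 + x)))) =
      (1 - x\<^sup>2) * g x) (at_right (-1))"
  proof (rule eventually_mono)
    show "eventually (\<lambda>x. x \<in> {-1<..<1}) (at_right (-1 :: real))"
      by (rule eventually_at_right_real) simp
    fix x :: real assume elim: "x \<in> {-1<..<1}"
    define y where "y = 1 + x"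
    have y: "y > 0" and xy: "x = y - 1" using elim by (auto simp: y_def)
    have "1 - x\<^sup>2 = (2 - y) * y" by (simp add: xy power2_eq_square algebra_simps)
    then have "(1 - x\<^sup>2) * g x = (2 - y) * (y * drift y)" by (simp add: g_def y_def)
    also have "y * drift y = 2 * \<alpha> + 2 * \<epsilon> * (y * N y * (1 / m y))"
      using y by (simp add: drift_def distrib_left)
    finally show "(2 - (1 + x)) * (2 * \<alpha> + 2 * \<epsilon> * ((1 + x) * N (1 + x) * (1 / m (1 + x)))) = (1 - x\<^sup>2) * g x"
      by (simp only: y_def)
  qed
  ultimately show ?thesis by (rule Lim_transform_eventually)
qed

end

theorem corollary1p1:
  shows "(\<forall>\<tau>::real. \<tau> < 3 \<longrightarrow>
            (\<exists>U\<^sub>\<theta> U\<^sub>\<phi>. axisymmetric_NS_solution U\<^sub>\<theta> U\<^sub>\<phi> \<and> \<not> zero_swirl U\<^sub>\<phi> \<and>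
                      (U\<^sub>\<theta> \<longlongrightarrow> \<tau>) (at_right (-1)))) \<and>
         (\<forall>U\<^sub>\<theta> U\<^sub>\<phi> \<tau>. axisymmetric_NS_solution U\<^sub>\<theta> U\<^sub>\<phi> \<and>
                      (U\<^sub>\<theta> \<longlongrightarrow> \<tau>) (at_right (-1)) \<and> \<tau> \<ge> 3 \<longrightarrow>
            zero_swirl U\<^sub>\<phi>)"
proof (intro conjI allI impI)
  fix \<tau> :: real
  assume \<tau>: "\<tau> < 3"
  define \<alpha> where "\<alpha> = \<tau> / 4"
  have \<alpha>: "\<alpha> < 3 / 4" using \<tau> by (simp add: \<alpha>_def)
  \<comment> \<open>The order handed to \<open>antider\<close> is r = 2 p - 1 - 2 \<alpha>. For
    \<alpha> < 1/2 a choice p > 1 + \<alpha> makes r > 1, and integration starts at y = 2. For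
    \<alpha> \<ge> 1/2 every p < 3/2 is below 1 + \<alpha>, so r < 1 and integration starts at 0;
    there 2 \<alpha> < 3/2 leaves room for p.\<close>
  obtain p where p: "2 * \<alpha> \<le> p" "1 < p" "p < 3 / 2" "p \<noteq> 1 + \<alpha>"
  proof (cases "\<alpha> < 1 / 2")
    case True
    then have "max 1 (1 + \<alpha>) < 3 / 2" by (simp only: max_less_iff_conj) simp
    then obtain p where "max 1 (1 + \<alpha>) < p" "p < 3 / 2" using dense by blast
    with True that[of p] show ?thesis by simp
  next
    case False
    then have "2 * \<alpha> < 3 / 2" using \<alpha> by simp
    then obtain p where "2 * \<alpha> < p" "p < 3 / 2" using dense by blast
    with False that[of p] show ?thesis by simp
  qed
  have "lip (2 * p - 2 - 1) (\<lambda>m. int0 (slope \<alpha> (2 * p - 1 - 2 * \<alpha>) m))"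
    using p by (intro lip_linop[OF lip_slope linop_int0]) auto
  then have "lip 0 (\<lambda>m. int0 (slope \<alpha> (2 * p - 1 - 2 * \<alpha>) m))"
    by (rule lip_mono) (use p in simp)
  then obtain \<epsilon> m where "0 < \<epsilon>" "m \<in> near1"
    "\<And>y. y \<in> {0<..3} \<Longrightarrow> m y = 1 + \<epsilon> * int0 (slope \<alpha> (2 * p - 1 - 2 * \<alpha>) m) y"
    using lip_fixed_point by blast
  then interpret swirl_construction \<alpha> p \<epsilon> m using p by unfold_locales
  have "4 * \<alpha> = \<tau>" by (simp add: \<alpha>_def)
  then show "\<exists>U\<^sub>\<theta> U\<^sub>\<phi>. axisymmetric_NS_solution U\<^sub>\<theta> U\<^sub>\<phi> \<and> \<not> zero_swirl U\<^sub>\<phi> \<and>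
                      (U\<^sub>\<theta> \<longlongrightarrow> \<tau>) (at_right (-1))"
    using solution nonzero_swirl limit by metis
next
  fix U V :: "real \<Rightarrow> real" and \<tau> :: real
  assume *: "axisymmetric_NS_solution U V \<and> (U \<longlongrightarrow> \<tau>) (at_right (-1)) \<and> 3 \<le> \<tau>"
  then obtain U1 V1 H1 H2 where "\<forall>x\<in>{-1<..<1}.
       (U has_field_derivative U1 x) (at x) \<and> (V has_field_derivative V1 x) (at x) \<and>
       (V1 has_field_derivative - (U x / (1 - x\<^sup>2)) * V1 x) (at x) \<and>
       ((\<lambda>x. (1 - x\<^sup>2) * U1 x + 2 * x * U x + (U x)\<^sup>2 / 2) has_field_derivative H1 x) (at x) \<and>
       (H1 has_field_derivative H2 x) (at x) \<and>
       (H2 has_field_derivative - 2 * V x * V1 x / (1 - x\<^sup>2)) (at x)"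
    using axisymmetric_NS_solutionD(2) by blast
  then interpret swirl_ode U V U1 V1 H1 H2 \<tau>
    using * axisymmetric_NS_solutionD(1)[of U V] by unfold_locales auto
  show "zero_swirl V" by (simp add: zero_swirl_def swirl_zero)
qed

end
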